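(* The constant term of $E_\beta(g,\nu,1)$ along the Siegel parabolic $P_\alpha$ is (as meromorphic functions of $\nu\in\mathbb C$) $$C_\beta^\alpha(g,\nu,1)=C^\alpha_{\beta,s_\beta}(g,\nu,1)+C^\alpha_{\beta,s_\beta s_\alpha s_\beta}(g,\nu,1),$$ where $$\begin{aligned} C^\alpha_{\beta,s_\beta}(g,\nu,1)&=E\Bigl(-n_1+\tfrac{y_1}{y_2}i,\ \tfrac{\nu+1}2\Bigr)y_1^{\nu/2+1}y_2^{\nu/2+1},\\ C^\alpha_{\beta,s_\beta s_\alpha s_\beta}(g,\nu,1)&=\frac{\Lambda(\nu)}{\Lambda(\nu+1)}\frac{\Lambda(\nu+1)}{\Lambda(\nu+2)}E\Bigl(-n_1+\tfrac{y_1}{y_2}i,\ \tfrac{\nu-1}2\Bigr)y_1^{-\nu/2+1}y_2^{-\nu/2+1}. \end{aligned}$$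
   Context: Let $J=\begin{pmatrix}0&I_2\\-I_2&0\end{pmatrix}$, $G=\mathrm{Sp}(4,\mathbb R)=\{g\in\mathrm{GL}(4,\mathbb R): g^\top Jg=J\}$, $\Gamma=\mathrm{Sp}(4,\mathbb Z)$, $K=\left\{\begin{pmatrix}A&B\\-B&A\end{pmatrix}: A+iB\in U(2)\right\}$. Every $g\in G/K$ has a unique (Iwasawa) representative $\begin{pmatrix}1&n_1&n_2&n_3\\0&1&n_4&n_5\\0&0&1&0\\0&0&-n_1&1\end{pmatrix}\mathrm{diag}(y_1,y_2,y_1^{-1},y_2^{-1})$ with $n_3=n_1n_5+n_4$, $y_1,y_2>0$; $n_1,y_1,y_2$ in the claim are these coordinates. Let $P_\beta=\begin{pmatrix}*&*&*&*\\0&*&*&*\\0&0&*&0\\0&*&*&*\end{pmatrix}\cap G$ be the Jacobi parabolic, $I_\beta(g,\nu)=y_1^{\nu+2}$ and $E_\beta(g,\nu,1)=\sum_{\gamma\in(P_\beta\cap\Gamma)\backslash\Gamma}I_\beta(\gamma g,\nu)$, continued meromorphically in $\nu\in\mathbb C$. The Siegel parabolic $P_\alpha$ (elements of $G$ with zero lower-left $2\times2$ block) has unipotent radical $N_\alpha=\left\{\begin{pmatrix}I_2&S\\0&I_2\end{pmatrix}:S^\top=S\right\}$, with $d\eta$ the Lebesgue measure in the entries of $S$. The constant term is $C_\beta^\alpha(g,\nu,1)=\int_{N_\alpha(\mathbb Z)\backslash N_\alpha(\mathbb R)}E_\beta(\eta g,\nu,1)\,d\eta$. The subscripts (Weyl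 group elements) are labels for the terms. $E(z,s)=\frac12\sum_{\delta\in\Gamma_{\infty,2}\backslash\mathrm{SL}(2,\mathbb Z)}\mathrm{Im}(\delta z)^{s+1/2}$, $\Gamma_{\infty,2}=\{\begin{pmatrix}1&b\\0&1\end{pmatrix}:b\in\mathbb Z\}$, meromorphically continued in $s$. $\Lambda(s)=\pi^{-s/2}\Gamma(s/2)\zeta(s)$. *)

theory Defs
  imports "HOL-Complex_Analysis.Complex_Analysis"
begin

no_notation fps_nth (infixl "$" 75)  (* clashes with vec_nth *)

section \<open>Meromorphic functions on the complex plane\<close>

text \<open>Meromorphic functions are identified when they agree off a closed discrete set, since
  HOL functions also take (irrelevant) values at poles and at removable singularities.\<close>

definition mero_eq :: "(complex \<Rightarrow> complex) \<Rightarrow> (complex \<Rightarrow> complex) \<Rightarrow> bool" where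
  "mero_eq f g \<longleftrightarrow>
     f meromorphic_on UNIV \<and> g meromorphic_on UNIV \<and> (\<forall>\<^sub>\<approx>s\<in>UNIV. f s = g s)"

text \<open>The meromorphic continuation to the whole plane of a function given on the half plane
  \<open>Re s > \<sigma>\<close>. Asking for a nicely meromorphic function (value 0 at poles, no removable
  singularities) makes it unique as a HOL function.\<close>

definition mero_cont :: "real \<Rightarrow> (complex \<Rightarrow> complex) \<Rightarrow> complex \<Rightarrow> complex" where
  "mero_cont \<sigma> f =
     (THE F. F nicely_meromorphic_on UNIV \<and> (\<forall>s. Re s > \<sigma> \<longrightarrow> F s = f s))"

section \<open>The symplectic group of degree 4\<close>

definition blocks ::
  "'a::zero^2^2 \<Rightarrow> 'a^2^2 \<Rightarrow> 'a^2^2 \<Rightarrow> 'a^2^2 \<Rightarrow> 'a^4^4" where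
  "blocks A B C D = vector
     [vector [A$1$1, A$1$2, B$1$1, B$1$2],
      vector [A$2$1, A$2$2, B$2$1, B$2$2],
      vector [C$1$1, C$1$2, D$1$1, D$1$2],
      vector [C$2$1, C$2$2, D$2$1, D$2$2]]"

definition J :: "real^4^4" where
  "J = blocks 0 (mat 1) (- mat 1) 0"

definition Sp4R :: "(real^4^4) set" where
  "Sp4R = {g. invertible g \<and> transpose g ** J ** g = J}"

definition Sp4Z :: "(real^4^4) set" where
  "Sp4Z = {g \<in> Sp4R. \<forall>i j. g$i$j \<in> \<int>}"

definition U2 :: "(complex^2^2) set" where
  "U2 = {M. (\<chi> i j. cnj (M$j$i)) ** M = mat 1}"

definition K :: "(real^4^4) set" where
  "K = {blocks A B (- B) A | A B. (\<chi> i j. Complex (A$i$j) (B$i$j)) \<in> U2}"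

definition P_beta :: "(real^4^4) set" where
  "P_beta = {g \<in> Sp4R. g$2$1 = 0 \<and> g$3$1 = 0 \<and> g$3$2 = 0 \<and> g$3$4 = 0 \<and> g$4$1 = 0}"

section \<open>Iwasawa coordinates\<close>

definition iwasawa_rep ::
  "real \<Rightarrow> real \<Rightarrow> real \<Rightarrow> real \<Rightarrow> real \<Rightarrow> real \<Rightarrow> real \<Rightarrow> real^4^4" where
  "iwasawa_rep n1 n2 n3 n4 n5 y1 y2 =
     (vector [vector [1, n1, n2, n3],
              vector [0, 1, n4, n5],
              vector [0, 0, 1, 0],
              vector [0, 0, - n1, 1]] :: real^4^4) **
     vector [vector [y1, 0, 0, 0],
             vector [0, y2, 0, 0],
             vector [0, 0, inverse y1, 0],
             vector [0, 0, 0, inverse y2]]"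

definition is_iwasawa ::
  "real^4^4 \<Rightarrow> real \<Rightarrow> real \<Rightarrow> real \<Rightarrow> real \<Rightarrow> real \<Rightarrow> real \<Rightarrow> real \<Rightarrow> bool" where
  "is_iwasawa g n1 n2 n3 n4 n5 y1 y2 \<longleftrightarrow>
     n3 = n1 * n5 + n4 \<and> y1 > 0 \<and> y2 > 0 \<and>
     (\<exists>k\<in>K. g = iwasawa_rep n1 n2 n3 n4 n5 y1 y2 ** k)"

definition iwa_n1 :: "real^4^4 \<Rightarrow> real" where
  "iwa_n1 g = (THE n1. \<exists>n2 n3 n4 n5 y1 y2. is_iwasawa g n1 n2 n3 n4 n5 y1 y2)"

definition iwa_y1 :: "real^4^4 \<Rightarrow> real" where
  "iwa_y1 g = (THE y1. \<exists>n1 n2 n3 n4 n5 y2. is_iwasawa g n1 n2 n3 n4 n5 y1 y2)"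

definition iwa_y2 :: "real^4^4 \<Rightarrow> real" where
  "iwa_y2 g = (THE y2. \<exists>n1 n2 n3 n4 n5 y1. is_iwasawa g n1 n2 n3 n4 n5 y1 y2)"

section \<open>Eisenstein series\<close>

text \<open>The sum of \<open>f \<gamma>\<close> over the right cosets \<open>H \<gamma>\<close> in \<open>H \ \<Gamma>\<close>. The summand is evaluated at a
  chosen representative, so this is meaningful for left \<open>H\<close>-invariant \<open>f\<close> only.\<close>

definition coset_sum ::
  "('a::semiring_1^'n^'n) set \<Rightarrow> ('a^'n^'n) set \<Rightarrow> ('a^'n^'n \<Rightarrow> complex) \<Rightarrow> complex" where
  "coset_sum H \<Gamma> f =
     (\<Sum>\<^sub>\<infinity>c \<in> (\<lambda>\<gamma>. (\<lambda>h. h ** \<gamma>) ` H) ` \<Gamma>. f (SOME \<gamma>. \<gamma> \<in> c))"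

definition I_beta :: "real^4^4 \<Rightarrow> complex \<Rightarrow> complex" where
  "I_beta g \<nu> = complex_of_real (iwa_y1 g) powr (\<nu> + 2)"

text \<open>The series converges absolutely exactly for \<open>Re \<nu> > 2\<close>: it is half the sum of
  \<open>norm (v v* g) powr (- \<nu> - 2)\<close> over the primitive integral row vectors \<open>v\<close> of length 4.\<close>

definition E_beta :: "real^4^4 \<Rightarrow> complex \<Rightarrow> complex" where
  "E_beta g = mero_cont 2 (\<lambda>\<nu>. coset_sum (P_beta \<inter> Sp4Z) Sp4Z (\<lambda>\<gamma>. I_beta (\<gamma> ** g) \<nu>))"

text \<open>\<open>n_alpha s\<close>, for \<open>s\<close> in \<open>real^3\<close>, runs through the unipotent radical of the Siegel
  parabolic; the integral points correspond to integral \<open>s\<close>, so that the half-open unit cube is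
  a fundamental domain for the quotient of the real by the integral points.\<close>

definition n_alpha :: "real^3 \<Rightarrow> real^4^4" where
  "n_alpha s = blocks (mat 1) (vector [vector [s$1, s$2], vector [s$2, s$3]]) 0 (mat 1)"

definition constant_term :: "real^4^4 \<Rightarrow> complex \<Rightarrow> complex" where
  "constant_term g \<nu> =
     (LINT s : {s. \<forall>i. 0 \<le> s$i \<and> s$i < 1} | lborel. E_beta (n_alpha s ** g) \<nu>)"

definition SL2Z :: "(int^2^2) set" where
  "SL2Z = {\<delta>. det \<delta> = 1}"

definition Gamma_inf2 :: "(int^2^2) set" where
  "Gamma_inf2 = {vector [vector [1, b], vector [0, 1]] | b. True}"

definition frac_linear :: "int^2^2 \<Rightarrow> complex \<Rightarrow> complex" where
  "frac_linear \<delta> z = (of_int (\<delta>$1$1) * z + of_int (\<delta>$1$2)) / (of_int (\<delta>$2$1) * z + of_int (\<delta>$2$2))"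

text \<open>The series converges absolutely for \<open>Re s > 1/2\<close>.\<close>

definition E_SL2 :: "complex \<Rightarrow> complex \<Rightarrow> complex" where
  "E_SL2 z = mero_cont (1/2) (\<lambda>s. 1/2 *
     coset_sum Gamma_inf2 SL2Z (\<lambda>\<delta>. complex_of_real (Im (frac_linear \<delta> z)) powr (s + 1/2)))"

section \<open>The completed zeta function\<close>

definition zeta :: "complex \<Rightarrow> complex" where
  "zeta = mero_cont 1 (\<lambda>s. \<Sum>n. of_nat (Suc n) powr (- s))"

definition Lambda :: "complex \<Rightarrow> complex" where
  "Lambda s = of_real pi powr (- s / 2) * Gamma (s / 2) * zeta s"

section \<open>The two terms of the constant term\<close>

definition C_s_beta :: "real^4^4 \<Rightarrow> complex \<Rightarrow> complex" where
  "C_s_beta g \<nu> =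
     E_SL2 (- of_real (iwa_n1 g) + of_real (iwa_y1 g / iwa_y2 g) * \<i>) ((\<nu> + 1) / 2) *
     of_real (iwa_y1 g) powr (\<nu> / 2 + 1) * of_real (iwa_y2 g) powr (\<nu> / 2 + 1)"

definition C_s_beta_alpha_beta :: "real^4^4 \<Rightarrow> complex \<Rightarrow> complex" where
  "C_s_beta_alpha_beta g \<nu> =
     (Lambda \<nu> / Lambda (\<nu> + 1)) * (Lambda (\<nu> + 1) / Lambda (\<nu> + 2)) *
     E_SL2 (- of_real (iwa_n1 g) + of_real (iwa_y1 g / iwa_y2 g) * \<i>) ((\<nu> - 1) / 2) *
     of_real (iwa_y1 g) powr (- \<nu> / 2 + 1) * of_real (iwa_y2 g) powr (- \<nu> / 2 + 1)"

end

theory Submission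
  imports Defs
begin

text \<open>Everything reduces to Epstein zeta functions, that is, to sums \<open>\<Sum>v \<noteq> 0. norm (L v) powr (- w)\<close> over an integer
lattice with \<open>L\<close> linear and injective.

In Iwasawa coordinates \<open>y\<^sub>1\<close> of \<open>h\<close> is the inverse length of the third row of \<open>h\<close>, and the third row of
\<open>\<gamma>\<close>, up to sign, determines the coset of \<open>\<gamma>\<close> modulo the Jacobi parabolic; it runs through the primitive
vectors (\<open>coset_sum_Sp4\<close>). So \<open>E_beta g \<nu>\<close> is half the sum of \<open>norm (v v* g) powr (- \<nu> - 2)\<close> over
primitive \<open>v\<close>, and multiplication by \<open>zeta (\<nu> + 2)\<close> turns it into half an Epstein zeta function
(\<open>sum_primitive\<close>). The series on the upper half plane is treated alike (\<open>coset_sum_SL2\<close>).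

For real \<open>\<nu> > 2\<close> all terms are positive and the constant term is computed term by term
(\<open>cube_lattice_sum\<close>). Write \<open>v = (a, b)\<close> with \<open>a\<close>, \<open>b\<close> in \<open>\<int>\<^sup>2\<close>; the unipotent element with block \<open>S\<close> moves
\<open>v\<close> to \<open>(a, a S + b)\<close>. If \<open>a = 0\<close> nothing depends on \<open>S\<close>, and these vectors give the planar Epstein zeta
function at \<open>\<nu> + 2\<close>: the first term. If \<open>a \<noteq> 0\<close>, then \<open>S \<mapsto> a S\<close> maps the torus of all \<open>S\<close> onto the torus
\<open>\<real>\<^sup>2 / \<int>\<^sup>2\<close>, and the sum over \<open>b\<close> unfolds the integral to one over the plane (\<open>cube_unfold\<close>). That integral
is elementary (\<open>plane_integral\<close>) and leaves the power \<open>- \<nu>\<close> of the length of \<open>a\<close>, so the sum over \<open>a\<close> is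
the planar Epstein zeta function at \<open>\<nu>\<close>. The constant \<open>2 \<pi> / \<nu>\<close> from the plane integral is the quotient
of the archimedean factors of \<open>Lambda \<nu>\<close> and \<open>Lambda (\<nu> + 2)\<close> (\<open>Lambda_ratio\<close>): the second term.

The continuation uses no theta functions. A nonzero lattice vector is \<open>2 v + u\<close> with \<open>u\<close> in
\<open>{0,1}\<^sup>n\<close>. Expanding the summand at \<open>2 v\<close> in the direction \<open>u\<close> by Taylor's formula and using homogeneity,
the sum multiplied by \<open>1 - 2 powr (n - w)\<close> becomes a combination of sums of the same type that decay
faster, plus a remainder that converges further to the left. The class of summands closed under this
step is that of the homogeneous \<open>symbol\<close>s, and induction on the depth of the strip gives
\<open>symbol_sum_continuation\<close>. The multipliers only depend on \<open>n\<close> and the degree, not on \<open>L\<close>. Hence, for \<open>L\<close>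
depending continuously on a parameter in a compact set, the continuation has the form \<open>W p w / D w\<close> with
\<open>D\<close> independent of the parameter \<open>p\<close> and \<open>W\<close> jointly continuous. This allows integration over \<open>p = S\<close>, so
the constant term is meromorphic (\<open>constant_term_meromorphic\<close>). Both sides are then meromorphic functions
that agree on a half-line, and the identity theorem finishes the proof.\<close>

section \<open>Summability over the integer lattice\<close>

definition lattice :: "(real^'n) set" where
  "lattice = {v. \<forall>i. v$i \<in> \<int>}"

lemma summable_int_powr:
  assumes "a > 1"
  shows "(\<lambda>k::int. max 1 \<bar>real_of_int k\<bar> powr (- a)) summable_on UNIV"
proof -
  have s: "summable (\<lambda>n. max 1 (real n) powr (- a))"
  proof (subst summable_cong)
    show "\<forall>\<^sub>F n in sequentially. max 1 (real n) powr (- a) = real n powr (- a)"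
      using eventually_ge_at_top[of 1] by eventually_elim (auto simp: max_def)
    show "summable (\<lambda>n. real n powr (- a))" using assms by (simp add: summable_real_powr_iff)
  qed
  hence n: "(\<lambda>n. max 1 (real n) powr (- a)) summable_on UNIV"
    by (intro norm_summable_imp_summable_on) auto
  have "(\<lambda>k::int. max 1 \<bar>real_of_int k\<bar> powr (- a)) summable_on range int"
    by (subst summable_on_reindex) (use n in \<open>auto simp: o_def inj_on_def\<close>)
  moreover have "(\<lambda>k::int. max 1 \<bar>real_of_int k\<bar> powr (- a)) summable_on range (\<lambda>n. - int n)"
    by (subst summable_on_reindex) (use n in \<open>auto simp: o_def inj_on_def\<close>)
  ultimately have "(\<lambda>k::int. max 1 \<bar>real_of_int k\<bar> powr (- a)) summable_on (range int \<union> range (\<lambda>n. - int n))"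
    by (rule summable_on_union)
  moreover have "range int \<union> range (\<lambda>n. - int n) = UNIV"
  proof (intro equalityI subsetI)
    fix k :: int
    obtain n where "k = int n \<or> k = - int n" by (cases k rule: int_cases2) auto
    thus "k \<in> range int \<union> range (\<lambda>n. - int n)" by auto
  qed auto
  ultimately show ?thesis by simp
qed

text \<open>The norm dominates every coordinate, so \<open>norm v powr (- \<sigma>)\<close> is at most the product over the \<open>n\<close>
coordinates of \<open>max 1 \<bar>v $ i\<bar> powr (- \<sigma> / n)\<close>. Each factor is summable over \<open>\<int>\<close> because \<open>\<sigma> / n > 1\<close>.\<close>
lemma summable_lattice_powr:
  assumes "\<sigma> > real CARD('n)"
  shows "(\<lambda>v::real^'n. norm v powr (- \<sigma>)) summable_on (lattice - {0})"
proof -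
  define n where "n = real CARD('n)"
  have n: "n > 0" by (simp add: n_def)
  define g where "g = (\<lambda>k::int. max 1 \<bar>real_of_int k\<bar> powr (- (\<sigma>/n)))"
  have "g summable_on UNIV" unfolding g_def
    by (rule summable_int_powr) (use assms n in \<open>auto simp: n_def field_simps\<close>)
  hence "Infinite_Sum.abs_summable_on g UNIV" by (simp add: g_def)
  hence ga: "Infinite_Set_Sum.abs_summable_on g UNIV"
    using abs_summable_equivalent by blast
  have "Infinite_Set_Sum.abs_summable_on (\<lambda>h::'n\<Rightarrow>int. \<Prod>i\<in>UNIV. g (h i)) (PiE UNIV (\<lambda>_. UNIV))"
    by (rule abs_summable_on_prod_PiE) (use ga in auto)
  moreover have "PiE UNIV (\<lambda>_::'n. UNIV::int set) = UNIV" by (simp add: PiE_UNIV_domain)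
  ultimately have "Infinite_Sum.abs_summable_on (\<lambda>h::'n\<Rightarrow>int. \<Prod>i\<in>UNIV. g (h i)) UNIV"
    using abs_summable_equivalent by metis
  hence s: "(\<lambda>h::'n\<Rightarrow>int. \<Prod>i\<in>UNIV. g (h i)) summable_on UNIV"
    by (rule abs_summable_summable)
  define e where "e = (\<lambda>h::'n\<Rightarrow>int. \<chi> i. real_of_int (h i))"
  have inj: "inj e" by (auto simp: e_def inj_on_def vec_eq_iff)
  have ran: "range e = lattice"
  proof
    show "lattice \<subseteq> range e"
    proof
      fix v :: "real^'n" assume "v \<in> lattice"
      hence "v = e (\<lambda>i. \<lfloor>v$i\<rfloor>)" by (auto simp: e_def lattice_def vec_eq_iff)
      thus "v \<in> range e" by blast
    qed
  qed (auto simp: e_def lattice_def)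
  define G where "G = (\<lambda>v::real^'n. \<Prod>i\<in>UNIV. max 1 \<bar>v$i\<bar> powr (- (\<sigma>/n)))"
  have "G summable_on range e"
    by (subst summable_on_reindex[OF inj]) (use s in \<open>simp add: G_def g_def e_def o_def\<close>)
  hence G: "G summable_on (lattice - {0})"
    unfolding ran by (rule summable_on_subset_banach) auto
  show ?thesis
  proof (rule summable_on_comparison_test[OF G])
    fix v :: "real^'n" assume v: "v \<in> lattice - {0}"
    then obtain i0 where "v$i0 \<noteq> 0" by (auto simp: vec_eq_iff)
    with v have "\<bar>v$i0\<bar> \<ge> 1" by (auto simp: lattice_def intro!: Ints_nonzero_abs_ge1)
    hence n1: "norm v \<ge> 1" using component_le_norm_cart[of v i0] by simp
    have "norm v powr (-\<sigma>) = (\<Prod>i\<in>(UNIV::'n set). norm v powr (- (\<sigma>/n)))"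
      using n n1 powr_power[of "norm v" "- (\<sigma>/n)" "CARD('n)"] by (cases "v = 0") (auto simp: n_def field_simps)
    also have "\<dots> \<le> G v" unfolding G_def
    proof (rule prod_mono, safe)
      fix i
      show "norm v powr (- (\<sigma>/n)) \<le> max 1 \<bar>v$i\<bar> powr (- (\<sigma>/n))"
        using n1 component_le_norm_cart[of v i] assms n
        by (intro powr_mono2') (auto simp: n_def)
    qed auto
    finally show "norm v powr (-\<sigma>) \<le> G v" .
  qed auto
qed

text \<open>Induction on \<open>n\<close>: the derivative of the remainder is the remainder of order one less for \<open>g 1\<close>, and the
remainder vanishes at \<open>0\<close>. On the unit interval the mean value inequality passes the bound \<open>B\<close> on unchanged.\<close>
lemma Taylor_remainder_unit_interval:
  fixes g :: "nat \<Rightarrow> real \<Rightarrow> 'a::real_normed_vector"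
  assumes der: "\<And>j t. j < n \<Longrightarrow> t \<in> {0..1} \<Longrightarrow> (g j has_vector_derivative g (Suc j) t) (at t within {0..1})"
    and B: "\<And>t. t \<in> {0..1} \<Longrightarrow> norm (g n t) \<le> B"
    and "t \<in> {0..1}"
  shows "norm (g 0 t - (\<Sum>j<n. (t ^ j / fact j) *\<^sub>R g j 0)) \<le> B"
  using assms
proof (induction n arbitrary: g t)
  case (Suc n)
  define h where "h = (\<lambda>t. g 0 t - (\<Sum>j<Suc n. (t ^ j / fact j) *\<^sub>R g j 0))"
  define h' where "h' = (\<lambda>t. g 1 t - (\<Sum>j<n. (t ^ j / fact j) *\<^sub>R g (Suc j) 0))"
  have B0: "B \<ge> 0" by (rule order_trans[OF norm_ge_zero Suc.prems(2)[of 0]]) simp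
  have bd: "norm (h' t) \<le> B" if "t \<in> {0..1}" for t
    unfolding h'_def One_nat_def
    by (rule Suc.IH[of "\<lambda>j. g (Suc j)" t]) (use Suc.prems(1,2) that in auto)
  have hd: "(h has_vector_derivative h' t) (at t within {0..1})" if "t \<in> {0..1}" for t
  proof -
    have h: "h = (\<lambda>t. g 0 t - (g 0 0 + (\<Sum>j<n. (t ^ Suc j / fact (Suc j)) *\<^sub>R g (Suc j) 0)))"
      unfolding h_def by (subst sum.lessThan_Suc_shift) simp
    have c: "((\<lambda>t::real. (t ^ Suc j / fact (Suc j)) *\<^sub>R g (Suc j) 0) has_vector_derivative (t ^ j / fact j) *\<^sub>R g (Suc j) 0) (at t within {0..1})" for j
    proof -
      have "((\<lambda>t::real. (t ^ Suc j / fact (Suc j))) has_field_derivative (t ^ j / fact j)) (at t within {0..1})"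
        by (rule derivative_eq_intros refl | simp add: divide_simps)+
      from has_vector_derivative_scaleR[OF this has_vector_derivative_const[of "g (Suc j) 0"]]
      show ?thesis by simp
    qed
    have c0: "(g 0 has_vector_derivative g 1 t) (at t within {0..1})" using Suc.prems(1)[of 0 t] that by simp
    have "(h has_vector_derivative g 1 t - (0 + (\<Sum>j<n. (t ^ j / fact j) *\<^sub>R g (Suc j) 0))) (at t within {0..1})"
      unfolding h by (intro has_vector_derivative_diff has_vector_derivative_add has_vector_derivative_const has_vector_derivative_sum c c0)
    thus ?thesis by (simp add: h'_def)
  qed
  have "norm (h t - h 0) \<le> B * norm (t - 0)"
  proof (rule differentiable_bound[of "{0..1}" h "\<lambda>t x. x *\<^sub>R h' t" B])
    fix x :: real assume x: "x \<in> {0..1}"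
    show "(h has_derivative (\<lambda>xa. xa *\<^sub>R h' x)) (at x within {0..1})"
      using hd[OF x] by (simp add: has_vector_derivative_def)
    show "onorm (\<lambda>xa. xa *\<^sub>R h' x) \<le> B" by (rule onorm_le) (use mult_right_mono[OF bd[OF x] abs_ge_zero] in \<open>auto simp: mult.commute\<close>)
  qed (use Suc.prems in auto)
  also have "\<dots> \<le> B" using Suc.prems B0 by (auto intro: mult_left_le)
  finally have "norm (h t - h 0) \<le> B" .
  moreover have "h 0 = 0" unfolding h_def by (subst sum.lessThan_Suc_shift) simp
  ultimately show ?case by (simp add: h_def)
qed auto

text \<open>The Weierstrass test for sums over an arbitrary index set, along the filter of finite subsets.\<close>
lemma uniform_limit_infsum:
  fixes f :: "'i \<Rightarrow> 'a \<Rightarrow> 'b::banach"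
  assumes M: "M summable_on A" and le: "\<And>i x. i \<in> A \<Longrightarrow> x \<in> X \<Longrightarrow> norm (f i x) \<le> M i"
  shows "uniform_limit X (\<lambda>F x. \<Sum>i\<in>F. f i x) (\<lambda>x. \<Sum>\<^sub>\<infinity>i\<in>A. f i x) (finite_subsets_at_top A)"
proof (cases "X = {}")
  case False
  then obtain x0 where "x0 \<in> X" by blast
  hence M0: "M i \<ge> 0" if "i \<in> A" for i using le[OF that] norm_ge_zero order_trans by blast
  show ?thesis
  proof (rule uniform_limitI)
    fix e :: real assume e: "e > 0"
    have "((\<lambda>F. sum M F) \<longlongrightarrow> infsum M A) (finite_subsets_at_top A)"
      using M by (simp add: infsum_tendsto)
    hence "\<forall>\<^sub>F F in finite_subsets_at_top A. dist (sum M F) (infsum M A) < e" using e by (rule tendstoD)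
    moreover have "\<forall>\<^sub>F F in finite_subsets_at_top A. finite F \<and> F \<subseteq> A" by auto
    ultimately show "\<forall>\<^sub>F F in finite_subsets_at_top A. \<forall>x\<in>X. dist (\<Sum>i\<in>F. f i x) (\<Sum>\<^sub>\<infinity>i\<in>A. f i x) < e"
    proof eventually_elim
      case (elim F)
      show ?case
      proof
        fix x assume x: "x \<in> X"
        have abs: "(\<lambda>i. norm (f i x)) summable_on A"
          by (rule summable_on_comparison_test[OF M]) (use le x in auto)
        hence s: "(\<lambda>i. f i x) summable_on A" by (rule abs_summable_summable)
        have sF: "(\<lambda>i. f i x) summable_on F" "M summable_on F" using elim by auto
        have absd: "(\<lambda>i. norm (f i x)) summable_on (A - F)" 
          by (rule summable_on_subset_banach[OF abs]) auto
        have Md: "M summable_on (A - F)" by (rule summable_on_subset_banach[OF M]) auto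
        have "infsum (\<lambda>i. f i x) (A - F) = infsum (\<lambda>i. f i x) A - infsum (\<lambda>i. f i x) F"
          using elim by (intro infsum_Diff s sF) auto
        hence "norm ((\<Sum>\<^sub>\<infinity>i\<in>A. f i x) - (\<Sum>i\<in>F. f i x)) = norm (infsum (\<lambda>i. f i x) (A - F))"
          using elim by simp
        also have "\<dots> \<le> infsum (\<lambda>i. norm (f i x)) (A - F)" using absd by (rule norm_infsum_bound)
        also have "\<dots> \<le> infsum M (A - F)" by (rule infsum_mono[OF absd Md]) (use le x in auto)
        also have "\<dots> = infsum M A - sum M F" using elim by (subst infsum_Diff[OF M sF(2)]) auto
        also have "\<dots> < e" using elim by (auto simp: dist_real_def)
        finally show "dist (\<Sum>i\<in>F. f i x) (\<Sum>\<^sub>\<infinity>i\<in>A. f i x) < e" by (simp add: dist_norm norm_minus_commute)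
      qed
    qed
  qed
qed auto

section \<open>Holomorphic families and homogeneous symbols\<close>

text \<open>Continuity is joint in parameter and variable, holomorphy only concerns the variable. Both survive
locally uniform sums, and together they make the integral over the parameter holomorphic.\<close>
definition joint_hol :: "'p::metric_space set \<Rightarrow> complex set \<Rightarrow> ('p \<Rightarrow> complex \<Rightarrow> complex) \<Rightarrow> bool" where
  "joint_hol P U F \<longleftrightarrow> continuous_on (P \<times> U) (\<lambda>(p,w). F p w) \<and> (\<forall>p\<in>P. F p holomorphic_on U)"

lemma joint_hol_subset: "joint_hol P U F \<Longrightarrow> V \<subseteq> U \<Longrightarrow> joint_hol P V F"
  unfolding joint_hol_def by (meson Sigma_mono continuous_on_subset holomorphic_on_subset order_refl)

lemma joint_hol_const_param: 
  assumes "f holomorphic_on U" 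
  shows "joint_hol P U (\<lambda>p. f)"
proof -
  have "continuous_on (P \<times> U) (\<lambda>x. f (snd x))"
    by (rule continuous_on_compose2[OF holomorphic_on_imp_continuous_on[OF assms]]) (auto intro: continuous_intros)
  thus ?thesis using assms by (simp add: joint_hol_def case_prod_unfold)
qed

lemma joint_hol_add: "joint_hol P U F \<Longrightarrow> joint_hol P U G \<Longrightarrow> joint_hol P U (\<lambda>p w. F p w + G p w)"
  unfolding joint_hol_def case_prod_unfold by (auto intro!: continuous_intros holomorphic_intros)

lemma joint_hol_diff: "joint_hol P U F \<Longrightarrow> joint_hol P U G \<Longrightarrow> joint_hol P U (\<lambda>p w. F p w - G p w)"
  unfolding joint_hol_def case_prod_unfold by (auto intro!: continuous_intros holomorphic_intros)

lemma joint_hol_mult: "joint_hol P U F \<Longrightarrow> joint_hol P U G \<Longrightarrow> joint_hol P U (\<lambda>p w. F p w * G p w)"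
  unfolding joint_hol_def case_prod_unfold by (auto intro!: continuous_intros holomorphic_intros)

lemma joint_hol_sum: "(\<And>i. i \<in> I \<Longrightarrow> joint_hol P U (F i)) \<Longrightarrow> joint_hol P U (\<lambda>p w. \<Sum>i\<in>I. F i p w)"
  unfolding joint_hol_def case_prod_unfold by (auto intro!: continuous_intros holomorphic_intros)

lemma joint_hol_cong: "(\<And>p w. p \<in> P \<Longrightarrow> w \<in> U \<Longrightarrow> F p w = G p w) \<Longrightarrow> joint_hol P U F = joint_hol P U G"
proof -
  assume a: "\<And>p w. p \<in> P \<Longrightarrow> w \<in> U \<Longrightarrow> F p w = G p w"
  have "continuous_on (P \<times> U) (\<lambda>(p,w). F p w) = continuous_on (P \<times> U) (\<lambda>(p,w). G p w)"
    by (rule continuous_on_cong) (auto simp: a)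
  moreover have "(F p holomorphic_on U) = (G p holomorphic_on U)" if "p \<in> P" for p
    by (rule holomorphic_cong) (auto simp: a that)
  ultimately show ?thesis by (simp add: joint_hol_def)
qed

text \<open>A dominated series is locally uniformly convergent, jointly in parameter and variable; continuity passes to
uniform limits, and so does holomorphy by Weierstrass' theorem.\<close>
lemma joint_hol_infsum:
  fixes P :: "'p::metric_space set"
  assumes U: "open U" and F: "\<And>i. i \<in> A \<Longrightarrow> joint_hol P U (F i)"
    and M: "\<And>w0. w0 \<in> U \<Longrightarrow> \<exists>r>0. \<exists>M. cball w0 r \<subseteq> U \<and> M summable_on A \<and> (\<forall>i\<in>A. \<forall>p\<in>P. \<forall>w\<in>cball w0 r. norm (F i p w) \<le> M i)"
  shows "joint_hol P U (\<lambda>p w. \<Sum>\<^sub>\<infinity>i\<in>A. F i p w)"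
  unfolding joint_hol_def
proof safe
  have evF: "\<forall>\<^sub>F S in finite_subsets_at_top A. finite S \<and> S \<subseteq> A" by auto
  have nt: "finite_subsets_at_top A \<noteq> bot" by simp
  have "continuous (at x within P \<times> U) (\<lambda>(p,w). \<Sum>\<^sub>\<infinity>i\<in>A. F i p w)"
    if x: "x \<in> P \<times> U" for x
  proof -
    obtain p0 w0 where x0: "x = (p0, w0)" "p0 \<in> P" "w0 \<in> U" using x by auto
    from M[OF x0(3)] obtain r M where r: "r > 0" "cball w0 r \<subseteq> U" "M summable_on A" 
      "\<And>i p w. i\<in>A \<Longrightarrow> p\<in>P \<Longrightarrow> w\<in>cball w0 r \<Longrightarrow> norm (F i p w) \<le> M i" by blast
    have "continuous_on (P \<times> cball w0 r) (\<lambda>x. \<Sum>\<^sub>\<infinity>i\<in>A. F i (fst x) (snd x))"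
    proof (rule uniform_limit_theorem[OF _ _ nt])
      show "uniform_limit (P \<times> cball w0 r) (\<lambda>S x. \<Sum>i\<in>S. F i (fst x) (snd x)) (\<lambda>x. \<Sum>\<^sub>\<infinity>i\<in>A. F i (fst x) (snd x)) (finite_subsets_at_top A)"
        by (rule uniform_limit_infsum[OF r(3)]) (use r(4) in auto)
      show "\<forall>\<^sub>F S in finite_subsets_at_top A. continuous_on (P \<times> cball w0 r) (\<lambda>x. \<Sum>i\<in>S. F i (fst x) (snd x))"
        using evF
      proof eventually_elim
        case (elim S)
        show ?case
        proof (rule continuous_on_sum)
          fix i assume "i \<in> S"
          hence "continuous_on (P \<times> U) (\<lambda>x. F i (fst x) (snd x))" using F[of i] elim by (auto simp: joint_hol_def case_prod_unfold)
          thus "continuous_on (P \<times> cball w0 r) (\<lambda>x. F i (fst x) (snd x))" 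
            by (rule continuous_on_subset) (use r(2) in auto)
        qed
      qed
    qed
    hence "continuous_on (P \<times> ball w0 r) (\<lambda>(p,w). \<Sum>\<^sub>\<infinity>i\<in>A. F i p w)"
      unfolding case_prod_unfold by (rule continuous_on_subset) auto
    moreover have "x \<in> P \<times> ball w0 r" using x0 r(1) by auto
    ultimately have "continuous (at x within P \<times> ball w0 r) (\<lambda>(p,w). \<Sum>\<^sub>\<infinity>i\<in>A. F i p w)"
      unfolding continuous_on_eq_continuous_within by blast
    moreover have "at x within P \<times> ball w0 r = at x within P \<times> U"
      by (rule at_within_nhd[of _ "UNIV \<times> ball w0 r"]) (use x0 r(1,2) in \<open>auto intro: open_Times\<close>)
    ultimately show ?thesis by simp
  qed
  then show "continuous_on (P \<times> U) (\<lambda>(p,w). \<Sum>\<^sub>\<infinity>i\<in>A. F i p w)" 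
    by (simp add: continuous_on_eq_continuous_within)
next
  fix p assume p: "p \<in> P"
  have nt: "\<not> trivial_limit (finite_subsets_at_top A)" by simp
  have "\<exists>r>0. (\<lambda>w. \<Sum>\<^sub>\<infinity>i\<in>A. F i p w) holomorphic_on ball w0 r" if w0: "w0 \<in> U" for w0
  proof -
    from M[OF w0] obtain r M where r: "r > 0" "cball w0 r \<subseteq> U" "M summable_on A" 
      "\<And>i p w. i\<in>A \<Longrightarrow> p\<in>P \<Longrightarrow> w\<in>cball w0 r \<Longrightarrow> norm (F i p w) \<le> M i" by blast
    have ul: "uniform_limit (cball w0 r) (\<lambda>S w. \<Sum>i\<in>S. F i p w) (\<lambda>w. \<Sum>\<^sub>\<infinity>i\<in>A. F i p w) (finite_subsets_at_top A)"
      by (rule uniform_limit_infsum[OF r(3)]) (use r(4) p in auto)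
    have "\<forall>\<^sub>F S in finite_subsets_at_top A. finite S \<and> S \<subseteq> A" by auto
    hence ev: "\<forall>\<^sub>F S in finite_subsets_at_top A. continuous_on (cball w0 r) (\<lambda>w. \<Sum>i\<in>S. F i p w) \<and> (\<lambda>w. \<Sum>i\<in>S. F i p w) holomorphic_on ball w0 r"
    proof eventually_elim
      case (elim S)
      have "(\<lambda>w. \<Sum>i\<in>S. F i p w) holomorphic_on U"
        by (intro holomorphic_on_sum) (use F elim p in \<open>auto simp: joint_hol_def\<close>)
      thus ?case using r(2) ball_subset_cball 
        by (meson holomorphic_on_imp_continuous_on holomorphic_on_subset order_trans)
    qed
    show ?thesis using holomorphic_uniform_limit[OF ev ul nt] r(1) by blast
  qed
  thus "(\<lambda>w. \<Sum>\<^sub>\<infinity>i\<in>A. F i p w) holomorphic_on U"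
    using U by (metis at_within_open centre_in_ball field_differentiable_at_within holomorphic_on_def open_ball)
qed

text \<open>A compact family of injective linear maps. The cases of interest are \<open>v \<mapsto> v v* (n_alpha S ** g)\<close> with \<open>S\<close>
in the unit cube, \<open>(c, d) \<mapsto> c z + d\<close>, and the identity of the line, which yields the Riemann zeta function.\<close>
locale linear_family =
  fixes P :: "'p::metric_space set" and L :: "'p \<Rightarrow> real^'n \<Rightarrow> 'e::euclidean_space"
  assumes compact: "compact P"
    and linL: "\<And>p. p \<in> P \<Longrightarrow> linear (L p)"
    and injL: "\<And>p x. p \<in> P \<Longrightarrow> L p x = 0 \<Longrightarrow> x = 0"
    and cont: "continuous_on (P \<times> UNIV) (\<lambda>(p,x). L p x)"
begin

text \<open>By homogeneity it suffices to consider the unit sphere, where compactness gives a positive minimum and a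
finite maximum, uniformly in the parameter.\<close>
lemma bounds:
  obtains c C where "c > 0" "C > 0" "\<And>p x. p \<in> P \<Longrightarrow> c * norm x \<le> norm (L p x)" 
    "\<And>p x. p \<in> P \<Longrightarrow> norm (L p x) \<le> C * norm x"
proof -
  define S where "S = P \<times> sphere (0::real^'n) 1"
  define g where "g = (\<lambda>(p,x). norm (L p x))"
  have cg: "continuous_on S g" unfolding g_def case_prod_unfold
    by (rule continuous_on_norm, rule continuous_on_subset[OF cont[unfolded case_prod_unfold]]) (auto simp: S_def)
  have cS: "compact S" unfolding S_def by (intro compact_Times compact compact_sphere)
  have hom: "norm (L p x) = norm x * g (p, x /\<^sub>R norm x)" if "p \<in> P" "x \<noteq> 0" for p x
    using that linL[OF that(1)] by (simp add: g_def linear_cmul)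
  show thesis
  proof (cases "S = {}")
    case True
    hence "P = {}" by (auto simp: S_def)
    thus thesis using that[of 1 1] by auto
  next
    case False
    obtain a where a: "a \<in> S" "\<And>y. y \<in> S \<Longrightarrow> g a \<le> g y" using continuous_attains_inf[OF cS False cg] by blast
    obtain b where b: "b \<in> S" "\<And>y. y \<in> S \<Longrightarrow> g y \<le> g b" using continuous_attains_sup[OF cS False cg] by blast
    have pos: "g y > 0" if "y \<in> S" for y using that injL unfolding S_def g_def by fastforce
    show thesis
    proof (rule that[of "g a" "g b"])
      fix p x assume p: "p \<in> P"
      have L0: "L p 0 = 0" using linL[OF p] by (rule linear_0)
      show "g a * norm x \<le> norm (L p x)"
        by (cases "x = 0") (use a(2)[of "(p, x /\<^sub>R norm x)"] hom[OF p] p L0 in \<open>auto simp: S_def mult.commute\<close>)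
      show "norm (L p x) \<le> g b * norm x"
        by (cases "x = 0") (use b(2)[of "(p, x /\<^sub>R norm x)"] hom[OF p] p L0 in \<open>auto simp: S_def mult.commute\<close>)
    qed (use a b pos in auto)
  qed
qed

lemma cont_at: "continuous_on P (\<lambda>p. L p x)"
  by (rule continuous_on_compose2[OF cont[unfolded case_prod_unfold], of _ "\<lambda>p. (p, x)", simplified]) (auto intro!: continuous_intros)

lemma cont_at' [continuous_intros]: "continuous_on (P \<times> U) (\<lambda>q. L (fst q) x)"
  by (rule continuous_on_compose2[OF cont_at]) (auto intro!: continuous_intros)

lemma L_pos: "p \<in> P \<Longrightarrow> x \<noteq> 0 \<Longrightarrow> norm (L p x) > 0"
  using injL by auto

text \<open>A symbol of degree \<open>d\<close> is homogeneous of degree \<open>- d\<close> in \<open>x\<close>, so \<open>d\<close> measures decay at infinity. The rules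
are chosen so that the class contains the derivatives of \<open>norm (L p x) powr (- w)\<close> divided by that
function itself: a derivative along \<open>u\<close> produces the factors \<open>- w\<close>, \<open>L p x \<bullet> L p u\<close> and
\<open>1 / (norm (L p x))\<^sup>2\<close>.\<close>
inductive symbol :: "real \<Rightarrow> ('p \<Rightarrow> complex \<Rightarrow> real^'n \<Rightarrow> complex) \<Rightarrow> bool" where
  const: "joint_hol P UNIV c \<Longrightarrow> symbol 0 (\<lambda>p w x. c p w)"
| lin: "symbol (-1) (\<lambda>p w x. of_real (L p x \<bullet> L p u))"
| inv: "symbol 2 (\<lambda>p w x. of_real (inverse ((norm (L p x))\<^sup>2)))"
| add: "symbol d a \<Longrightarrow> symbol d b \<Longrightarrow> symbol d (\<lambda>p w x. a p w x + b p w x)"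
| mult: "symbol d a \<Longrightarrow> symbol e b \<Longrightarrow> symbol (d + e) (\<lambda>p w x. a p w x * b p w x)"

lemma symbol_joint_hol: "symbol d a \<Longrightarrow> x \<noteq> 0 \<Longrightarrow> joint_hol P UNIV (\<lambda>p w. a p w x)"
proof (induction rule: symbol.induct)
  case (lin u)
  show ?case unfolding joint_hol_def case_prod_unfold by (auto intro!: continuous_intros)
next
  case inv
  show ?case unfolding joint_hol_def case_prod_unfold by (auto intro!: continuous_intros dest!: injL simp: inv.prems)
qed (auto intro: joint_hol_add joint_hol_mult)

lemma symbol_hom: "symbol d a \<Longrightarrow> p \<in> P \<Longrightarrow> a p w (2 *\<^sub>R x) = of_real (2 powr (- d)) * a p w x"
proof (induction rule: symbol.induct)
  case (lin u)
  thus ?case using linL[of p] by (simp add: linear_cmul)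
next
  case inv
  thus ?case using linL[of p] by (simp add: linear_cmul power_mult_distrib powr_minus)
next
  case (mult d a e b)
  thus ?case by (simp add: powr_add powr_minus mult_ac powr_diff divide_simps)
qed (auto simp: algebra_simps)

lemma symbol_bound: "symbol d a \<Longrightarrow> \<exists>B\<ge>0. \<forall>p\<in>P. \<forall>w. norm w \<le> r \<longrightarrow> (\<forall>x. x \<noteq> 0 \<longrightarrow> norm (a p w x) \<le> B * norm x powr (- d))"
proof (induction rule: symbol.induct)
  case (const c)
  have "compact ((\<lambda>(p,w). c p w) ` (P \<times> cball 0 r))"
    by (intro compact_continuous_image compact_Times compact compact_cball)
       (use const in \<open>auto simp: joint_hol_def intro: continuous_on_subset\<close>)
  then obtain B where "\<And>y. y \<in> (\<lambda>(p,w). c p w) ` (P \<times> cball 0 r) \<Longrightarrow> norm y \<le> B"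
    using compact_imp_bounded bounded_iff by metis
  hence "norm (c p w) \<le> max B 0" if "p \<in> P" "norm w \<le> r" for p w
    using that by (force simp: le_max_iff_disj)
  hence "\<forall>p\<in>P. \<forall>w. norm w \<le> r \<longrightarrow> (\<forall>x::real^'n. x \<noteq> 0 \<longrightarrow> norm (c p w) \<le> max B 0 * norm x powr (- 0))"
    by simp
  thus ?case by (intro exI[of _ "max B 0"]) auto
next
  case (lin u)
  obtain c C where C: "c > 0" "C > 0" "\<And>p x. p \<in> P \<Longrightarrow> c * norm x \<le> norm (L p x)" 
    "\<And>p x. p \<in> P \<Longrightarrow> norm (L p x) \<le> C * norm x" using bounds by blast
  have "norm (L p x \<bullet> L p u) \<le> (C * (C * norm u)) * norm x" if "p \<in> P" for p x
  proof -
    have "norm (L p x \<bullet> L p u) \<le> norm (L p x) * norm (L p u)" by (rule Cauchy_Schwarz_ineq2[folded real_norm_def])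
    also have "\<dots> \<le> (C * norm x) * (C * norm u)" using C that by (intro mult_mono) auto
    finally show ?thesis by (simp add: mult_ac)
  qed
  thus ?case using C by (intro exI[of _ "C * (C * norm u)"]) auto
next
  case inv
  obtain c C where C: "c > 0" "C > 0" "\<And>p x. p \<in> P \<Longrightarrow> c * norm x \<le> norm (L p x)" 
    "\<And>p x. p \<in> P \<Longrightarrow> norm (L p x) \<le> C * norm x" using bounds by blast
  have "norm (complex_of_real (inverse ((norm (L p x))\<^sup>2))) \<le> inverse (c^2) * norm x powr (- 2)" if "p \<in> P" "x \<noteq> 0" for p x
  proof -
    have "inverse ((norm (L p x))\<^sup>2) \<le> inverse ((c * norm x)\<^sup>2)"
      using C that by (intro le_imp_inverse_le power_mono) auto
    also have "\<dots> = inverse (c^2) * norm x powr (- 2)"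
      using that by (simp add: powr_minus power_mult_distrib)
    finally show ?thesis by (simp add: norm_inverse norm_power)
  qed
  thus ?case using C by (intro exI[of _ "inverse (c^2)"]) auto
next
  case (add d a b)
  then obtain B1 B2 where B: "B1 \<ge> 0" "\<And>p w x. p\<in>P \<Longrightarrow> norm w \<le> r \<Longrightarrow> x \<noteq> 0 \<Longrightarrow> norm (a p w x) \<le> B1 * norm x powr (- d)"
     "B2 \<ge> 0" "\<And>p w x. p\<in>P \<Longrightarrow> norm w \<le> r \<Longrightarrow> x \<noteq> 0 \<Longrightarrow> norm (b p w x) \<le> B2 * norm x powr (- d)" by metis
  have "norm (a p w x + b p w x) \<le> (B1 + B2) * norm x powr (- d)" if "p\<in>P" "norm w \<le> r" "x \<noteq> 0" for p w x
    using norm_triangle_ineq[of "a p w x" "b p w x"] B(2,4)[OF that] by (simp add: algebra_simps)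
  thus ?case using B by (intro exI[of _ "B1 + B2"]) auto
next
  case (mult d a e b)
  then obtain B1 B2 where B: "B1 \<ge> 0" "\<And>p w x. p\<in>P \<Longrightarrow> norm w \<le> r \<Longrightarrow> x \<noteq> 0 \<Longrightarrow> norm (a p w x) \<le> B1 * norm x powr (- d)"
     "B2 \<ge> 0" "\<And>p w x. p\<in>P \<Longrightarrow> norm w \<le> r \<Longrightarrow> x \<noteq> 0 \<Longrightarrow> norm (b p w x) \<le> B2 * norm x powr (- e)" by metis
  have "norm (a p w x * b p w x) \<le> (B1 * B2) * norm x powr (- (d + e))" if "p\<in>P" "norm w \<le> r" "x \<noteq> 0" for p w x
  proof -
    have "norm (a p w x * b p w x) \<le> (B1 * norm x powr (- d)) * (B2 * norm x powr (- e))"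
      unfolding norm_mult using B that by (intro mult_mono) auto
    also have "\<dots> = (B1 * B2) * norm x powr (- (d + e))" using that by (simp add: powr_add powr_minus powr_diff field_simps)
    finally show ?thesis .
  qed
  thus ?case using B by (intro exI[of _ "B1 * B2"]) auto
qed

text \<open>The restriction to points away from the origin is essential, since the summands are singular there.\<close>
definition dir_deriv :: "real^'n \<Rightarrow> ('p \<Rightarrow> complex \<Rightarrow> real^'n \<Rightarrow> complex) \<Rightarrow> ('p \<Rightarrow> complex \<Rightarrow> real^'n \<Rightarrow> complex) \<Rightarrow> bool" where
  "dir_deriv u a a' \<longleftrightarrow> (\<forall>p\<in>P. \<forall>w x t. x + t *\<^sub>R u \<noteq> 0 \<longrightarrow>
     ((\<lambda>t. a p w (x + t *\<^sub>R u)) has_vector_derivative a' p w (x + t *\<^sub>R u)) (at t))"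

lemma has_derivative_L:
  assumes "p \<in> P"
  shows "((\<lambda>t. L p (x + t *\<^sub>R u)) has_vector_derivative L p u) (at t)"
proof -
  have "L p (x + t *\<^sub>R u) = L p x + t *\<^sub>R L p u" for t
    using linL[OF assms] by (simp add: linear_add linear_cmul)
  thus ?thesis by (auto intro!: derivative_eq_intros simp: has_vector_derivative_def)
qed

lemma dir_deriv_norm2:
  assumes "p \<in> P"
  shows "((\<lambda>t. (norm (L p (x + t *\<^sub>R u)))\<^sup>2) has_real_derivative 2 * (L p (x + t *\<^sub>R u) \<bullet> L p u)) (at t)"
  unfolding power2_norm_eq_inner has_real_derivative_iff_has_vector_derivative
  using bounded_bilinear.has_vector_derivative[OF bounded_bilinear_inner has_derivative_L[OF assms, of x u t] has_derivative_L[OF assms, of x u t]]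
  by (simp add: inner_commute)

text \<open>Differentiation is a derivation, so it suffices to treat the generators; the derivative of each of them is
again built from generators and decays by one degree more.\<close>
lemma symbol_deriv: "symbol d a \<Longrightarrow> \<exists>a'. symbol (d + 1) a' \<and> dir_deriv u a a'"
proof (induction rule: symbol.induct)
  case (const c)
  have "symbol (0 + 1) (\<lambda>p w x. 0 * of_real (inverse ((norm (L p x))\<^sup>2)) * of_real (L p x \<bullet> L p 0))"
    using mult[OF mult[OF symbol.const[of "\<lambda>p w. 0"] inv] symbol.lin[of 0]] by (simp add: joint_hol_const_param)
  thus ?case by (intro exI[of _ "\<lambda>p w x. 0 * of_real (inverse ((norm (L p x))\<^sup>2)) * of_real (L p x \<bullet> L p 0)"]) (auto simp: dir_deriv_def)
next
  case (lin u')
  have "symbol 0 (\<lambda>p w x. of_real (L p u \<bullet> L p u'))"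
    by (rule symbol.const) (auto simp: joint_hol_def case_prod_unfold intro!: continuous_intros)
  moreover have "dir_deriv u (\<lambda>p w x. of_real (L p x \<bullet> L p u')) (\<lambda>p w x. of_real (L p u \<bullet> L p u'))"
    unfolding dir_deriv_def
    by (intro ballI allI impI has_vector_derivative_of_real,
        unfold has_real_derivative_iff_has_vector_derivative)
       (intro bounded_linear.has_vector_derivative[OF bounded_linear_inner_left] has_derivative_L)
  ultimately show ?case by auto
next
  case inv
  have "symbol (0 + ((2 + 2) + (-1))) (\<lambda>p w x. (-2) * ((of_real (inverse ((norm (L p x))\<^sup>2)) * of_real (inverse ((norm (L p x))\<^sup>2))) * of_real (L p x \<bullet> L p u)))"
    by (intro symbol.mult symbol.inv symbol.lin symbol.const joint_hol_const_param) auto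
  moreover have "dir_deriv u (\<lambda>p w x. of_real (inverse ((norm (L p x))\<^sup>2))) (\<lambda>p w x. (-2) * ((of_real (inverse ((norm (L p x))\<^sup>2)) * of_real (inverse ((norm (L p x))\<^sup>2))) * of_real (L p x \<bullet> L p u)))"
    unfolding dir_deriv_def
  proof safe
    fix p :: 'p and w x and t :: real assume p: "p \<in> P" "x + t *\<^sub>R u \<noteq> 0"
    let ?N = "(norm (L p (x + t *\<^sub>R u)))\<^sup>2"
    have "?N \<noteq> 0" using L_pos[OF p] by simp
    from DERIV_inverse_fun[OF dir_deriv_norm2[OF p(1), of x u t] this]
    have "((\<lambda>t. inverse ((norm (L p (x + t *\<^sub>R u)))\<^sup>2)) has_real_derivative - (inverse ?N * (2 * (L p (x + t *\<^sub>R u) \<bullet> L p u)) * inverse ?N)) (at t)"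
      by (simp add: numeral_2_eq_2 mult_ac)
    from has_vector_derivative_of_real[OF this, where 'a = complex]
    show "((\<lambda>t. complex_of_real (inverse ((norm (L p (x + t *\<^sub>R u)))\<^sup>2))) has_vector_derivative
         - 2 * (of_real (inverse ?N) * of_real (inverse ?N) * of_real (L p (x + t *\<^sub>R u) \<bullet> L p u))) (at t)"
      by (rule has_vector_derivative_eq_rhs) (simp add: mult_ac)
  qed
  ultimately show ?case by auto
next
  case (add d a b)
  then obtain a' b' where "symbol (d+1) a'" "dir_deriv u a a'" "symbol (d+1) b'" "dir_deriv u b b'" by blast
  thus ?case by (intro exI[of _ "\<lambda>p w x. a' p w x + b' p w x"]) (auto simp: dir_deriv_def intro!: symbol.add has_vector_derivative_add)
next
  case (mult d a e b)
  then obtain a' b' where ab: "symbol (d+1) a'" "dir_deriv u a a'" "symbol (e+1) b'" "dir_deriv u b b'" by blast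
  have "symbol (d + e + 1) (\<lambda>p w x. a p w x * b' p w x + a' p w x * b p w x)"
    using symbol.add[OF symbol.mult[OF mult(1) ab(3)], of "\<lambda>p w x. a' p w x * b p w x"] symbol.mult[OF ab(1) mult(2)]
    by (simp add: add_ac)
  moreover have "dir_deriv u (\<lambda>p w x. a p w x * b p w x) (\<lambda>p w x. a p w x * b' p w x + a' p w x * b p w x)"
    using ab(2,4) by (auto simp: dir_deriv_def intro!: has_vector_derivative_mult)
  ultimately show ?case by blast
qed

end

section \<open>Halving the lattice\<close>

text \<open>The standard representatives of \<open>\<int>\<^sup>n\<close> modulo \<open>2 \<int>\<^sup>n\<close>.\<close>
definition cube01 :: "(real^'n) set" where
  "cube01 = {u. \<forall>i. u$i = 0 \<or> u$i = 1}"

lemma cube01_eq: "cube01 = (\<lambda>A. \<chi> i. of_bool (i \<in> A)) ` (UNIV :: 'n::finite set set)"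
proof (intro equalityI subsetI)
  fix u :: "real^'n" assume "u \<in> cube01"
  hence "u = (\<chi> i. of_bool (i \<in> {i. u$i = 1}))" by (auto simp: cube01_def vec_eq_iff)
  thus "u \<in> (\<lambda>A. \<chi> i. of_bool (i \<in> A)) ` (UNIV :: 'n::finite set set)" by blast
qed (auto simp: cube01_def)

lemma finite_cube01: "finite (cube01 :: (real^'n) set)"
  unfolding cube01_eq by simp

lemma card_cube01: "card (cube01 :: (real^'n) set) = 2 ^ CARD('n)"
proof -
  have "inj (\<lambda>A. (\<chi> i. of_bool (i \<in> A)) :: real^'n)"
    by (auto simp: inj_on_def vec_eq_iff of_bool_def split: if_splits)
  thus ?thesis unfolding cube01_eq by (subst card_image) (auto simp: card_UNIV_set)
qed

lemma cube01_lattice: "u \<in> cube01 \<Longrightarrow> u \<in> lattice"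
  unfolding cube01_def lattice_def by (auto, metis Ints_0 Ints_1)

lemma zero_cube01: "0 \<in> cube01" by (simp add: cube01_def)

lemma lattice_coord:
  assumes "v \<in> lattice"
  obtains a where "v $ i = of_int a"
  using assms unfolding lattice_def by (metis Ints_cases mem_Collect_eq)

text \<open>The map \<open>(u, v) \<mapsto> 2 v + u\<close> is a bijection onto the lattice (parity of the coordinates). The term \<open>f u\<close> is
the contribution of \<open>v = 0\<close>, kept apart because \<open>2 v\<close> is not an admissible centre of expansion then.\<close>
lemma lattice_split:
  fixes f :: "real^'n \<Rightarrow> complex"
  assumes f: "f summable_on (lattice - {0})"
  shows "infsum f (lattice - {0}) = infsum (\<lambda>v. f (2 *\<^sub>R v)) (lattice - {0}) +
     (\<Sum>u\<in>cube01 - {0}. f u + infsum (\<lambda>v. f (2 *\<^sub>R v + u)) (lattice - {0}))"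
    and "u \<in> cube01 \<Longrightarrow> (\<lambda>v. f (2 *\<^sub>R v + u)) summable_on (lattice - {0})"
proof -
  define B where "B = (\<lambda>u::real^'n. if u = 0 then lattice - {0} else (lattice :: (real^'n) set))"
  define \<phi> where "\<phi> = (\<lambda>(u::real^'n,v). 2 *\<^sub>R v + u)"
  have inj: "inj_on \<phi> (Sigma cube01 B)"
  proof (rule inj_onI, safe)
    fix u v u' v' :: "real^'n"
    assume "u \<in> cube01" "v \<in> B u" "u' \<in> cube01" "v' \<in> B u'" and eq: "\<phi> (u,v) = \<phi> (u',v')"
    hence c: "u \<in> cube01" "v \<in> lattice" "u' \<in> cube01" "v' \<in> lattice" by (auto simp: B_def split: if_splits)
    have "u$i = u'$i \<and> v$i = v'$i" for i
    proof -
      obtain a b where ab: "v$i = of_int a" "v'$i = of_int b" using c lattice_coord by metis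
      have e: "2 * v$i + u$i = 2 * v'$i + u'$i" using eq by (simp add: \<phi>_def vec_eq_iff)
      have "a = b"
      proof -
        have "\<bar>2 * (v$i - v'$i)\<bar> < 2" using e c by (auto simp: cube01_def) (smt (verit))
        hence "real_of_int \<bar>a - b\<bar> < 1" by (simp add: ab)
        hence "\<bar>a - b\<bar> < 1" by linarith
        thus ?thesis by linarith
      qed
      thus ?thesis using ab e by simp
    qed
    thus "u = u'" "v = v'" by (auto simp: vec_eq_iff)
  qed
  have ran: "\<phi> ` Sigma cube01 B = lattice - {0}"
  proof (intro equalityI subsetI)
    fix x assume "x \<in> \<phi> ` Sigma cube01 B"
    then obtain u v where x: "x = 2 *\<^sub>R v + u" "u \<in> cube01" "v \<in> B u" by (auto simp: \<phi>_def)
    hence vl: "v \<in> lattice" by (auto simp: B_def split: if_splits)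
    have "x \<in> lattice" using vl cube01_lattice[OF x(2)] by (auto simp: x(1) lattice_def)
    moreover have "x \<noteq> 0"
    proof
      assume "x = 0"
      hence "\<phi> (u,v) = \<phi> (0,0)" by (simp add: \<phi>_def x)
      have "u$i = 0 \<and> v$i = 0" for i
      proof -
        have e: "2 * v$i + u$i = 0" using \<open>x = 0\<close> by (simp add: x(1) vec_eq_iff)
        obtain a where a: "v$i = of_int a" using vl lattice_coord by metis
        have "\<bar>2 * v$i\<bar> < 2" using e x(2) by (auto simp: cube01_def) (smt (verit))
        hence "a = 0" using a by linarith
        thus ?thesis using a e by simp
      qed
      hence "u = 0" "v = 0" by (auto simp: vec_eq_iff)
      thus False using x(3) by (simp add: B_def)
    qed
    ultimately show "x \<in> lattice - {0}" by simp
  next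
    fix x :: "real^'n" assume x: "x \<in> lattice - {0}"
    define v :: "real^'n" where "v = (\<chi> i. of_int \<lfloor>x$i / 2\<rfloor>)"
    define u where "u = x - 2 *\<^sub>R v"
    have "u \<in> cube01" unfolding cube01_def
    proof safe
      fix i assume 1: "u$i \<noteq> 1"
      obtain a where a: "x$i = of_int a" using x lattice_coord by (metis DiffD1)
      have "\<lfloor>x$i / 2\<rfloor> = a div 2" unfolding a by (metis floor_divide_of_int_eq of_int_numeral)
      hence "u$i = of_int (a - 2 * (a div 2))" by (simp add: u_def v_def a)
      also have "a - 2 * (a div 2) = a mod 2" by (simp add: minus_mult_div_eq_mod)
      finally show "u$i = 0" using 1 by (cases "a mod 2 = 0") auto
    qed
    moreover have "v \<in> B u" using x by (auto simp: B_def v_def lattice_def u_def)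
    moreover have "x = \<phi> (u,v)" by (simp add: \<phi>_def u_def)
    ultimately show "x \<in> \<phi> ` Sigma cube01 B" by blast
  qed
  have s: "(\<lambda>(u,v). f (2 *\<^sub>R v + u)) summable_on Sigma cube01 B"
    using f unfolding ran[symmetric] summable_on_reindex[OF inj] by (simp add: \<phi>_def o_def case_prod_unfold)
  have B: "(\<lambda>v. f (2 *\<^sub>R v + u)) summable_on B u" if "u \<in> cube01" for u
    using summable_on_SigmaD1[OF s that] by simp
  thus B0: "(\<lambda>v. f (2 *\<^sub>R v + u)) summable_on (lattice - {0})" if "u \<in> cube01" for u
    using summable_on_subset_banach[OF B[OF that]] by (auto simp: B_def)
  have z: "infsum (\<lambda>v. f (2 *\<^sub>R v + u)) (B u) = f u + infsum (\<lambda>v. f (2 *\<^sub>R v + u)) (lattice - {0})" if "u \<in> cube01 - {0}" for u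
  proof -
    have *: "B u = insert 0 (lattice - {0})" using that by (auto simp: B_def lattice_def)
    show ?thesis unfolding * by (subst infsum_insert) (use B0[of u] that in auto)
  qed
  have "infsum f (lattice - {0}) = infsum (\<lambda>(u,v). f (2 *\<^sub>R v + u)) (Sigma cube01 B)"
    unfolding ran[symmetric] infsum_reindex[OF inj] by (simp add: \<phi>_def o_def case_prod_unfold)
  also have "\<dots> = infsum (\<lambda>u. infsum (\<lambda>v. f (2 *\<^sub>R v + u)) (B u)) cube01"
    using infsum_Sigma'_banach[OF s] by simp
  also have "\<dots> = (\<Sum>u\<in>cube01. infsum (\<lambda>v. f (2 *\<^sub>R v + u)) (B u))"
    by (rule infsum_finite[OF finite_cube01])
  also have "\<dots> = infsum (\<lambda>v. f (2 *\<^sub>R v)) (lattice - {0}) + (\<Sum>u\<in>cube01-{0}. infsum (\<lambda>v. f (2 *\<^sub>R v + u)) (B u))"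
    by (subst sum.remove[OF finite_cube01 zero_cube01]) (simp add: B_def)
  also have "(\<Sum>u\<in>cube01-{0}. infsum (\<lambda>v. f (2 *\<^sub>R v + u)) (B u)) = (\<Sum>u\<in>cube01 - {0}. f u + infsum (\<lambda>v. f (2 *\<^sub>R v + u)) (lattice - {0}))"
    by (rule sum.cong) (auto simp: z)
  finally show "infsum f (lattice - {0}) = infsum (\<lambda>v. f (2 *\<^sub>R v)) (lattice - {0}) +
     (\<Sum>u\<in>cube01 - {0}. f u + infsum (\<lambda>v. f (2 *\<^sub>R v + u)) (lattice - {0}))" .
qed

text \<open>Each coordinate of \<open>v\<close> is \<open>0\<close> or at least \<open>1\<close> in absolute value, so doubling it and adding a number from
\<open>[0, 1]\<close> cannot bring it closer to \<open>0\<close>. Hence the segment from \<open>2 v\<close> to \<open>2 v + u\<close> avoids the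
origin, and decay estimates in \<open>v\<close> hold along it.\<close>
lemma norm_2v_plus:
  assumes "v \<in> lattice" "u \<in> cube01" "t \<in> {0..1}"
  shows "norm (v::real^'n) \<le> norm (2 *\<^sub>R v + t *\<^sub>R u)"
proof (rule norm_le_componentwise_cart)
  fix i
  obtain a where a: "v$i = of_int a" using assms lattice_coord by metis
  have t: "0 \<le> t * u$i" "t * u$i \<le> 1" using assms by (auto simp: cube01_def) (metis mult_zero_right order_refl mult.right_neutral zero_le_one)+
  have "v$i = 0 \<or> v$i \<ge> 1 \<or> v$i \<le> -1" 
  proof -
    have "a = 0 \<or> a \<ge> 1 \<or> a \<le> -1" by linarith
    thus ?thesis unfolding a by (metis of_int_0 of_int_1 of_int_le_iff of_int_minus)
  qed
  hence "\<bar>v$i\<bar> \<le> \<bar>2 * v$i + t * u$i\<bar>" using t by (auto split: abs_split)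
  thus "norm (v $ i) \<le> norm ((2 *\<^sub>R v + t *\<^sub>R u) $ i)" by simp
qed

lemma of_real_powr_exp: "x > 0 \<Longrightarrow> complex_of_real x powr z = exp (z * of_real (ln x))"
  by (simp add: powr_def Ln_of_real)

text \<open>The family \<open>G\<close> is only meaningful for \<open>Re w > c\<close>, where its series converges; \<open>W\<close> and \<open>D\<close> describe its
continuation to \<open>Re w > b\<close>. The point is that one denominator \<open>D\<close> serves all parameters: poles do not move
with \<open>p\<close>, so the continuation can be integrated over \<open>p\<close>.\<close>
definition mero_family :: "'p::metric_space set \<Rightarrow> real \<Rightarrow> real \<Rightarrow> ('p \<Rightarrow> complex \<Rightarrow> complex) \<Rightarrow> bool" where
  "mero_family P c b G \<longleftrightarrow> (\<exists>D W. D holomorphic_on UNIV \<and> (\<exists>w. D w \<noteq> 0) \<and> joint_hol P {w. Re w > b} W \<and>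
      (\<forall>p\<in>P. \<forall>w. Re w > c \<longrightarrow> D w * G p w = W p w))"

text \<open>Entire functions form an integral domain, by the identity theorem.\<close>
lemma entire_mult_nonzero:
  assumes "f holomorphic_on UNIV" "g holomorphic_on UNIV" "f a \<noteq> 0" "g b \<noteq> 0"
  shows "\<exists>w. f w * g w \<noteq> (0::complex)"
proof (rule ccontr)
  assume "\<not> ?thesis"
  hence z: "f w = 0 \<or> g w = 0" for w by auto
  have "continuous (at a) f" using holomorphic_on_imp_continuous_on[OF assms(1)] continuous_on_eq_continuous_at[OF open_UNIV] by blast
  then obtain e where e: "e > 0" "\<And>y. dist a y < e \<Longrightarrow> f y \<noteq> 0"
    using continuous_at_avoid[of a f 0] assms(3) by blast
  have "g b = 0"
    by (rule analytic_continuation_open[of "ball a e" UNIV g "\<lambda>_. 0"]) (use e z assms(2) in auto)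
  with assms show False by simp
qed

lemma mero_family_cong: "(\<And>p w. p \<in> P \<Longrightarrow> Re w > c \<Longrightarrow> F p w = G p w) \<Longrightarrow> mero_family P c b F \<longleftrightarrow> mero_family P c b G"
  unfolding mero_family_def by (intro ex_cong1 conj_cong refl) auto

lemma mero_family_joint_hol: "joint_hol P {w. Re w > b} F \<Longrightarrow> mero_family P c b F"
  unfolding mero_family_def by (intro exI[of _ "\<lambda>_. 1"] exI[of _ F]) auto

lemma mero_family_mono: "mero_family P c b F \<Longrightarrow> c \<le> c' \<Longrightarrow> b \<le> b' \<Longrightarrow> mero_family P c' b' F"
  unfolding mero_family_def by (elim exE, rule_tac x = D in exI, rule_tac x = W in exI) (auto intro: joint_hol_subset)

lemma mero_family_add:
  assumes "mero_family P c b F" "mero_family P c b G"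
  shows "mero_family P c b (\<lambda>p w. F p w + G p w)"
proof -
  obtain D W where 1: "D holomorphic_on UNIV" "\<exists>w. D w \<noteq> 0" "joint_hol P {w. Re w > b} W"
     "\<And>p w. p \<in> P \<Longrightarrow> Re w > c \<Longrightarrow> D w * F p w = W p w" using assms(1) unfolding mero_family_def by blast
  obtain D' W' where 2: "D' holomorphic_on UNIV" "\<exists>w. D' w \<noteq> 0" "joint_hol P {w. Re w > b} W'"
     "\<And>p w. p \<in> P \<Longrightarrow> Re w > c \<Longrightarrow> D' w * G p w = W' p w" using assms(2) unfolding mero_family_def by blast
  have n: "joint_hol P {w. Re w > b} (\<lambda>p w. D' w * W p w + D w * W' p w)"
    using 1 2 by (intro joint_hol_add joint_hol_mult joint_hol_const_param) (auto intro: holomorphic_on_subset)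
  have "D w * D' w * (F p w + G p w) = D' w * W p w + D w * W' p w" if "p \<in> P" "Re w > c" for p w
    using 1(4)[OF that] 2(4)[OF that] by (simp add: algebra_simps flip: 1(4)[OF that] 2(4)[OF that])
  thus ?thesis unfolding mero_family_def using n entire_mult_nonzero[OF 1(1) 2(1)] 1(2) 2(2) 1(1) 2(1)
    by (intro exI[of _ "\<lambda>w. D w * D' w"] exI[of _ "\<lambda>p w. D' w * W p w + D w * W' p w"]) (auto intro!: holomorphic_intros)
qed

lemma mero_family_0: "mero_family P c b (\<lambda>p w. 0)"
  by (rule mero_family_joint_hol) (auto intro: joint_hol_const_param)

lemma mero_family_sum: "finite I \<Longrightarrow> (\<And>i. i \<in> I \<Longrightarrow> mero_family P c b (F i)) \<Longrightarrow> mero_family P c b (\<lambda>p w. \<Sum>i\<in>I. F i p w)"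
  by (induction I rule: finite_induct) (auto intro: mero_family_add mero_family_0)

lemma mero_family_mult_entire:
  assumes "mero_family P c b F" "h holomorphic_on UNIV"
  shows "mero_family P c b (\<lambda>p w. h w * F p w)"
proof -
  obtain D W where 1: "D holomorphic_on UNIV" "\<exists>w. D w \<noteq> 0" "joint_hol P {w. Re w > b} W"
     "\<And>p w. p \<in> P \<Longrightarrow> Re w > c \<Longrightarrow> D w * F p w = W p w" using assms(1) unfolding mero_family_def by blast
  have "joint_hol P {w. Re w > b} (\<lambda>p w. h w * W p w)"
    using 1 assms by (intro joint_hol_mult joint_hol_const_param) (auto intro: holomorphic_on_subset)
  thus ?thesis unfolding mero_family_def using 1
    by (intro exI[of _ D] exI[of _ "\<lambda>p w. h w * W p w"]) (auto simp flip: 1(4))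
qed

lemma mero_family_divide_entire:
  assumes "mero_family P c b (\<lambda>p w. h w * F p w)" "h holomorphic_on UNIV" "h a \<noteq> 0"
  shows "mero_family P c b F"
proof -
  obtain D W where 1: "D holomorphic_on UNIV" "\<exists>w. D w \<noteq> 0" "joint_hol P {w. Re w > b} W"
     "\<And>p w. p \<in> P \<Longrightarrow> Re w > c \<Longrightarrow> D w * (h w * F p w) = W p w" using assms(1) unfolding mero_family_def by blast
  show ?thesis unfolding mero_family_def using 1 entire_mult_nonzero[OF 1(1) assms(2) _ assms(3)] assms(2)
    by (intro exI[of _ "\<lambda>w. D w * h w"] exI[of _ W]) (auto simp: mult.assoc intro!: holomorphic_intros)
qed

section \<open>Lattice sums of symbols and their continuation\<close>

text \<open>A bound for \<open>\<rho> powr y\<close> that is uniform for \<open>\<rho>\<close> in a compact interval and bounded exponents of either sign.\<close>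
lemma powr_bound:
  fixes c C r y \<rho> :: real
  assumes "c > 0" "\<rho> \<ge> c" "\<rho> \<le> C" "\<bar>y\<bar> \<le> r"
  shows "\<rho> powr y \<le> max (max C (inverse c)) 1 powr r"
proof -
  let ?K = "max (max C (inverse c)) 1"
  have "\<rho> powr y \<le> ?K powr \<bar>y\<bar>"
  proof (cases "y \<ge> 0")
    case True
    have "\<rho> powr y \<le> ?K powr y" using assms True by (intro powr_mono2) auto
    thus ?thesis using True by simp
  next
    case False
    have "\<rho> powr y = inverse \<rho> powr (- y)" using assms by (simp add: powr_minus inverse_powr)
    also have "\<dots> \<le> ?K powr (-y)"
    proof (rule powr_mono2)
      have "inverse \<rho> \<le> inverse c" using assms by (intro le_imp_inverse_le) auto
      thus "inverse \<rho> \<le> ?K" by linarith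
    qed (use assms False in auto)
    finally show ?thesis using False by simp
  qed
  also have "\<dots> \<le> ?K powr r" using assms by (intro powr_mono) auto
  finally show ?thesis .
qed

context linear_family
begin

text \<open>Homogeneous of degree \<open>- w - d\<close> when \<open>a\<close> is a symbol of degree \<open>d\<close>.\<close>
definition symbol_fun :: "('p \<Rightarrow> complex \<Rightarrow> real^'n \<Rightarrow> complex) \<Rightarrow> 'p \<Rightarrow> complex \<Rightarrow> real^'n \<Rightarrow> complex" where
  "symbol_fun a p w x = a p w x * of_real (norm (L p x)) powr (- w)"

lemma symbol_fun_joint_hol: 
  assumes "symbol d a" "x \<noteq> 0"
  shows "joint_hol P UNIV (\<lambda>p w. symbol_fun a p w x)"
proof -
  have e: "symbol_fun a p w x = a p w x * exp (- w * of_real (ln (norm (L p x))))" if "p \<in> P" for p w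
    using L_pos[OF that assms(2)] by (simp add: symbol_fun_def of_real_powr_exp)
  have "joint_hol P UNIV (\<lambda>p w. a p w x * exp (- w * of_real (ln (norm (L p x)))))"
  proof (intro joint_hol_mult symbol_joint_hol[OF assms])
    show "joint_hol P UNIV (\<lambda>p w. exp (- w * complex_of_real (ln (norm (L p x)))))"
      unfolding joint_hol_def case_prod_unfold using L_pos assms(2)
      by (auto intro!: continuous_intros holomorphic_intros dest: injL)
  qed
  thus ?thesis by (subst joint_hol_cong[OF e])
qed

lemma symbol_fun_hom:
  assumes "symbol d a" "p \<in> P" "x \<noteq> 0"
  shows "symbol_fun a p w (2 *\<^sub>R x) = 2 powr (- w - of_real d) * symbol_fun a p w x"
proof -
  have n: "norm (L p (2 *\<^sub>R x)) = 2 * norm (L p x)" using linL[OF assms(2)] by (simp add: linear_cmul)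
  have "complex_of_real (2 * norm (L p x)) powr (- w) = 2 powr (- w) * complex_of_real (norm (L p x)) powr (- w)"
    by (subst of_real_mult, subst powr_times_real) auto
  moreover have "(2::complex) powr (- w - of_real d) = 2 powr (-w) * of_real (2 powr (- d))"
  proof -
    have "complex_of_real (2 powr (- d)) = 2 powr (- of_real d)" using powr_of_real[of 2 "-d"] by simp
    thus ?thesis by (simp add: powr_add[symmetric])
  qed
  ultimately show ?thesis using symbol_hom[OF assms(1,2), of w x]
    by (simp only: symbol_fun_def n mult_ac)
qed

lemma symbol_fun_bound:
  assumes "symbol d a"
  shows "\<exists>B\<ge>0. \<forall>p\<in>P. \<forall>w. norm w \<le> r \<longrightarrow> (\<forall>x. x \<noteq> 0 \<longrightarrow> norm (symbol_fun a p w x) \<le> B * norm x powr (- (Re w + d)))"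
proof -
  obtain B where B: "B \<ge> 0" "\<And>p w x. p\<in>P \<Longrightarrow> norm w \<le> r \<Longrightarrow> x \<noteq> 0 \<Longrightarrow> norm (a p w x) \<le> B * norm x powr (- d)"
    using symbol_bound[OF assms, of r] by metis
  obtain c C where C: "c > 0" "C > 0" "\<And>p x. p \<in> P \<Longrightarrow> c * norm x \<le> norm (L p x)" 
    "\<And>p x. p \<in> P \<Longrightarrow> norm (L p x) \<le> C * norm x" using bounds by blast
  define M where "M = max (max C (inverse c)) 1 powr r"
  have "norm (symbol_fun a p w x) \<le> (B * M) * norm x powr (- (Re w + d))" if h: "p \<in> P" "norm w \<le> r" "x \<noteq> 0" for p w x
  proof -
    define \<rho> where "\<rho> = norm (L p x) / norm x"
    have \<rho>: "\<rho> \<ge> c" "\<rho> \<le> C" using C(3,4)[OF h(1), of x] h(3) by (auto simp: \<rho>_def field_simps)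
    have "norm (complex_of_real (norm (L p x)) powr (- w)) = norm (L p x) powr (- Re w)"
      using L_pos[OF h(1,3)] by (simp add: norm_powr_real_powr)
    also have "\<dots> = (norm x * \<rho>) powr (- Re w)" using h(3) by (simp add: \<rho>_def)
    also have "(norm x * \<rho>) powr (- Re w) = norm x powr (- Re w) * \<rho> powr (- Re w)"
      using \<rho> C(1) by (subst powr_mult) auto
    also have "\<dots> \<le> norm x powr (- Re w) * M" unfolding M_def
      using \<rho> C(1) h(2) abs_Re_le_cmod[of w] by (intro mult_left_mono powr_bound) auto
    finally have "norm (symbol_fun a p w x) \<le> (B * norm x powr (- d)) * (norm x powr (- Re w) * M)"
      unfolding symbol_fun_def norm_mult using B(2)[OF h] B(1) by (intro mult_mono) auto
    also have "\<dots> = (B * M) * norm x powr (- (Re w + d))" 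
      by (simp add: powr_add powr_minus powr_diff field_simps)
    finally show ?thesis .
  qed
  moreover have "M \<ge> 0" by (simp add: M_def)
  ultimately show ?thesis using B(1) by (intro exI[of _ "B * M"]) auto
qed

text \<open>The product rule. The second summand of the new symbol comes from
\<open>norm (L p x) powr (- w) = ((norm (L p x))\<^sup>2) powr (- w / 2)\<close>, whose base is a smooth function of \<open>x\<close>.\<close>
lemma symbol_fun_deriv:
  assumes "symbol d a"
  shows "\<exists>a'. symbol (d + 1) a' \<and> dir_deriv u (symbol_fun a) (symbol_fun a')"
proof -
  obtain a' where a': "symbol (d + 1) a'" "dir_deriv u a a'" using symbol_deriv[OF assms] by blast
  define b where "b = (\<lambda>p w x. a' p w x + ((- w) * a p w x) * (of_real (inverse ((norm (L p x))\<^sup>2)) * of_real (L p x \<bullet> L p u)))"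
  have "symbol (((0 + d) + (2 + (-1)))) (\<lambda>p w x. ((- w) * a p w x) * (of_real (inverse ((norm (L p x))\<^sup>2)) * of_real (L p x \<bullet> L p u)))"
    by (intro symbol.mult symbol.inv symbol.lin assms symbol.const joint_hol_const_param) (auto intro!: holomorphic_intros)
  hence "symbol (d + 1) b" unfolding b_def using a' by (intro symbol.add) auto
  moreover have "dir_deriv u (symbol_fun a) (symbol_fun b)" unfolding dir_deriv_def
  proof safe
    fix p w x and t :: real assume p: "p \<in> P" "x + t *\<^sub>R u \<noteq> 0"
    define N where "N = (\<lambda>t. (norm (L p (x + t *\<^sub>R u)))\<^sup>2)"
    define q where "q = L p (x + t *\<^sub>R u) \<bullet> L p u"
    have Np: "N t > 0" using L_pos[OF p] by (simp add: N_def)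
    have Nl: "norm (L p (x + s *\<^sub>R u)) = 0 \<longleftrightarrow> N s = 0" for s by (simp add: N_def)
    have e: "complex_of_real (norm (L p (x + s *\<^sub>R u))) powr (- w) = of_real (N s) powr (- w / 2)" for s
    proof (cases "N s = 0")
      case False
      hence "norm (L p (x + s *\<^sub>R u)) > 0" by (simp add: Nl[symmetric])
      thus ?thesis unfolding N_def by (simp add: of_real_powr_exp ln_realpow del: of_real_power)
    qed (simp add: Nl[symmetric] N_def)
    have dN: "(N has_real_derivative 2 * q) (at t)" unfolding N_def q_def by (rule dir_deriv_norm2[OF p(1)])
    have dN': "((\<lambda>s. complex_of_real (N s)) has_vector_derivative of_real (2 * q)) (at t)"
      by (rule has_vector_derivative_of_real[OF dN])
    have "((\<lambda>z. z powr (- w / 2)) has_field_derivative (- w / 2) * of_real (N t) powr (- w / 2 - 1)) (at (of_real (N t)))"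
      by (rule has_field_derivative_powr) (use Np in \<open>auto simp: complex_nonpos_Reals_iff\<close>)
    from field_vector_diff_chain_at[OF dN' this]
    have "((\<lambda>s. complex_of_real (N s) powr (- w / 2)) has_vector_derivative of_real (2 * q) * ((- w / 2) * of_real (N t) powr (- w / 2 - 1))) (at t)"
      by (simp add: o_def)
    also have "complex_of_real (N t) powr (- w / 2 - 1) = of_real (N t) powr (- w / 2) / of_real (N t)"
      using Np by (subst powr_diff) auto
    also have "of_real (2 * q) * ((- w / 2) * (of_real (N t) powr (- w / 2) / of_real (N t))) = 
      (- w) * (of_real (inverse (N t)) * of_real q) * of_real (N t) powr (- w / 2)" by (simp add: field_simps)
    finally have d2: "((\<lambda>s. complex_of_real (norm (L p (x + s *\<^sub>R u))) powr (- w)) has_vector_derivative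
      (- w) * (of_real (inverse (N t)) * of_real q) * of_real (N t) powr (- w / 2)) (at t)"
      by (simp add: e)
    have d1: "((\<lambda>t. a p w (x + t *\<^sub>R u)) has_vector_derivative a' p w (x + t *\<^sub>R u)) (at t)"
      using a'(2) p by (auto simp: dir_deriv_def)
    have "((\<lambda>s. symbol_fun a p w (x + s *\<^sub>R u)) has_vector_derivative 
      a p w (x + t *\<^sub>R u) * ((- w) * (of_real (inverse (N t)) * of_real q) * of_real (N t) powr (- w / 2)) + 
      a' p w (x + t *\<^sub>R u) * complex_of_real (norm (L p (x + t *\<^sub>R u))) powr (- w)) (at t)"
      unfolding symbol_fun_def by (rule has_vector_derivative_mult[OF d1 d2])
    also have "a p w (x + t *\<^sub>R u) * ((- w) * (of_real (inverse (N t)) * of_real q) * of_real (N t) powr (- w / 2)) + 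
      a' p w (x + t *\<^sub>R u) * complex_of_real (norm (L p (x + t *\<^sub>R u))) powr (- w) = symbol_fun b p w (x + t *\<^sub>R u)"
      unfolding e by (simp add: symbol_fun_def b_def e N_def q_def algebra_simps)
    finally show "((\<lambda>t. symbol_fun a p w (x + t *\<^sub>R u)) has_vector_derivative symbol_fun b p w (x + t *\<^sub>R u)) (at t)" .
  qed
  ultimately show ?thesis by blast
qed

definition symbol_sum :: "('p \<Rightarrow> complex \<Rightarrow> real^'n \<Rightarrow> complex) \<Rightarrow> 'p \<Rightarrow> complex \<Rightarrow> complex" where
  "symbol_sum a p w = infsum (symbol_fun a p w) (lattice - {0})"

lemma local_box:
  assumes "Re w0 > b"
  obtains r where "r > 0" "\<And>w. w \<in> cball w0 r \<Longrightarrow> Re w \<ge> (Re w0 + b) / 2" "\<And>w. w \<in> cball w0 r \<Longrightarrow> norm w \<le> norm w0 + r"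
proof (rule that[of "(Re w0 - b) / 2"])
  fix w assume w: "w \<in> cball w0 ((Re w0 - b) / 2)"
  show "Re w \<ge> (Re w0 + b) / 2"
    using w abs_Re_le_cmod[of "w0 - w"] by (auto simp: dist_norm field_simps abs_le_iff)
  show "norm w \<le> norm w0 + (Re w0 - b) / 2"
    using w norm_triangle_ineq[of w0 "w - w0"] by (simp add: dist_norm norm_minus_commute field_simps)
qed (use assms in auto)

text \<open>The hypothesis asks for decay of order \<open>Re w + e\<close> with a constant that is uniform for bounded \<open>w\<close>. On a small
disc the exponent stays above the dimension, which gives a summable majorant.\<close>
lemma joint_hol_lattice_sum:
  assumes A: "A \<subseteq> (lattice :: (real^'n) set) - {0}"
    and F: "\<And>v. v \<in> A \<Longrightarrow> joint_hol P {w. Re w > real CARD('n) - e} (F v)"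
    and bd: "\<And>r. \<exists>B\<ge>0. \<forall>p\<in>P. \<forall>w. norm w \<le> r \<longrightarrow> Re w > real CARD('n) - e \<longrightarrow> (\<forall>v\<in>A. norm (F v p w) \<le> B * norm v powr (- (Re w + e)))"
  shows "joint_hol P {w. Re w > real CARD('n) - e} (\<lambda>p w. \<Sum>\<^sub>\<infinity>v\<in>A. F v p w)"
    and "p \<in> P \<Longrightarrow> Re w > real CARD('n) - e \<Longrightarrow> (\<lambda>v. F v p w) summable_on A"
proof -
  have 1: "\<exists>r>0. \<exists>M. cball w0 r \<subseteq> {w. Re w > real CARD('n) - e} \<and> M summable_on A \<and> (\<forall>v\<in>A. \<forall>p\<in>P. \<forall>w\<in>cball w0 r. norm (F v p w) \<le> M v)"
    if w0: "w0 \<in> {w. Re w > real CARD('n) - e}" for w0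
  proof -
    define \<sigma> where "\<sigma> = (Re w0 + (real CARD('n) - e)) / 2"
    obtain r where r: "r > 0" "\<And>w. w \<in> cball w0 r \<Longrightarrow> Re w \<ge> \<sigma>" "\<And>w. w \<in> cball w0 r \<Longrightarrow> norm w \<le> norm w0 + r"
      using local_box[of "real CARD('n) - e" w0] w0 unfolding \<sigma>_def by (metis mem_Collect_eq)
    have \<sigma>: "\<sigma> > real CARD('n) - e" using w0 by (simp add: \<sigma>_def)
    obtain B where B: "B \<ge> 0" "\<And>p w v. p \<in> P \<Longrightarrow> norm w \<le> norm w0 + r \<Longrightarrow> Re w > real CARD('n) - e \<Longrightarrow> v \<in> A \<Longrightarrow> norm (F v p w) \<le> B * norm v powr (- (Re w + e))"
      using bd[of "norm w0 + r"] by blast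
    have "(\<lambda>v::real^'n. B * norm v powr (- (\<sigma> + e))) summable_on (lattice - {0})"
      using \<sigma> by (intro summable_on_cmult_right summable_lattice_powr) auto
    hence "(\<lambda>v::real^'n. B * norm v powr (- (\<sigma> + e))) summable_on A"
      using A by (rule summable_on_subset_banach)
    moreover have "norm (F v p w) \<le> B * norm v powr (- (\<sigma> + e))" if "v \<in> A" "p \<in> P" "w \<in> cball w0 r" for v p w
    proof -
      have "v \<in> lattice - {0}" using that A by auto
      then obtain i0 where "v$i0 \<noteq> 0" by (auto simp: vec_eq_iff)
      with \<open>v \<in> lattice - {0}\<close> have "\<bar>v$i0\<bar> \<ge> 1" by (auto simp: lattice_def intro!: Ints_nonzero_abs_ge1)
      hence n1: "norm v \<ge> 1" using component_le_norm_cart[of v i0] by simp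
      have "norm (F v p w) \<le> B * norm v powr (- (Re w + e))" using B(2)[of p w v] that r \<sigma> by fastforce
      also have "\<dots> \<le> B * norm v powr (- (\<sigma> + e))" using n1 r(2)[OF that(3)] B(1) by (intro mult_left_mono powr_mono) auto
      finally show ?thesis .
    qed
    moreover have "cball w0 r \<subseteq> {w. Re w > real CARD('n) - e}" using r(2) \<sigma> by force
    ultimately show ?thesis using r(1) by blast
  qed
  show "joint_hol P {w. Re w > real CARD('n) - e} (\<lambda>p w. \<Sum>\<^sub>\<infinity>v\<in>A. F v p w)"
    by (rule joint_hol_infsum[OF open_halfspace_Re_gt F 1])
  assume "p \<in> P" "Re w > real CARD('n) - e"
  with 1[of w] obtain M r where M: "r > 0" "M summable_on A" "\<forall>v\<in>A. \<forall>p\<in>P. \<forall>w\<in>cball w r. norm (F v p w) \<le> M v" by blast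
  have "(\<lambda>v. norm (F v p w)) summable_on A"
    by (rule summable_on_comparison_test[OF M(2)]) (use M \<open>p \<in> P\<close> in auto)
  thus "(\<lambda>v. F v p w) summable_on A" by (rule abs_summable_summable)
qed

lemma 
  assumes "symbol d a" "A \<subseteq> lattice - {0}"
  shows joint_hol_subsum: "joint_hol P {w. Re w > real CARD('n) - d} (\<lambda>p w. \<Sum>\<^sub>\<infinity>v\<in>A. symbol_fun a p w v)"
    and summable_subsum: "p \<in> P \<Longrightarrow> Re w > real CARD('n) - d \<Longrightarrow> (symbol_fun a p w) summable_on A"
proof -
  have F: "joint_hol P {w. Re w > real CARD('n) - d} (\<lambda>p w. symbol_fun a p w v)" if "v \<in> A" for v
    by (rule joint_hol_subset[OF symbol_fun_joint_hol[OF assms(1)]]) (use that assms(2) in auto)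
  have b: "\<exists>B\<ge>0. \<forall>p\<in>P. \<forall>w. norm w \<le> r \<longrightarrow> Re w > real CARD('n) - d \<longrightarrow> (\<forall>v\<in>A. norm (symbol_fun a p w v) \<le> B * norm v powr (- (Re w + d)))" for r
  proof -
    obtain B where "B \<ge> 0" "\<And>p w x. p\<in>P \<Longrightarrow> norm w \<le> r \<Longrightarrow> x \<noteq> 0 \<Longrightarrow> norm (symbol_fun a p w x) \<le> B * norm x powr (- (Re w + d))"
      using symbol_fun_bound[OF assms(1), of r] by metis
    thus ?thesis using assms(2) by (intro exI[of _ B]) auto
  qed
  show "joint_hol P {w. Re w > real CARD('n) - d} (\<lambda>p w. \<Sum>\<^sub>\<infinity>v\<in>A. symbol_fun a p w v)"
    by (rule joint_hol_lattice_sum(1)[where F = "\<lambda>v p w. symbol_fun a p w v", OF assms(2) F b])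
  show "p \<in> P \<Longrightarrow> Re w > real CARD('n) - d \<Longrightarrow> (symbol_fun a p w) summable_on A"
    by (rule joint_hol_lattice_sum(2)[where F = "\<lambda>v p w. symbol_fun a p w v", OF assms(2) F b])
qed

end

lemma has_sum_finite_sum:
  fixes f :: "'i \<Rightarrow> 'a \<Rightarrow> complex"
  assumes "finite I" "\<And>i. i \<in> I \<Longrightarrow> (f i has_sum s i) A"
  shows "((\<lambda>x. \<Sum>i\<in>I. f i x) has_sum (\<Sum>i\<in>I. s i)) A"
  using assms
proof (induction I rule: finite_induct)
  case (insert i I)
  have "((\<lambda>x. f i x + (\<Sum>i\<in>I. f i x)) has_sum (s i + (\<Sum>i\<in>I. s i))) A"
    by (intro has_sum_add insert.prems insert.IH) auto
  thus ?case using insert.hyps by simp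
qed auto

lemma cube_sum_rearrange:
  fixes z :: complex
  shows "z = q * z + s + (t - 1) * (q * z) \<Longrightarrow> (1 - t * q) * z = s"
  by (simp add: algebra_simps)

context linear_family
begin

text \<open>In Taylor's formula of order \<open>N\<close> for the segment from \<open>2 v\<close> to \<open>2 v + u\<close>, the term of order \<open>j\<close> is a
symbol of degree \<open>d + j\<close> at \<open>2 v\<close>. By homogeneity its sum over \<open>v\<close> is an entire factor times a lattice sum
that only has to be continued by \<open>N - j < N\<close>; the remainder decays like degree \<open>d + N\<close> and converges in the
whole half plane in question.\<close>
lemma taylor_sum_mero_family:
  assumes a: "symbol d a" and u: "u \<in> cube01 - {0}" and N: "N \<ge> 1"
    and IH: "\<And>M e b. M < N \<Longrightarrow> symbol e b \<Longrightarrow> mero_family P (real CARD('n) - e) (real CARD('n) - e - real M) (symbol_sum b)"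
  shows "mero_family P (real CARD('n) - d) (real CARD('n) - d - real N) 
    (\<lambda>p w. \<Sum>\<^sub>\<infinity>v\<in>lattice - {0}. symbol_fun a p w (2 *\<^sub>R v + u) - symbol_fun a p w (2 *\<^sub>R v))"
proof -
  let ?n = "real CARD('n)"
  have "\<exists>A. A 0 = a \<and> (\<forall>j. (symbol (d + real j) (A j)) \<and> dir_deriv u (symbol_fun (A j)) (symbol_fun (A (Suc j))))"
  proof -
    have "\<exists>A. (A 0 = a \<and> (\<forall>j. symbol (d + real j) (A j))) \<and> (\<forall>j. dir_deriv u (symbol_fun (A j)) (symbol_fun (A (Suc j))))"
    proof -
      have step: "\<exists>y. symbol (d + real (Suc j)) y \<and> dir_deriv u (symbol_fun x) (symbol_fun y)" if "symbol (d + real j) x" for x j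
        using symbol_fun_deriv[OF that, of u] by (simp add: add_ac)
      define A where "A = rec_nat a (\<lambda>j x. SOME y. symbol (d + real (Suc j)) y \<and> dir_deriv u (symbol_fun x) (symbol_fun y))"
      have s: "symbol (d + real j) (A j)" for j
      proof (induction j)
        case (Suc j)
        show ?case using someI_ex[OF step[OF Suc]] by (simp add: A_def)
      qed (use a in \<open>simp add: A_def\<close>)
      have "dir_deriv u (symbol_fun (A j)) (symbol_fun (A (Suc j)))" for j
        using someI_ex[OF step[OF s[of j]]] by (simp add: A_def)
      thus ?thesis using s by (intro exI[of _ A]) (auto simp: A_def)
    qed
    thus ?thesis by blast
  qed
  then obtain A where A: "A 0 = a" "\<And>j. symbol (d + real j) (A j)" "\<And>j. dir_deriv u (symbol_fun (A j)) (symbol_fun (A (Suc j)))" by blast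
  \<comment> \<open>\<open>A j\<close> is the \<open>j\<close>-th derivative along \<open>u\<close>; \<open>R\<close> is the Taylor remainder, and \<open>c j\<close> the factor
    produced by homogeneity from the doubled argument, together with the Taylor coefficient.\<close>
  define R where "R = (\<lambda>v p w. symbol_fun a p w (2 *\<^sub>R v + u) - (\<Sum>j<N. (1 / fact j) *\<^sub>R symbol_fun (A j) p w (2 *\<^sub>R v)))"
  define c where "c = (\<lambda>j w. 2 powr (- w - of_real (d + real j)) / fact j :: complex)"
  have ch: "c j holomorphic_on UNIV" for j unfolding c_def by (auto intro!: holomorphic_intros)
  have nz: "2 *\<^sub>R v + t *\<^sub>R u \<noteq> 0" if "v \<in> lattice - {0}" "t \<in> {0..1}" for v t
  proof -
    have "norm v > 0" using that by auto
    also have "norm v \<le> norm (2 *\<^sub>R v + t *\<^sub>R u)" using norm_2v_plus[of v u t] u that by blast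
    finally show ?thesis using zero_less_norm_iff by blast
  qed
  have Rn: "joint_hol P {w. Re w > ?n - (d + real N)} (\<lambda>p w. R v p w)" if "v \<in> lattice - {0}" for v
  proof -
    have 1: "2 *\<^sub>R v + u \<noteq> 0" using nz[OF that, of 1] by simp
    have 2: "2 *\<^sub>R v \<noteq> 0" using that by (metis Diff_iff insertI1 scaleR_eq_0_iff zero_neq_numeral)
    have "joint_hol P UNIV (\<lambda>p w. of_real (1 / fact j) * symbol_fun (A j) p w (2 *\<^sub>R v))" for j
      by (rule joint_hol_mult[OF joint_hol_const_param symbol_fun_joint_hol[OF A(2) 2]]) auto
    hence "joint_hol P UNIV (\<lambda>p w. (1 / fact j) *\<^sub>R symbol_fun (A j) p w (2 *\<^sub>R v))" for j
      by (simp only: scaleR_conv_of_real[where 'a = complex])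
    hence "joint_hol P UNIV (R v)" unfolding R_def by (intro joint_hol_diff joint_hol_sum symbol_fun_joint_hol[OF a] 1)
    thus ?thesis by (rule joint_hol_subset) auto
  qed
  have Rb: "\<exists>B\<ge>0. \<forall>p\<in>P. \<forall>w. norm w \<le> r \<longrightarrow> Re w > ?n - (d + real N) \<longrightarrow> (\<forall>v\<in>lattice - {0}. norm (R v p w) \<le> B * norm v powr (- (Re w + (d + real N))))" for r
  proof -
    obtain B where B: "B \<ge> 0" "\<And>p w x. p\<in>P \<Longrightarrow> norm w \<le> r \<Longrightarrow> x \<noteq> 0 \<Longrightarrow> norm (symbol_fun (A N) p w x) \<le> B * norm x powr (- (Re w + (d + real N)))"
      using symbol_fun_bound[OF A(2)[of N], of r] by metis
    have "norm (R v p w) \<le> B * norm v powr (- (Re w + (d + real N)))" 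
      if h: "p \<in> P" "norm w \<le> r" "Re w > ?n - (d + real N)" "v \<in> lattice - {0}" for p w v
    proof -
      define g where "g = (\<lambda>j t. symbol_fun (A j) p w (2 *\<^sub>R v + t *\<^sub>R u))"
      have "norm (g 0 1 - (\<Sum>j<N. (1 ^ j / fact j) *\<^sub>R g j 0)) \<le> B * norm v powr (- (Re w + (d + real N)))"
      proof (rule Taylor_remainder_unit_interval)
        fix j and t :: real assume t: "t \<in> {0..1}"
        show "(g j has_vector_derivative g (Suc j) t) (at t within {0..1})"
          unfolding g_def using A(3)[of j, unfolded dir_deriv_def, rule_format, OF h(1) nz[OF h(4) t]]
          by (rule has_vector_derivative_at_within)
      next
        fix t :: real assume t: "t \<in> {0..1}"
        have "norm (g N t) \<le> B * norm (2 *\<^sub>R v + t *\<^sub>R u) powr (- (Re w + (d + real N)))"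
          unfolding g_def by (rule B(2)) (use h nz[OF h(4) t] in auto)
        also have "\<dots> \<le> B * norm v powr (- (Re w + (d + real N)))"
        proof (rule mult_left_mono[OF powr_mono2' B(1)])
          show "norm v \<le> norm (2 *\<^sub>R v + t *\<^sub>R u)" using norm_2v_plus[of v u t] u h t by auto
          have "?n > 0" by simp
          thus "- (Re w + (d + real N)) \<le> 0" using h(3) by linarith
          show "0 < norm v" using h(4) by simp
        qed
        finally show "norm (g N t) \<le> B * norm v powr (- (Re w + (d + real N)))" .
      qed auto
      thus ?thesis by (simp add: g_def R_def A(1))
    qed
    thus ?thesis using B(1) by (intro exI[of _ B]) auto
  qed
  have nR: "joint_hol P {w. Re w > ?n - d - real N} (\<lambda>p w. \<Sum>\<^sub>\<infinity>v\<in>lattice - {0}. R v p w)"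
    using joint_hol_lattice_sum(1)[where F = R and e = "d + real N", OF order_refl Rn Rb] by (simp add: algebra_simps)
  have sR: "(\<lambda>v. R v p w) summable_on (lattice - {0})" if "p \<in> P" "Re w > ?n - d" for p w
    by (rule joint_hol_lattice_sum(2)[where F = R and e = "d + real N", OF order_refl Rn Rb]) (use that in auto)
  have eq: "(\<Sum>\<^sub>\<infinity>v\<in>lattice - {0}. symbol_fun a p w (2 *\<^sub>R v + u) - symbol_fun a p w (2 *\<^sub>R v)) = 
     (\<Sum>j\<in>{1..<N}. c j w * symbol_sum (A j) p w) + (\<Sum>\<^sub>\<infinity>v\<in>lattice - {0}. R v p w)" if h: "p \<in> P" "Re w > ?n - d" for p w
  proof -
    have s: "symbol_fun (A j) p w summable_on (lattice - {0})" for j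
      by (rule summable_subsum[OF A(2)]) (use h in auto)
    have "symbol_fun a p w (2 *\<^sub>R v + u) - symbol_fun a p w (2 *\<^sub>R v) = (\<Sum>j\<in>{1..<N}. c j w * symbol_fun (A j) p w v) + R v p w"
      if v: "v \<in> lattice - {0}" for v
    proof -
      have "(\<Sum>j<N. (1 / fact j) *\<^sub>R symbol_fun (A j) p w (2 *\<^sub>R v)) = symbol_fun a p w (2 *\<^sub>R v) + (\<Sum>j\<in>{1..<N}. (1 / fact j) *\<^sub>R symbol_fun (A j) p w (2 *\<^sub>R v))"
        using N A(1) by (simp add: lessThan_atLeast0 sum.atLeast_Suc_lessThan)
      also have "(\<Sum>j\<in>{1..<N}. (1 / fact j) *\<^sub>R symbol_fun (A j) p w (2 *\<^sub>R v)) = (\<Sum>j\<in>{1..<N}. c j w * symbol_fun (A j) p w v)"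
        by (rule sum.cong[OF refl], subst symbol_fun_hom[OF A(2) h(1)]) (use v in \<open>auto simp: c_def scaleR_conv_of_real divide_simps\<close>)
      finally show ?thesis by (simp add: R_def)
    qed
    hence "(\<Sum>\<^sub>\<infinity>v\<in>lattice - {0}. symbol_fun a p w (2 *\<^sub>R v + u) - symbol_fun a p w (2 *\<^sub>R v)) = 
        (\<Sum>\<^sub>\<infinity>v\<in>lattice - {0}. (\<Sum>j\<in>{1..<N}. c j w * symbol_fun (A j) p w v) + R v p w)"
      by (intro infsum_cong) auto
    also have "\<dots> = (\<Sum>j\<in>{1..<N}. c j w * symbol_sum (A j) p w) + (\<Sum>\<^sub>\<infinity>v\<in>lattice - {0}. R v p w)"
      unfolding symbol_sum_def
      by (intro infsumI has_sum_add has_sum_finite_sum has_sum_cmult_right has_sum_infsum s sR h) auto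
    finally show ?thesis .
  qed
  have "mero_family P (?n - d) (?n - d - real N) (\<lambda>p w. (\<Sum>j\<in>{1..<N}. c j w * symbol_sum (A j) p w) + (\<Sum>\<^sub>\<infinity>v\<in>lattice - {0}. R v p w))"
  proof (intro mero_family_add mero_family_sum mero_family_mult_entire ch mero_family_joint_hol[OF nR])
    fix j assume j: "j \<in> {1..<N}"
    have "mero_family P (?n - (d + real j)) (?n - (d + real j) - real (N - j)) (symbol_sum (A j))"
      by (rule IH[OF _ A(2)]) (use j in auto)
    thus "mero_family P (?n - d) (?n - d - real N) (symbol_sum (A j))"
      by (rule mero_family_mono) (use j in \<open>auto simp: of_nat_diff\<close>)
  qed auto
  thus ?thesis by (rule mero_family_cong[THEN iffD2, rotated]) (rule eq)
qed

lemma one_symbol: "symbol 0 (\<lambda>p w x. 1)"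
  by (rule symbol.const) (auto intro: joint_hol_const_param)

text \<open>Split the lattice by parity. Each of the \<open>2\<^sup>n\<close> classes contributes \<open>2 powr (- w - d)\<close> times the full sum,
up to differences that \<open>taylor_sum_mero_family\<close> continues. Solving for the full sum means dividing by
\<open>1 - 2\<^sup>n * 2 powr (- w - d)\<close>, an entire function independent of the family.\<close>
theorem symbol_sum_continuation:
  "symbol d a \<Longrightarrow> mero_family P (real CARD('n) - d) (real CARD('n) - d - real N) (symbol_sum a)"
proof (induction N arbitrary: d a rule: less_induct)
  case (less N)
  let ?n = "real CARD('n)"
  let ?T = "\<lambda>u p w. \<Sum>\<^sub>\<infinity>v\<in>lattice - {0}. symbol_fun a p w (2 *\<^sub>R v + u) - symbol_fun a p w (2 *\<^sub>R v)"
  have nZ: "joint_hol P {w. Re w > ?n - d} (symbol_sum a)"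
    using joint_hol_subsum[OF less.prems order_refl] by (simp add: symbol_sum_def[abs_def])
  show ?case
  proof (cases "N = 0")
    case True
    thus ?thesis using mero_family_joint_hol[OF nZ] by simp
  next
    case False
    define h where "h = (\<lambda>w. 1 - 2 ^ CARD('n) * 2 powr (- w - of_real d) :: complex)"
    have hh: "h holomorphic_on UNIV" unfolding h_def by (auto intro!: holomorphic_intros)
    \<comment> \<open>At this point \<open>2\<^sup>n * 2 powr (- w - d) = 1/2\<close>.\<close>
    have h0: "h (of_real (?n + 1 - d)) \<noteq> 0"
    proof -
      have "- complex_of_real (?n + 1 - d) - of_real d = of_real (- (?n + 1))" by simp
      hence "h (of_real (?n + 1 - d)) = of_real (1 - 2 ^ CARD('n) * 2 powr (- (?n + 1)))"
        using powr_of_real[of 2 "- (?n + 1)"] by (simp only: h_def) simp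
      also have "(2::real) ^ CARD('n) * 2 powr (- (?n + 1)) = 1/2"
        by (simp add: powr_diff powr_minus powr_realpow field_simps)
      finally have e: "h (of_real (?n + 1 - d)) = of_real (1 - 1/2)" .
      show ?thesis unfolding e by simp
    qed
    have cf: "mero_family P (?n - d) (?n - d - real N) (\<lambda>p w. \<Sum>u\<in>cube01-{0}. symbol_fun a p w u + 
        ?T u p w)"
    proof (intro mero_family_sum mero_family_add)
      fix u :: "real^'n" assume u: "u \<in> cube01 - {0}"
      show "mero_family P (?n - d) (?n - d - real N) (\<lambda>p w. symbol_fun a p w u)"
        by (rule mero_family_joint_hol, rule joint_hol_subset[OF symbol_fun_joint_hol[OF less.prems]]) (use u in auto)
      show "mero_family P (?n - d) (?n - d - real N) (?T u)"
        by (rule taylor_sum_mero_family[OF less.prems u]) (use False less.IH in auto)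
    qed (auto simp: finite_cube01)
    have eq: "h w * symbol_sum a p w = (\<Sum>u\<in>cube01-{0}. symbol_fun a p w u + 
        ?T u p w)" if p: "p \<in> P" "Re w > ?n - d" for p w
    proof -
      have s: "symbol_fun a p w summable_on (lattice - {0})" 
        by (rule summable_subsum[OF less.prems]) (use p in auto)
      define q where "q = (2::complex) powr (- w - of_real d)"
      have s2: "(\<lambda>v. symbol_fun a p w (2 *\<^sub>R v)) summable_on (lattice - {0})" 
        using lattice_split(2)[OF s zero_cube01] by simp
      have e2: "infsum (\<lambda>v. symbol_fun a p w (2 *\<^sub>R v)) (lattice - {0}) = q * symbol_sum a p w"
      proof -
        have "infsum (\<lambda>v. symbol_fun a p w (2 *\<^sub>R v)) (lattice - {0}) = infsum (\<lambda>v. q * symbol_fun a p w v) (lattice - {0})"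
          by (rule infsum_cong) (auto simp: symbol_fun_hom[OF less.prems p(1)] q_def)
        thus ?thesis by (simp add: infsum_cmult_right' symbol_sum_def)
      qed
      have "infsum (\<lambda>v. symbol_fun a p w (2 *\<^sub>R v + u)) (lattice - {0}) = ?T u p w + q * symbol_sum a p w"
        if "u \<in> cube01 - {0}" for u
      proof -
        have "(\<lambda>v. symbol_fun a p w (2 *\<^sub>R v + u) - symbol_fun a p w (2 *\<^sub>R v)) summable_on (lattice - {0})"
          using summable_on_add[OF lattice_split(2)[OF s, of u] summable_on_uminus[THEN iffD2, OF s2]] that by simp
        from infsum_add[OF this s2] show ?thesis by (simp add: e2)
      qed
      hence e3: "(\<Sum>u\<in>cube01 - {0}. symbol_fun a p w u + infsum (\<lambda>v. symbol_fun a p w (2 *\<^sub>R v + u)) (lattice - {0})) =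
         (\<Sum>u\<in>cube01 - {0}. (symbol_fun a p w u + ?T u p w) + q * symbol_sum a p w)"
        by (intro sum.cong) (simp_all add: add.assoc)
      have "symbol_sum a p w = infsum (\<lambda>v. symbol_fun a p w (2 *\<^sub>R v)) (lattice - {0}) +
          (\<Sum>u\<in>cube01 - {0}. symbol_fun a p w u + infsum (\<lambda>v. symbol_fun a p w (2 *\<^sub>R v + u)) (lattice - {0}))"
        unfolding symbol_sum_def by (rule lattice_split(1)[OF s])
      hence "symbol_sum a p w = q * symbol_sum a p w + (\<Sum>u\<in>cube01 - {0}. (symbol_fun a p w u + ?T u p w) + q * symbol_sum a p w)"
        unfolding e2 e3 .
      also have "\<dots> = q * symbol_sum a p w + (\<Sum>u\<in>cube01 - {0}. (symbol_fun a p w u + ?T u p w)) + 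
           of_nat (card (cube01 - {0 :: real^'n})) * (q * symbol_sum a p w)"
        by (simp add: sum.distrib)
      also have "card (cube01 - {0 :: real^'n}) = 2 ^ CARD('n) - 1"
        using card_cube01[where 'n = 'n] finite_cube01 zero_cube01 by (subst card_Diff_singleton) auto
      also have "of_nat (2 ^ CARD('n) - 1) = (2 ^ CARD('n) - 1 :: complex)" by (simp add: of_nat_diff)
      finally show ?thesis unfolding h_def q_def[symmetric] by (rule cube_sum_rearrange)
    qed
    have "mero_family P (?n - d) (?n - d - real N) (\<lambda>p w. h w * symbol_sum a p w)"
      using cf by (rule mero_family_cong[THEN iffD2, rotated]) (rule eq)
    thus ?thesis by (rule mero_family_divide_entire[OF _ hh h0])
  qed
qed

corollary norm_powr_sum_continuation:
  "mero_family P (real CARD('n)) b (\<lambda>p w. \<Sum>\<^sub>\<infinity>v\<in>lattice - {0}. of_real (norm (L p v)) powr (- w))"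
proof -
  obtain N :: nat where N: "real CARD('n) - b \<le> real N" using real_arch_simple by blast
  have "symbol_sum (\<lambda>p w x. 1) = (\<lambda>p w. \<Sum>\<^sub>\<infinity>v\<in>lattice - {0}. of_real (norm (L p v)) powr (- w))"
    by (simp add: symbol_sum_def[abs_def] symbol_fun_def[abs_def])
  thus ?thesis using mero_family_mono[OF symbol_sum_continuation[OF one_symbol, of N], of "real CARD('n)" b] N by simp
qed

corollary 
  assumes "A \<subseteq> lattice - {0}"
  shows norm_powr_sum_joint_hol: "joint_hol P {w. Re w > real CARD('n)} (\<lambda>p w. \<Sum>\<^sub>\<infinity>v\<in>A. of_real (norm (L p v)) powr (- w))"
    and norm_powr_summable: "p \<in> P \<Longrightarrow> Re w > real CARD('n) \<Longrightarrow> (\<lambda>v. complex_of_real (norm (L p v)) powr (- w)) summable_on A"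
  using joint_hol_subsum[OF one_symbol assms] summable_subsum[OF one_symbol assms] by (simp_all add: symbol_fun_def[abs_def])

end

section \<open>Gluing meromorphic functions and integrating over a parameter\<close>

lemma meromorphic_identity:
  assumes "f meromorphic_on A" "g meromorphic_on A" "open A" "connected A" "z \<in> A" "frequently (\<lambda>w. f w = g w) (at z)"
  shows "\<forall>\<^sub>\<approx>w\<in>A. f w = g w"
proof -
  have m: "(\<lambda>w. f w - g w) meromorphic_on A" using assms by (intro meromorphic_intros)
  from meromorphic_imp_constant_or_avoid[OF m assms(3,4), of 0]
  show ?thesis
  proof
    assume "\<forall>\<^sub>\<approx>w\<in>A. f w - g w = 0"
    thus ?thesis by eventually_elim simp
  next
    assume "\<forall>\<^sub>\<approx>w\<in>A. f w - g w \<noteq> 0"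
    hence "eventually (\<lambda>w. f w - g w \<noteq> 0) (at z)"
      using assms by (auto simp: eventually_cosparse_open_eq)
    thus ?thesis using assms(6) by (simp add: frequently_def)
  qed
qed

text \<open>A nicely meromorphic function takes the value \<open>0\<close> at a pole and its limit elsewhere, so its value at a point is
determined by the punctured neighbourhood.\<close>
lemma nicely_meromorphic_eq_at:
  assumes "f nicely_meromorphic_on {z}" "g nicely_meromorphic_on {z}" "eventually (\<lambda>w. f w = g w) (at z)"
  shows "f z = g z"
proof -
  have p: "is_pole f z \<longleftrightarrow> is_pole g z" by (rule is_pole_cong) (use assms in auto)
  have t: "(f \<longlongrightarrow> l) (at z) \<longleftrightarrow> (g \<longlongrightarrow> l) (at z)" for l by (rule tendsto_cong) (use assms in auto)
  have f: "(is_pole f z \<and> f z = 0) \<or> f \<midarrow>z\<rightarrow> f z" and g: "(is_pole g z \<and> g z = 0) \<or> g \<midarrow>z\<rightarrow> g z"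
    using assms by (auto simp: nicely_meromorphic_on_def)
  have np: "\<not> (is_pole h z \<and> h \<midarrow>z\<rightarrow> h z)" for h :: "complex \<Rightarrow> complex"
    using not_tendsto_and_filterlim_at_infinity[of "at z" h "h z"] by (auto simp: is_pole_def)
  show ?thesis using f g p t np LIM_unique[of g "f z" z "g z"] by metis
qed

lemma nicely_meromorphic_identity:
  assumes f: "f nicely_meromorphic_on A" and g: "g nicely_meromorphic_on A" and A: "open A" "connected A"
    and "z \<in> A" "frequently (\<lambda>w. f w = g w) (at z)" "w \<in> A"
  shows "f w = g w"
proof (rule nicely_meromorphic_eq_at[where z = w and f = f and g = g])
  show "f nicely_meromorphic_on {w}" "g nicely_meromorphic_on {w}"
    using f g assms by (auto intro: nicely_meromorphic_on_subset)
  have "\<forall>\<^sub>\<approx>w\<in>A. f w = g w"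
    by (rule meromorphic_identity[of _ _ _ z]) (use assms in \<open>auto simp: nicely_meromorphic_on_def\<close>)
  thus "eventually (\<lambda>w. f w = g w) (at w)" using A assms by (auto simp: eventually_cosparse_open_eq)
qed

lemma frequently_halfspace:
  assumes "\<And>s. Re s > \<sigma> \<Longrightarrow> f s = g s" "Re z > \<sigma>"
  shows "frequently (\<lambda>w. f w = g w) (at z)"
proof -
  have "eventually (\<lambda>w. w \<in> {w. Re w > \<sigma>}) (at z)"
    by (rule eventually_at_in_open') (use assms in \<open>auto simp: open_halfspace_Re_gt\<close>)
  hence "eventually (\<lambda>w. f w = g w) (at z)" by eventually_elim (use assms in auto)
  thus ?thesis by (rule eventually_frequently[rotated]) simp
qed

lemma connected_halfspace_Re: "connected {w. Re w > \<sigma>}"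
  by (rule convex_connected) (rule convex_halfspace_Re_gt)

lemma mero_cont_eqI:
  assumes "F nicely_meromorphic_on UNIV" "\<And>s. Re s > \<sigma> \<Longrightarrow> F s = f s"
  shows "mero_cont \<sigma> f = F"
  unfolding mero_cont_def
proof (rule the_equality)
  fix G assume G: "G nicely_meromorphic_on UNIV \<and> (\<forall>s. \<sigma> < Re s \<longrightarrow> G s = f s)"
  show "G = F"
  proof
    fix s
    have *: "Re (of_real (\<sigma> + 1)) > \<sigma>" by simp
    have fr: "frequently (\<lambda>w. G w = F w) (at (of_real (\<sigma> + 1)))"
      by (rule frequently_halfspace[OF _ *]) (use G assms in auto)
    show "G s = F s"
      by (rule nicely_meromorphic_identity[OF conjunct1[OF G] assms(1) open_UNIV connected_UNIV UNIV_I fr UNIV_I])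
  qed
qed (use assms in auto)

lemma entire_quotient_meromorphic:
  assumes D: "D holomorphic_on H" "W holomorphic_on H" "open H"
  shows "(\<lambda>s. W s / D s) meromorphic_on H"
  using assms by (intro meromorphic_intros analytic_on_imp_meromorphic_on) (auto simp: analytic_on_open)

lemma holomorphic_nonzero_cosparse:
  assumes "D holomorphic_on H" "open H" "connected H" "a \<in> H" "D a \<noteq> (0::complex)"
  shows "\<forall>\<^sub>\<approx>s\<in>H. D s \<noteq> 0"
proof -
  have "D nicely_meromorphic_on H" using assms by (intro analytic_on_imp_nicely_meromorphic_on) (auto simp: analytic_on_open)
  from nicely_meromorphic_imp_constant_or_avoid[OF this assms(2,3), of 0] show ?thesis using assms by auto
qed

text \<open>Continuability to every half plane as a quotient of holomorphic functions. The quotient may depend on the half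
plane; for different ones they agree by the identity theorem.\<close>
definition left_continuable :: "real \<Rightarrow> (complex \<Rightarrow> complex) \<Rightarrow> bool" where
  "left_continuable \<sigma> f \<longleftrightarrow> (\<forall>b\<le>\<sigma>. \<exists>D W. D holomorphic_on {s. Re s > b} \<and> W holomorphic_on {s. Re s > b} \<and> (\<exists>s. Re s > b \<and> D s \<noteq> 0)
         \<and> (\<forall>s. Re s > \<sigma> \<longrightarrow> D s * f s = W s))"

text \<open>On each half plane the quotient, with removable singularities removed, is nicely meromorphic. Two such
quotients agree where both are defined, since they agree with \<open>f\<close> on the right; so they glue.\<close>
theorem meromorphic_glue:
  assumes f: "f holomorphic_on {s. Re s > \<sigma>}" and c: "left_continuable \<sigma> f"
  obtains F where "F nicely_meromorphic_on UNIV" "\<And>s. Re s > \<sigma> \<Longrightarrow> F s = f s"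
proof -
  define H where "H = (\<lambda>N::nat. {s. Re s > \<sigma> - real N})"
  have oH: "open (H N)" "connected (H N)" for N 
    unfolding H_def by (auto simp: open_halfspace_Re_gt connected_halfspace_Re)
  have "\<forall>N. \<exists>D W. D holomorphic_on H N \<and> W holomorphic_on H N \<and> (\<exists>s\<in>H N. D s \<noteq> 0)
         \<and> (\<forall>s. Re s > \<sigma> \<longrightarrow> D s * f s = W s)"
  proof
    fix N
    show "\<exists>D W. D holomorphic_on H N \<and> W holomorphic_on H N \<and> (\<exists>s\<in>H N. D s \<noteq> 0)
         \<and> (\<forall>s. Re s > \<sigma> \<longrightarrow> D s * f s = W s)"
      using c[unfolded left_continuable_def, rule_format, of "\<sigma> - real N"] by (auto simp: H_def)
  qed
  then obtain D W where DW: "\<And>N. D N holomorphic_on H N" "\<And>N. W N holomorphic_on H N" "\<And>N. \<exists>s\<in>H N. D N s \<noteq> 0"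
     "\<And>N s. Re s > \<sigma> \<Longrightarrow> D N s * f s = W N s" by metis
  define G where "G = (\<lambda>N. remove_sings (\<lambda>s. W N s / D N s))"
  have G: "G N nicely_meromorphic_on H N" for N
    unfolding G_def by (intro remove_sings_nicely_meromorphic entire_quotient_meromorphic DW oH)
  have Gf: "G N s = f s" if s: "Re s > \<sigma>" for N s
  proof (rule nicely_meromorphic_eq_at[where z = s and f = "G N" and g = f])
    have sH: "s \<in> H N" using s by (simp add: H_def)
    show "G N nicely_meromorphic_on {s}" using G sH by (blast intro: nicely_meromorphic_on_subset)
    have "f analytic_on {s. Re s > \<sigma>}" using f by (simp add: analytic_on_open open_halfspace_Re_gt)
    thus "f nicely_meromorphic_on {s}" using s by (intro analytic_on_imp_nicely_meromorphic_on) (auto intro: analytic_on_subset)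
    have "\<forall>\<^sub>\<approx>s\<in>H N. D N s \<noteq> 0" using holomorphic_nonzero_cosparse[OF DW(1) oH] DW(3) by blast
    moreover have "\<forall>\<^sub>\<approx>s\<in>H N. G N s = W N s / D N s" unfolding G_def
      by (intro eventually_remove_sings_eq entire_quotient_meromorphic DW oH)
    ultimately have "\<forall>\<^sub>F w in at s. D N w \<noteq> 0" "\<forall>\<^sub>F w in at s. G N w = W N w / D N w"
      using sH oH by (auto simp: eventually_cosparse_open_eq)
    moreover have "eventually (\<lambda>w. w \<in> {w. Re w > \<sigma>}) (at s)"
      by (rule eventually_at_in_open') (use s in \<open>auto simp: open_halfspace_Re_gt\<close>)
    ultimately show "\<forall>\<^sub>F w in at s. G N w = f w"
      by eventually_elim (simp flip: DW(4))
  qed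
  have GG: "G N s = G M s" if "N \<le> M" "s \<in> H N" for N M s
  proof -
    have sub: "H N \<subseteq> H M" using that by (auto simp: H_def)
    have *: "Re (of_real (\<sigma> + 1)) > \<sigma>" by simp
    show ?thesis
    proof (rule nicely_meromorphic_identity[OF G[of N] nicely_meromorphic_on_subset[OF G sub] oH(1) oH(2) _ frequently_halfspace[OF _ *] that(2)])
      show "complex_of_real (\<sigma> + 1) \<in> H N" by (simp add: H_def)
    qed (use Gf in auto)
  qed
  have cover: "\<exists>N. s \<in> H N" for s
  proof -
    obtain N :: nat where "\<sigma> - Re s < real N" using reals_Archimedean2 by blast
    thus ?thesis by (intro exI[of _ N]) (auto simp: H_def)
  qed
  define F where "F = (\<lambda>s. G (LEAST N. s \<in> H N) s)"
  have F: "F s = G N s" if "s \<in> H N" for N s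
    unfolding F_def by (rule GG[OF Least_le[of "\<lambda>N. s \<in> H N", OF that] LeastI[of "\<lambda>N. s \<in> H N", OF that]])
  have Fat: "eventually (\<lambda>w. F w = G N w) (at z)" if "z \<in> H N" for z N
  proof -
    have "eventually (\<lambda>w. w \<in> H N) (at z)" by (rule eventually_at_in_open') (use that oH in auto)
    thus ?thesis by eventually_elim (rule F)
  qed
  have "F nicely_meromorphic_on UNIV" unfolding nicely_meromorphic_on_def
  proof (intro conjI ballI)
    show "F meromorphic_on UNIV"
    proof (subst meromorphic_on_meromorphic_at, safe)
      fix z obtain N where N: "z \<in> H N" using cover by blast
      have "G N meromorphic_on {z}" using G N by (meson nicely_meromorphic_on_def empty_subsetI insert_subset meromorphic_on_subset)
      thus "F meromorphic_on {z}" using Fat[OF N] by (subst meromorphic_on_cong[where g = "G N" and B = "{z}"]) auto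
    qed
    fix z :: complex
    obtain N where N: "z \<in> H N" using cover by blast
    have "(is_pole (G N) z \<and> G N z = 0) \<or> G N \<midarrow>z\<rightarrow> G N z" using G N by (auto simp: nicely_meromorphic_on_def)
    thus "(is_pole F z \<and> F z = 0) \<or> F \<midarrow>z\<rightarrow> F z"
      using is_pole_cong[OF Fat[OF N] refl] tendsto_cong[OF Fat[OF N]] F[OF N] by simp
  qed
  moreover have "F s = f s" if "Re s > \<sigma>" for s using F[of s 0] Gf[OF that] that by (simp add: H_def)
  ultimately show thesis using that by blast
qed

lemma
  assumes "f holomorphic_on {s. Re s > \<sigma>}" "left_continuable \<sigma> f"
  shows mero_cont_nicely: "mero_cont \<sigma> f nicely_meromorphic_on UNIV"
    and mero_cont_eq: "Re s > \<sigma> \<Longrightarrow> mero_cont \<sigma> f s = f s"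
proof -
  obtain F where F: "F nicely_meromorphic_on UNIV" "\<And>s. Re s > \<sigma> \<Longrightarrow> F s = f s" using meromorphic_glue[OF assms] by blast
  have e: "mero_cont \<sigma> f = F" by (rule mero_cont_eqI[OF F])
  show "mero_cont \<sigma> f nicely_meromorphic_on UNIV" "Re s > \<sigma> \<Longrightarrow> mero_cont \<sigma> f s = f s" unfolding e using F by auto
qed

text \<open>The identity \<open>D F = W\<close> propagates to the left, and at a point where \<open>D\<close> does not vanish the quotient is
analytic, which excludes a pole of \<open>F\<close> there. This recovers actual values, not just values up to a discrete
set; pointwise values are what the integral over the unit cube sees.\<close>
lemma nicely_meromorphic_quotient:
  assumes F: "F nicely_meromorphic_on UNIV" and D: "D holomorphic_on {s. Re s > b}" "W holomorphic_on {s. Re s > b}" 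
    and eq: "\<And>s. Re s > \<sigma> \<Longrightarrow> D s * F s = W s" and b: "b \<le> \<sigma>" and s: "Re s > b" "D s \<noteq> 0"
  shows "F s = W s / D s"
proof (rule nicely_meromorphic_eq_at[where z = s and f = F and g = "\<lambda>s. W s / D s"])
  let ?H = "{s. Re s > b}"
  have oH: "open ?H" "connected ?H" by (auto simp: open_halfspace_Re_gt connected_halfspace_Re)
  show "F nicely_meromorphic_on {s}" using F by (blast intro: nicely_meromorphic_on_subset)
  have an: "f analytic_on {s}" if "f holomorphic_on ?H" for f
  proof -
    have "f analytic_on ?H" using that oH(1) by (simp add: analytic_on_open)
    thus ?thesis by (rule analytic_on_subset) (use s in auto)
  qed
  have "(\<lambda>s. W s / D s) analytic_on {s}" using s an[OF D(1)] an[OF D(2)] by (intro analytic_intros) auto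
  thus "(\<lambda>s. W s / D s) nicely_meromorphic_on {s}" by (rule analytic_on_imp_nicely_meromorphic_on)
  have "F meromorphic_on ?H" using F by (auto simp: nicely_meromorphic_on_def intro: meromorphic_on_subset)
  moreover have "D meromorphic_on ?H" "W meromorphic_on ?H" using D oH by (auto intro!: analytic_on_imp_meromorphic_on simp: analytic_on_open)
  ultimately have m: "(\<lambda>s. D s * F s) meromorphic_on ?H" "W meromorphic_on ?H" by (auto intro: meromorphic_intros)
  have *: "Re (of_real (\<sigma> + 1)) > \<sigma>" by simp
  have "\<forall>\<^sub>\<approx>s\<in>?H. D s * F s = W s"
    by (rule meromorphic_identity[OF m oH _ frequently_halfspace[OF _ *]]) (use b eq in auto)
  moreover have "\<forall>\<^sub>\<approx>s\<in>?H. D s \<noteq> 0" using holomorphic_nonzero_cosparse[OF D(1) oH, of s] s by simp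
  ultimately have "\<forall>\<^sub>\<approx>s\<in>?H. F s = W s / D s" by eventually_elim (auto simp: field_simps)
  thus "\<forall>\<^sub>F w in at s. F w = W w / D w" using s oH by (auto simp: eventually_cosparse_open_eq)
qed

text \<open>Morera's theorem: the integral over the boundary of a triangle can be interchanged with the integral over the
parameter, and vanishes for each parameter by Cauchy's theorem.\<close>
lemma holomorphic_on_integral_param:
  fixes F :: "'p::euclidean_space \<Rightarrow> complex \<Rightarrow> complex"
  assumes U: "open U" and c: "continuous_on (cbox a b \<times> U) (\<lambda>(p,w). F p w)" and h: "\<And>p. p \<in> cbox a b \<Longrightarrow> F p holomorphic_on U"
  shows "(\<lambda>w. integral (cbox a b) (\<lambda>p. F p w)) holomorphic_on U"
proof -
  let ?I = "\<lambda>w. integral (cbox a b) (\<lambda>p. F p w)"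
  have c': "continuous_on (U \<times> cbox a b) (\<lambda>(w,p). F p w)"
    unfolding case_prod_unfold
    by (rule continuous_on_compose2[OF c[unfolded case_prod_unfold], of _ "\<lambda>x. (snd x, fst x)", simplified]) (auto intro!: continuous_intros)
  have cI: "continuous_on U ?I" by (rule integral_continuous_on_param[OF c'])
  have line: "contour_integral (linepath x y) ?I = integral (cbox a b) (\<lambda>p. contour_integral (linepath x y) (F p))"
    if "closed_segment x y \<subseteq> U" for x y
  proof -
    have inU: "linepath x y t \<in> U" if "t \<in> cbox 0 1" for t 
      using that \<open>closed_segment x y \<subseteq> U\<close> by (metis cbox_interval image_subset_iff path_image_def path_image_linepath)
    have c2: "continuous_on (cbox (0, a) (1, b)) (\<lambda>(t, p). F p (linepath x y t) * (y - x))"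
      unfolding case_prod_unfold
      by (intro continuous_intros continuous_on_compose2[OF c[unfolded case_prod_unfold], of _ "\<lambda>q. (snd q, linepath x y (fst q))", simplified])
         (use inU in \<open>auto simp: cbox_Pair_eq linepath_def intro!: continuous_intros\<close>)
    have "contour_integral (linepath x y) ?I = integral (cbox 0 1) (\<lambda>t. ?I (linepath x y t) * (y - x))"
      by (simp add: contour_integral_integral)
    also have "\<dots> = integral (cbox 0 1) (\<lambda>t. integral (cbox a b) (\<lambda>p. F p (linepath x y t) * (y - x)))"
      by simp
    also have "\<dots> = integral (cbox a b) (\<lambda>p. integral (cbox 0 1) (\<lambda>t. F p (linepath x y t) * (y - x)))"
      by (rule integral_swap_continuous[OF c2])
    also have "\<dots> = integral (cbox a b) (\<lambda>p. contour_integral (linepath x y) (F p))"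
      by (simp add: contour_integral_integral)
    finally show ?thesis .
  qed
  have "?I analytic_on U"
  proof (rule Morera_triangle[OF cI U], rule impI)
    fix x y z assume xyz: "convex hull {x, y, z} \<subseteq> U"
    have seg: "closed_segment x y \<subseteq> U" "closed_segment y z \<subseteq> U" "closed_segment z x \<subseteq> U"
      using xyz unfolding segment_convex_hull by (auto intro!: subset_trans[OF hull_mono xyz])
    have ct: "continuous_on (cbox a b) (\<lambda>p. contour_integral (linepath x y) (F p))" if "closed_segment x y \<subseteq> U" for x y
    proof -
      have inU: "linepath x y t \<in> U" if "t \<in> cbox 0 1" for t 
        using that \<open>closed_segment x y \<subseteq> U\<close> by (metis cbox_interval image_subset_iff path_image_def path_image_linepath)
      have "continuous_on (cbox a b \<times> cbox 0 1) (\<lambda>(p, t). F p (linepath x y t) * (y - x))"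
        unfolding case_prod_unfold
        by (intro continuous_intros continuous_on_compose2[OF c[unfolded case_prod_unfold], of _ "\<lambda>q. (fst q, linepath x y (snd q))", simplified])
           (use inU in \<open>auto simp: linepath_def intro!: continuous_intros\<close>)
      from integral_continuous_on_param[OF this] show ?thesis by (simp add: contour_integral_integral)
    qed
    have i: "(\<lambda>p. contour_integral (linepath x y) (F p)) integrable_on cbox a b" if "closed_segment x y \<subseteq> U" for x y
      by (rule integrable_continuous[OF ct[OF that]])
    have "contour_integral (linepath x y) ?I + contour_integral (linepath y z) ?I + contour_integral (linepath z x) ?I =
       integral (cbox a b) (\<lambda>p. contour_integral (linepath x y) (F p) + contour_integral (linepath y z) (F p) + contour_integral (linepath z x) (F p))"
      using i seg by (simp add: line integral_add integrable_add)
    also have "\<dots> = integral (cbox a b) (\<lambda>p. 0)"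
    proof (rule integral_cong)
      fix p assume p: "p \<in> cbox a b"
      have "F p holomorphic_on convex hull {x, y, z}" using h[OF p] xyz by (rule holomorphic_on_subset)
      from Cauchy_theorem_triangle[OF this]
      have "((F p) has_contour_integral 0) (linepath x y +++ linepath y z +++ linepath z x)" .
      moreover have "F p contour_integrable_on linepath x y" if "closed_segment x y \<subseteq> U" for x y
        using that h[OF p] by (intro contour_integrable_continuous_linepath holomorphic_on_imp_continuous_on) (auto intro: holomorphic_on_subset)
      ultimately show "contour_integral (linepath x y) (F p) + contour_integral (linepath y z) (F p) + contour_integral (linepath z x) (F p) = 0"
        using seg by (metis (no_types, lifting) Cauchy_theorem_triangle contour_integral_unique contour_integral_join add.assoc valid_path_linepath has_chain_integral_chain_integral3 has_contour_integral_integral)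
    qed
    finally show "contour_integral (linepath x y) ?I + contour_integral (linepath y z) ?I + contour_integral (linepath z x) ?I = 0" by simp
  qed
  thus ?thesis by (rule analytic_imp_holomorphic)
qed

section \<open>The symplectic group and Iwasawa coordinates\<close>

lemma vector_4 [simp]:
  "(vector [x,y,z,w] :: 'a^4)$1 = (x::'a::zero)"
  "(vector [x,y,z,w] :: 'a^4)$2 = y"
  "(vector [x,y,z,w] :: 'a^4)$3 = z"
  "(vector [x,y,z,w] :: 'a^4)$4 = w"
  unfolding vector_def by auto

lemma vec4_eq_iff: "(x::'a^4) = y \<longleftrightarrow> x$1 = y$1 \<and> x$2 = y$2 \<and> x$3 = y$3 \<and> x$4 = y$4"
  by (simp add: vec_eq_iff forall_4)

lemma inner_4: "(x::real^4) \<bullet> y = x$1 * y$1 + x$2 * y$2 + x$3 * y$3 + x$4 * y$4"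
  by (simp add: inner_vec_def sum_4)

lemma J_rows: "J$1 = vector [0,0,1,0]" "J$2 = vector [0,0,0,1]" "J$3 = vector [-1,0,0,0]" "J$4 = vector [0,-1,0,0]"
  by (simp_all add: J_def blocks_def mat_def)

text \<open>The row vector \<open>v v* J\<close>: a complex structure on \<open>\<real>\<^sup>4\<close> for which the symplectic form is \<open>jmul x \<bullet> y\<close>.\<close>
definition jmul :: "real^4 \<Rightarrow> real^4" where
  "jmul v = vector [- v$3, - v$4, v$1, v$2]"

lemma jmul_simps [simp]: "jmul v $ 1 = - v$3" "jmul v $ 2 = - v$4" "jmul v $ 3 = v$1" "jmul v $ 4 = v$2"
  by (simp_all add: jmul_def)

definition symp :: "real^4 \<Rightarrow> real^4 \<Rightarrow> real" where
  "symp x y = jmul x \<bullet> y"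

lemma symp_4: "symp x y = x$1 * y$3 + x$2 * y$4 - x$3 * y$1 - x$4 * y$2"
  by (simp add: symp_def inner_4)

lemma matrix_mult_nth4: "((A::real^4^4) ** B) $ i $ j = A$i$1 * B$1$j + A$i$2 * B$2$j + A$i$3 * B$3$j + A$i$4 * B$4$j"
  by (simp add: matrix_matrix_mult_def sum_4)

lemma JJ: "J ** J = - mat 1"
  by (simp add: vec4_eq_iff matrix_mult_nth4 J_rows mat_def)

lemma hJh_nth: "((h::real^4^4) ** J ** transpose h) $ i $ k = symp (h$i) (h$k)"
  unfolding matrix_mult_nth4 by (simp add: J_rows symp_4 transpose_def)

lemma minus_matrix_mult: "- (A::real^'n^'m) ** B = - (A ** B)" "A ** - B = - (A ** (B::real^'k^'n))"
  by (simp_all add: matrix_matrix_mult_def vec_eq_iff sum_negf)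

text \<open>Because \<open>J ** J = - mat 1\<close>, the relation \<open>h\<^sup>T J h = J\<close> says that \<open>- J h\<^sup>T J\<close> is a left inverse of \<open>h\<close>; a left
inverse of a square matrix is a right inverse, which is the relation for rows.\<close>
lemma symplectic_transpose:
  fixes h :: "real^4^4"
  assumes "transpose h ** J ** h = J"
  shows "h ** J ** transpose h = J" "invertible h" "h ** (- (J ** transpose h ** J)) = mat 1" "(- (J ** transpose h ** J)) ** h = mat 1"
proof -
  have "(- (J ** transpose h ** J)) ** h = - (J ** (transpose h ** J ** h))"
    by (simp add: minus_matrix_mult matrix_mul_assoc)
  also have "\<dots> = mat 1" using assms JJ by simp
  finally show l: "(- (J ** transpose h ** J)) ** h = mat 1" .
  show r: "h ** (- (J ** transpose h ** J)) = mat 1" using l matrix_left_right_inverse by blast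
  show "invertible h" using l r unfolding invertible_def by blast
  have "h ** J ** transpose h = - (h ** J ** transpose h ** (J ** J))" by (simp add: JJ minus_matrix_mult)
  also have "\<dots> = (h ** (- (J ** transpose h ** J))) ** J" by (simp add: minus_matrix_mult matrix_mul_assoc)
  finally show "h ** J ** transpose h = J" by (simp add: r)
qed

lemma Sp4R_iff: "h \<in> Sp4R \<longleftrightarrow> transpose h ** J ** h = J"
  using symplectic_transpose(2) by (auto simp: Sp4R_def)

text \<open>The rows of a symplectic matrix form a symplectic basis.\<close>
lemma Sp4R_symp:
  assumes "h \<in> Sp4R"
  shows "symp (h$i) (h$k) = J$i$k"
  using symplectic_transpose(1)[of h] assms by (metis Sp4R_iff hJh_nth)

lemma Sp4R_mult: "g \<in> Sp4R \<Longrightarrow> h \<in> Sp4R \<Longrightarrow> g ** h \<in> Sp4R"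
proof -
  assume "g \<in> Sp4R" "h \<in> Sp4R"
  moreover have "transpose (g ** h) ** J ** (g ** h) = transpose h ** (transpose g ** J ** g) ** h"
    by (simp only: matrix_transpose_mul matrix_mul_assoc)
  ultimately show ?thesis by (simp add: Sp4R_iff)
qed

text \<open>The rows of a unitary matrix are orthonormal; the real part of this relation is orthogonality of the rows of \<open>k\<close>.\<close>
lemma K_rows:
  assumes "k \<in> K"
  shows "k ** transpose k = mat 1" 
proof -
  obtain A B where k: "k = blocks A B (- B) A" and U: "(\<chi> i j. Complex (A$i$j) (B$i$j)) \<in> U2" using assms by (auto simp: K_def)
  define M :: "complex^2^2" where "M = (\<chi> i j. Complex (A$i$j) (B$i$j))"
  have "(\<chi> i j. cnj (M$j$i)) ** M = mat 1" using U by (simp add: U2_def M_def)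
  hence "M ** (\<chi> i j. cnj (M$j$i)) = mat 1" using matrix_left_right_inverse by blast
  hence "(M ** (\<chi> i j. cnj (M$j$i)))$a$b = (if a = b then 1 else 0)" for a b by (simp add: mat_def)
  hence e: "(\<Sum>j\<in>UNIV. M$a$j * cnj (M$b$j)) = (if a = b then 1 else 0)" for a b by (simp add: matrix_matrix_mult_def)
  have "A$a$1 * A$b$1 + B$a$1 * B$b$1 + A$a$2 * A$b$2 + B$a$2 * B$b$2 = (if a = b then 1 else 0) \<and>
        B$a$1 * A$b$1 - A$a$1 * B$b$1 + B$a$2 * A$b$2 - A$a$2 * B$b$2 = 0" for a b
    using e[of a b] by (auto simp: sum_2 M_def complex_eq_iff split: if_splits)
  from this[of 1 1] this[of 1 2] this[of 2 2] this[of 2 1]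
  show ?thesis unfolding k 
    by (simp add: vec4_eq_iff matrix_mult_nth4 transpose_def blocks_def mat_def algebra_simps)
qed

text \<open>An orthonormal pair spanning a Lagrangian plane is a unitary basis of \<open>\<complex>\<^sup>2\<close>, hence the lower half of an
element of \<open>K\<close>; the upper half is forced by the shape of \<open>K\<close>.\<close>
lemma K_I:
  assumes uu: "u \<bullet> u = 1" "t \<bullet> t = 1" "u \<bullet> t = 0" "symp u t = 0"
  shows "(vector [- jmul u, - jmul t, u, t] :: real^4^4) \<in> K"
proof -
  define A :: "real^2^2" where "A = vector [vector [u$3, u$4], vector [t$3, t$4]]"
  define B :: "real^2^2" where "B = vector [vector [-u$1, -u$2], vector [-t$1, -t$2]]"
  define M :: "complex^2^2" where "M = (\<chi> i j. Complex (A$i$j) (B$i$j))"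
  have "M ** (\<chi> i j. cnj (M$j$i)) = mat 1"
    using assms by (simp add: vec_eq_iff forall_2 matrix_matrix_mult_def sum_2 M_def A_def B_def complex_eq_iff mat_def inner_4 symp_4 algebra_simps)
  hence "(\<chi> i j. cnj (M$j$i)) ** M = mat 1" using matrix_left_right_inverse by blast
  hence "M \<in> U2" by (simp add: U2_def)
  moreover have "(vector [- jmul u, - jmul t, u, t] :: real^4^4) = blocks A B (- B) A"
    by (simp add: vec4_eq_iff blocks_def A_def B_def)
  ultimately show ?thesis unfolding K_def M_def by blast
qed

lemma rep_nth:
  "iwasawa_rep n1 n2 n3 n4 n5 y1 y2 $ 1 = vector [y1, n1 * y2, n2 / y1, n3 / y2]"
  "iwasawa_rep n1 n2 n3 n4 n5 y1 y2 $ 2 = vector [0, y2, n4 / y1, n5 / y2]"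
  "iwasawa_rep n1 n2 n3 n4 n5 y1 y2 $ 3 = vector [0, 0, 1 / y1, 0]"
  "iwasawa_rep n1 n2 n3 n4 n5 y1 y2 $ 4 = vector [0, 0, - n1 / y1, 1 / y2]"
  unfolding iwasawa_rep_def vec4_eq_iff matrix_mult_nth4 by (simp_all add: divide_inverse)

lemma orthogonal_rows_inner:
  fixes k :: "real^4^4"
  assumes "k ** transpose k = mat 1"
  shows "(x v* k) \<bullet> (y v* k) = x \<bullet> y"
proof -
  have "(x v* k) \<bullet> (y v* k) = x \<bullet> (k *v (y v* k))"
    by (metis dot_lmul_matrix)
  also have "k *v (y v* k) = (k ** transpose k) *v y"
    by (simp add: matrix_vector_mul_assoc[symmetric])
  finally show ?thesis by (simp add: assms)
qed

text \<open>Gram-Schmidt on the last two rows of \<open>h\<close>, which span a Lagrangian plane, yields the lower half of \<open>k\<close>. In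
\<open>p = h k\<^sup>T\<close> the entries of the first two columns are values of the symplectic form on rows of \<open>h\<close>, so they are
given by \<open>J\<close>. The remaining relation between the \<open>n\<^sub>i\<close> is that the first two rows of \<open>h\<close> are orthogonal for
the symplectic form.\<close>
theorem iwasawa_exists:
  assumes h: "h \<in> Sp4R"
  shows "\<exists>n1 n2 n3 n4 n5 y1 y2. is_iwasawa h n1 n2 n3 n4 n5 y1 y2"
proof -
  define r where "r = h$3"
  define s where "s = h$4"
  have sp: "symp (h$i) r = J$i$3" "symp (h$i) s = J$i$4" for i
    unfolding r_def s_def by (rule Sp4R_symp[OF h])+
  have r0: "r \<noteq> 0" using sp(1)[of 1] by (auto simp: symp_4 J_rows)
  define y1 where "y1 = 1 / norm r"
  have y1: "y1 > 0" "y1 * y1 * (r \<bullet> r) = 1" using r0 by (auto simp: y1_def dot_square_norm power2_eq_square)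
  define n1 where "n1 = - (r \<bullet> s) * y1 * y1"
  define t where "t = s + n1 *\<^sub>R r"
  have t0: "t \<noteq> 0"
  proof
    assume "t = 0"
    have "symp (h$2) t = symp (h$2) s + n1 * symp (h$2) r" by (simp add: t_def symp_4 algebra_simps)
    thus False using sp[of 2] \<open>t = 0\<close> by (simp add: J_rows symp_4)
  qed
  define y2 where "y2 = 1 / norm t"
  have y2: "y2 > 0" "y2 * y2 * (t \<bullet> t) = 1" using t0 by (auto simp: y2_def dot_square_norm power2_eq_square)
  define u where "u = y1 *\<^sub>R r"
  define q where "q = y2 *\<^sub>R t"
  have rt: "r \<bullet> t = 0"
  proof -
    have "r \<bullet> t = r \<bullet> s + n1 * (r \<bullet> r)" by (simp add: t_def inner_add_right)
    also have "n1 * (r \<bullet> r) = - (r \<bullet> s) * (y1 * y1 * (r \<bullet> r))" by (simp add: n1_def)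
    finally show ?thesis using y1 by simp
  qed
  have uq: "u \<bullet> u = 1" "q \<bullet> q = 1" "u \<bullet> q = 0"
    using y1 y2 rt by (auto simp: u_def q_def mult.assoc)
  have uqs: "symp u q = 0"
  proof -
    have "symp u q = y1 * y2 * (symp r s + n1 * symp r r)" by (simp add: u_def q_def t_def symp_4 algebra_simps)
    thus ?thesis using sp[of 3] by (simp add: r_def[symmetric] J_rows)
  qed
  define k :: "real^4^4" where "k = vector [- jmul u, - jmul q, u, q]"
  have kK: "k \<in> K" unfolding k_def by (rule K_I[OF uq uqs])
  have kk: "k ** transpose k = mat 1" by (rule K_rows[OF kK])
  hence kk': "transpose k ** k = mat 1" using matrix_left_right_inverse by blast
  define p where "p = h ** transpose k"
  have hp: "h = p ** k" by (simp add: p_def matrix_mul_assoc[symmetric] kk')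
  have pn: "p$i$1 = y1 * J$i$3" "p$i$2 = y2 * (J$i$4 + n1 * J$i$3)" "p$i$3 = (h$i) \<bullet> u" "p$i$4 = (h$i) \<bullet> q" for i
  proof -
    have pi: "p$i$j = (h$i) \<bullet> (k$j)" for j by (simp add: p_def matrix_mult_nth4 transpose_def inner_4)
    have sj: "x \<bullet> (- jmul z) = symp x z" for x z by (simp add: inner_4 symp_4)
    show "p$i$1 = y1 * J$i$3" unfolding pi k_def vector_4 sj sp(1)[symmetric] by (simp add: u_def symp_4 algebra_simps)
    show "p$i$2 = y2 * (J$i$4 + n1 * J$i$3)" unfolding pi k_def vector_4 sj sp[symmetric] by (simp add: q_def t_def symp_4 algebra_simps)
    show "p$i$3 = (h$i) \<bullet> u" "p$i$4 = (h$i) \<bullet> q" unfolding pi k_def vector_4 by auto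
  qed
  have p3: "p$3 = vector [0, 0, 1 / y1, 0]"
    using pn[of 3] y1 rt by (auto simp: vec4_eq_iff J_rows r_def[symmetric] u_def q_def field_simps)
  have st: "s \<bullet> t = t \<bullet> t"
  proof -
    have "t \<bullet> t = s \<bullet> t + n1 * (r \<bullet> t)" by (subst (1) t_def) (simp add: inner_add_left)
    thus ?thesis using rt by simp
  qed
  have p4: "p$4 = vector [0, 0, - n1 / y1, 1 / y2]"
  proof -
    have "s \<bullet> u = - n1 / y1" using y1 by (simp add: u_def n1_def inner_commute field_simps)
    moreover have "s \<bullet> q = 1 / y2" using y2 st by (simp add: q_def field_simps)
    ultimately show ?thesis using pn[of 4] by (auto simp: vec4_eq_iff J_rows s_def[symmetric])
  qed
  define n2 where "n2 = p$1$3 * y1"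
  define n3 where "n3 = p$1$4 * y2"
  define n4 where "n4 = p$2$3 * y1"
  define n5 where "n5 = p$2$4 * y2"
  have p1: "p$1 = vector [y1, n1 * y2, n2 / y1, n3 / y2]"
    using pn[of 1] y1 y2 by (auto simp: vec4_eq_iff J_rows n2_def n3_def)
  have p2: "p$2 = vector [0, y2, n4 / y1, n5 / y2]"
    using pn[of 2] y1 y2 by (auto simp: vec4_eq_iff J_rows n4_def n5_def)
  have "symp (h$1) (h$2) = 0" by (simp add: Sp4R_symp[OF h] J_rows)
  moreover have "symp (h$1) (h$2) = p$1$1 * p$2$3 + p$1$2 * p$2$4 - p$1$3 * p$2$1 - p$1$4 * p$2$2"
  proof -
    have sx: "symp x y = (jmul x v* transpose k) \<bullet> (y v* transpose k)" for x y
      by (subst orthogonal_rows_inner) (simp_all add: symp_def transpose_transpose kk')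
    have c1: "(h$i v* transpose k) = p$i" for i
      by (simp add: p_def vec4_eq_iff vector_matrix_mult_def matrix_mult_nth4 sum_4 mult.commute)
    have cj: "(jmul x v* transpose k) $ j = jmul x \<bullet> (k$j)" for x j
      by (simp add: vector_matrix_mult_def transpose_def inner_4 sum_4 algebra_simps)
    have jj: "jmul x \<bullet> (- jmul z) = - (x \<bullet> z)" "jmul x \<bullet> z = x \<bullet> (- jmul z)" for x z by (simp_all add: inner_4)
    have pk: "h$i \<bullet> (k$j) = p$i$j" for i j by (simp add: p_def matrix_mult_nth4 transpose_def inner_4)
    have "jmul (h$1) \<bullet> (k$1) = - p$1$3" "jmul (h$1) \<bullet> (k$2) = - p$1$4" "jmul (h$1) \<bullet> (k$3) = p$1$1" "jmul (h$1) \<bullet> (k$4) = p$1$2"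
      unfolding pk[symmetric] by (simp_all add: k_def inner_4)
    thus ?thesis unfolding sx c1 inner_4[of "jmul (h$1) v* transpose k"] cj by simp
  qed
  ultimately have "n3 = n1 * n5 + n4"
    using y1 y2 unfolding p1 p2 by (simp add: field_simps)
  moreover have "p = iwasawa_rep n1 n2 n3 n4 n5 y1 y2"
    unfolding vec4_eq_iff[of p] rep_nth by (simp add: p1 p2 p3 p4)
  ultimately have "is_iwasawa h n1 n2 n3 n4 n5 y1 y2"
    unfolding is_iwasawa_def using hp kK y1 y2 by auto
  thus ?thesis by blast
qed

text \<open>The element of \<open>K\<close> does not change lengths, so the length of \<open>x v* h\<close> can be read off from the triangular
representative. Uniqueness of the coordinates and all lattice sums are obtained from this formula.\<close>
lemma iwasawa_norm:
  assumes "is_iwasawa h n1 n2 n3 n4 n5 y1 y2"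
  shows "(norm (x v* h))\<^sup>2 = (x$1 * y1)\<^sup>2 + ((x$1 * n1 + x$2) * y2)\<^sup>2 + 
    ((x$1 * n2 + x$2 * n4 + x$3 - n1 * x$4) / y1)\<^sup>2 + ((x$1 * n3 + x$2 * n5 + x$4) / y2)\<^sup>2"
proof -
  obtain k where k: "k \<in> K" "h = iwasawa_rep n1 n2 n3 n4 n5 y1 y2 ** k" using assms by (auto simp: is_iwasawa_def)
  let ?p = "iwasawa_rep n1 n2 n3 n4 n5 y1 y2"
  have "x v* h = (x v* ?p) v* k" by (simp add: k vector_matrix_mul_assoc)
  hence "(norm (x v* h))\<^sup>2 = (x v* ?p) \<bullet> (x v* ?p)"
    by (simp add: power2_norm_eq_inner orthogonal_rows_inner[OF K_rows[OF k(1)]])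
  also have "(x v* ?p) = vector [x$1 * y1, (x$1 * n1 + x$2) * y2, (x$1 * n2 + x$2 * n4 + x$3 - n1 * x$4) / y1, (x$1 * n3 + x$2 * n5 + x$4) / y2]"
    unfolding vec4_eq_iff vector_matrix_mult_def by (simp add: sum_4 rep_nth algebra_simps diff_divide_distrib add_divide_distrib)
  finally show ?thesis by (simp add: inner_4 power2_eq_square)
qed

text \<open>The lengths of the combinations of the last two rows suffice: \<open>(1, 0)\<close> yields \<open>y\<^sub>1\<close>, then the difference between
\<open>(1, 1)\<close> and \<open>(0, 1)\<close> is affine in \<open>n\<^sub>1\<close>, and finally \<open>(0, 1)\<close> yields \<open>y\<^sub>2\<close>.\<close>
lemma iwasawa_unique:
  assumes 1: "is_iwasawa h n1 n2 n3 n4 n5 y1 y2" and 2: "is_iwasawa h n1' n2' n3' n4' n5' y1' y2'"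
  shows "n1 = n1'" "y1 = y1'" "y2 = y2'"
proof -
  have y: "y1 > 0" "y2 > 0" "y1' > 0" "y2' > 0" using assms by (auto simp: is_iwasawa_def)
  have e: "((a - n1 * b) / y1)\<^sup>2 + (b / y2)\<^sup>2 = ((a - n1' * b) / y1')\<^sup>2 + (b / y2')\<^sup>2" for a b
    using iwasawa_norm[OF 1, of "vector [0,0,a,b]"] iwasawa_norm[OF 2, of "vector [0,0,a,b]"] by simp
  have "(1 / y1)\<^sup>2 = (1 / y1')\<^sup>2" using e[of 1 0] by simp
  hence "1 / y1 = 1 / y1'" using y by (subst (asm) power2_eq_iff_nonneg) auto
  thus y1: "y1 = y1'" by simp
  have "(n1 / y1)\<^sup>2 + (1 / y2)\<^sup>2 = (n1' / y1)\<^sup>2 + (1 / y2')\<^sup>2" using e[of 0 1] y1 by (simp add: power_divide)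
  moreover have "((1 - n1) / y1)\<^sup>2 + (1 / y2)\<^sup>2 = ((1 - n1') / y1)\<^sup>2 + (1 / y2')\<^sup>2" using e[of 1 1] y1 by simp
  ultimately have "((1 - n1) / y1)\<^sup>2 - (n1 / y1)\<^sup>2 = ((1 - n1') / y1)\<^sup>2 - (n1' / y1)\<^sup>2" by linarith
  hence "(1 - n1)\<^sup>2 - n1\<^sup>2 = (1 - n1')\<^sup>2 - n1'\<^sup>2" using y by (simp add: power_divide diff_divide_distrib[symmetric])
  thus n1: "n1 = n1'" by (simp add: power2_eq_square algebra_simps)
  have "(1 / y2)\<^sup>2 = (1 / y2')\<^sup>2" using e[of 0 1] y1 n1 by simp
  hence "1 / y2 = 1 / y2'" using y by (subst (asm) power2_eq_iff_nonneg) auto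
  thus "y2 = y2'" by simp
qed

lemma iwasawa_coords:
  assumes "is_iwasawa h n1 n2 n3 n4 n5 y1 y2"
  shows "iwa_n1 h = n1" "iwa_y1 h = y1" "iwa_y2 h = y2"
proof -
  show "iwa_n1 h = n1" unfolding iwa_n1_def using assms iwasawa_unique(1)[OF _ assms] by (intro the_equality) blast+
  show "iwa_y1 h = y1" unfolding iwa_y1_def using assms iwasawa_unique(2)[OF _ assms] by (intro the_equality) blast+
  show "iwa_y2 h = y2" unfolding iwa_y2_def using assms iwasawa_unique(3)[OF _ assms] by (intro the_equality) blast+
qed

lemma iwa_y1_eq:
  assumes "h \<in> Sp4R"
  shows "iwa_y1 h = 1 / norm (h$3)"
proof -
  obtain n1 n2 n3 n4 n5 y1 y2 where i: "is_iwasawa h n1 n2 n3 n4 n5 y1 y2" using iwasawa_exists[OF assms] by blast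
  hence y: "y1 > 0" by (auto simp: is_iwasawa_def)
  have "(vector [0,0,1,0] :: real^4) v* h = h$3"
    unfolding vec4_eq_iff vector_matrix_mult_def by (simp add: sum_4)
  hence "(norm (h$3))\<^sup>2 = (1 / y1)\<^sup>2" using iwasawa_norm[OF i, of "vector [0,0,1,0]"] by simp
  hence "norm (h$3) = 1 / y1" using y by (subst (asm) power2_eq_iff_nonneg) auto
  thus ?thesis using iwasawa_coords[OF i] by simp
qed

section \<open>Primitive vectors and cosets\<close>

text \<open>Stated by divisors instead of a greatest common divisor of the coordinates, so that an integral combination
of the coordinates with value \<open>1\<close> immediately shows primitivity. The divisor \<open>0\<close> excludes the zero vector.\<close>
definition primitive :: "(real^'n) set" where
  "primitive = {v \<in> lattice. \<forall>d::nat. (\<forall>i. \<exists>k::int. v$i = of_int (int d * k)) \<longrightarrow> d = 1}"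

lemma primitive_lattice: "v \<in> primitive \<Longrightarrow> v \<in> lattice" by (simp add: primitive_def)

lemma primitive_nonzero: "v \<in> primitive \<Longrightarrow> v \<noteq> 0"
  unfolding primitive_def by (auto dest!: spec[of _ 0])

lemma primitive_sub: "primitive \<subseteq> lattice - {0}" using primitive_lattice primitive_nonzero by blast

lemma primitive_uminus: 
  assumes "v \<in> primitive" shows "- v \<in> primitive"
  unfolding primitive_def
proof safe
  show "- v \<in> lattice" using assms by (auto simp: primitive_def lattice_def)
  fix d :: nat assume d: "\<forall>i. \<exists>k. (- v) $ i = real_of_int (int d * k)"
  have "\<exists>k. v $ i = real_of_int (int d * k)" for i
  proof -
    obtain k where "(- v) $ i = real_of_int (int d * k)" using d by blast
    hence "v$i = real_of_int (int d * (- k))" by simp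
    thus ?thesis by blast
  qed
  thus "d = 1" using assms by (simp add: primitive_def)
qed

lemma primitive_Gcd:
  fixes f :: "'n::finite \<Rightarrow> int"
  shows "(\<chi> i. real_of_int (f i)) \<in> primitive \<longleftrightarrow> Gcd (range f) = 1"
proof
  assume p: "(\<chi> i. real_of_int (f i)) \<in> primitive"
  have "\<exists>k. real_of_int (f i) = real_of_int (int (nat (Gcd (range f))) * k)" for i
  proof -
    have "Gcd (range f) dvd f i" by (rule Gcd_dvd) auto
    then obtain k where "f i = Gcd (range f) * k" by (elim dvdE)
    moreover have "Gcd (range f) \<ge> 0" by simp
    ultimately show ?thesis by (metis int_nat_eq)
  qed
  hence "nat (Gcd (range f)) = 1" using p by (simp add: primitive_def)
  thus "Gcd (range f) = 1" by linarith
next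
  assume g: "Gcd (range f) = 1"
  show "(\<chi> i. real_of_int (f i)) \<in> primitive" unfolding primitive_def
  proof safe
    show "(\<chi> i. real_of_int (f i)) \<in> lattice" by (simp add: lattice_def)
    fix d :: nat assume d: "\<forall>i. \<exists>k. (\<chi> i. real_of_int (f i)) $ i = real_of_int (int d * k)"
    have "int d dvd f i" for i
    proof -
      obtain k where "real_of_int (f i) = real_of_int (int d * k)" using d[rule_format, of i] by (auto simp del: of_int_mult)
      hence "f i = int d * k" by (rule of_int_eq_iff[THEN iffD1])
      thus ?thesis by simp
    qed
    hence "int d dvd Gcd (range f)" by (intro Gcd_greatest) auto
    thus "d = 1" using g by simp
  qed
qed

lemma lattice_vec:
  assumes "v \<in> lattice"
  obtains f where "v = (\<chi> i. real_of_int (f i))"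
proof (rule that[of "\<lambda>i. \<lfloor>v$i\<rfloor>"])
  show "v = (\<chi> i. real_of_int \<lfloor>v $ i\<rfloor>)"
    using assms by (auto simp: vec_eq_iff lattice_def)
qed

text \<open>Every nonzero lattice vector is a unique positive multiple of a primitive one, the factor being the gcd of its coordinates.\<close>
lemma bij_primitive:
  "bij_betw (\<lambda>(k,u). of_nat (Suc k) *\<^sub>R u) (UNIV \<times> primitive) (lattice - {0 :: real^'n})"
  unfolding bij_betw_def
proof
  show "inj_on (\<lambda>(k,u). of_nat (Suc k) *\<^sub>R u) (UNIV \<times> (primitive :: (real^'n) set))"
  proof (rule inj_onI, clarify)
    fix k k' and u u' :: "real^'n"
    assume u: "u \<in> primitive" "u' \<in> primitive" and eq: "of_nat (Suc k) *\<^sub>R u = of_nat (Suc k') *\<^sub>R u'"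
    obtain f where f: "u = (\<chi> i. real_of_int (f i))" using lattice_vec[OF primitive_lattice[OF u(1)]] by blast
    obtain f' where f': "u' = (\<chi> i. real_of_int (f' i))" using lattice_vec[OF primitive_lattice[OF u(2)]] by blast
    have e: "int (Suc k) * f i = int (Suc k') * f' i" for i
    proof -
      have "real_of_int (int (Suc k) * f i) = real_of_int (int (Suc k') * f' i)"
        using eq by (simp add: f f' vec_eq_iff)
      thus ?thesis by (rule of_int_eq_iff[THEN iffD1])
    qed
    have G: "Gcd (range f) = 1" "Gcd (range f') = 1" using u primitive_Gcd f f' by metis+
    have "int (Suc k) = Gcd ((\<lambda>x. int (Suc k) * x) ` range f)" using G(1) Gcd_mult[of "int (Suc k)" "range f"] by simp
    also have "(\<lambda>x. int (Suc k) * x) ` range f = (\<lambda>x. int (Suc k') * x) ` range f'"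
      unfolding image_image by (intro image_cong) (auto simp only: e)
    also have "Gcd \<dots> = int (Suc k')" using G(2) Gcd_mult[of "int (Suc k')" "range f'"] by simp
    finally have k: "k = k'" by simp
    show "k = k' \<and> u = u'" using eq k by simp
  qed
  show "(\<lambda>(k,u). of_nat (Suc k) *\<^sub>R u) ` (UNIV \<times> (primitive :: (real^'n) set)) = lattice - {0}"
  proof (intro equalityI subsetI)
    fix x assume "x \<in> (\<lambda>(k,u). of_nat (Suc k) *\<^sub>R u) ` (UNIV \<times> (primitive :: (real^'n) set))"
    then obtain k u where x: "x = of_nat (Suc k) *\<^sub>R u" "u \<in> primitive" by auto
    thus "x \<in> lattice - {0}" using primitive_nonzero[OF x(2)] primitive_lattice[OF x(2)] by (auto simp: lattice_def)
  next
    fix x :: "real^'n" assume x: "x \<in> lattice - {0}"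
    then obtain f where f: "x = (\<chi> i. real_of_int (f i))" using lattice_vec by blast
    define d where "d = Gcd (range f)"
    have d0: "d \<noteq> 0" using x f by (auto simp: d_def vec_eq_iff)
    hence dp: "d > 0" by (simp add: d_def order_less_le)
    have "\<exists>g. \<forall>i. f i = d * g i" unfolding d_def by (rule choice) (auto intro!: Gcd_dvd simp: dvd_def[symmetric])
    then obtain g where g: "\<And>i. f i = d * g i" by blast
    have rf: "range f = (*) d ` range g" using g by auto
    have "d = normalize (d * Gcd (range g))" unfolding Gcd_mult[symmetric] rf[symmetric] by (rule d_def)
    hence "d = d * Gcd (range g)" using dp by (simp add: abs_mult)
    hence "Gcd (range g) = 1" using d0 by simp
    hence p: "(\<chi> i. real_of_int (g i)) \<in> primitive" by (simp add: primitive_Gcd)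
    have "x = of_nat (Suc (nat d - 1)) *\<^sub>R (\<chi> i. real_of_int (g i))"
      using dp by (simp add: f g vec_eq_iff)
    thus "x \<in> (\<lambda>(k,u). of_nat (Suc k) *\<^sub>R u) ` (UNIV \<times> (primitive :: (real^'n) set))"
      using p by (intro image_eqI[of _ _ "(nat d - 1, _)"]) auto
  qed
qed

definition zeta_series :: "complex \<Rightarrow> complex" where
  "zeta_series s = (\<Sum>n. of_nat (Suc n) powr (- s))"

lemma zeta_series_has_sum:
  assumes "Re s > 1"
  shows "((\<lambda>n. of_nat (Suc n) powr (- s)) has_sum zeta_series s) UNIV"
proof -
  have "summable (\<lambda>n. norm (of_nat (Suc n) powr (- s)))"
  proof -
    have "summable (\<lambda>n. real n powr (- Re s))" using assms by (simp add: summable_real_powr_iff)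
    hence "summable (\<lambda>n. real (Suc n) powr (- Re s))" by (subst summable_Suc_iff)
    moreover have "norm (complex_of_nat (Suc n) powr (- s)) = real (Suc n) powr (- Re s)" for n
      by (subst norm_powr_real_powr) auto
    ultimately show ?thesis by simp
  qed
  from norm_summable_imp_has_sum[OF this summable_sums[OF summable_norm_cancel[OF this]]]
  show ?thesis by (simp only: zeta_series_def)
qed

text \<open>Sum over the multiples of each primitive vector first: by homogeneity this produces the zeta series.\<close>
lemma sum_primitive:
  fixes N :: "real^'n \<Rightarrow> real"
  assumes hom: "\<And>k v. k > 0 \<Longrightarrow> N (k *\<^sub>R v) = k * N v" and nn: "\<And>v. N v \<ge> 0"
    and s: "(\<lambda>v. complex_of_real (N v) powr (- w)) summable_on (lattice - {0})" and w: "Re w > 1"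
  shows "infsum (\<lambda>v. complex_of_real (N v) powr (- w)) (lattice - {0}) = zeta_series w * infsum (\<lambda>v. complex_of_real (N v) powr (- w)) primitive"
proof -
  let ?f = "\<lambda>v. complex_of_real (N v) powr (- w)"
  have e: "?f (of_nat (Suc k) *\<^sub>R u) = of_nat (Suc k) powr (- w) * ?f u" for k u
  proof -
    have "complex_of_real (N (of_nat (Suc k) *\<^sub>R u)) = of_real (of_nat (Suc k)) * of_real (N u)" by (simp add: hom)
    thus ?thesis by (simp only:) (subst powr_times_real, use nn in auto)
  qed
  have "(\<lambda>x. ?f ((\<lambda>(k,u). of_nat (Suc k) *\<^sub>R u) x)) summable_on (UNIV \<times> primitive)"
    using s by (subst summable_on_reindex_bij_betw[OF bij_primitive])
  hence s2: "(\<lambda>(k,u). of_nat (Suc k) powr (- w) * ?f u) summable_on (UNIV \<times> primitive)"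
    unfolding case_prod_unfold e .
  have "infsum ?f (lattice - {0}) = infsum (\<lambda>x. ?f ((\<lambda>(k,u). of_nat (Suc k) *\<^sub>R u) x)) (UNIV \<times> primitive)"
    by (rule infsum_reindex_bij_betw[OF bij_primitive, symmetric])
  also have "\<dots> = infsum (\<lambda>(k,u). of_nat (Suc k) powr (- w) * ?f u) (UNIV \<times> primitive)"
    unfolding case_prod_unfold e ..
  also have "\<dots> = infsum (\<lambda>k. infsum (\<lambda>u. of_nat (Suc k) powr (- w) * ?f u) primitive) UNIV"
    by (rule infsum_Sigma'_banach[OF s2, symmetric])
  also have "\<dots> = infsum (\<lambda>k. of_nat (Suc k) powr (- w)) UNIV * infsum ?f primitive"
    by (simp only: infsum_cmult_right' infsum_cmult_left')
  also have "infsum (\<lambda>k. of_nat (Suc k) powr (- w)) UNIV = zeta_series w"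
    using zeta_series_has_sum[OF w] by (rule infsumI)
  finally show ?thesis .
qed


text \<open>The inverse of a symplectic matrix in a form that exhibits integrality.\<close>
definition symp_inverse :: "real^4^4 \<Rightarrow> real^4^4" where "symp_inverse h = - (J ** transpose h ** J)"

lemma symp_inverse: 
  assumes "h \<in> Sp4R" 
  shows "h ** symp_inverse h = mat 1" "symp_inverse h ** h = mat 1" "symp_inverse h \<in> Sp4R"
proof -
  show a: "h ** symp_inverse h = mat 1" and b: "symp_inverse h ** h = mat 1" 
    using symplectic_transpose assms by (auto simp: symp_inverse_def Sp4R_iff)
  have "transpose (symp_inverse h) ** J ** symp_inverse h = transpose (symp_inverse h) ** (transpose h ** J ** h) ** symp_inverse h"
    using assms by (simp add: Sp4R_iff)
  also have "\<dots> = transpose (h ** symp_inverse h) ** J ** (h ** symp_inverse h)"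
    by (simp only: matrix_transpose_mul matrix_mul_assoc)
  also have "\<dots> = J" unfolding a by (simp add: transpose_mat)
  finally show "symp_inverse h \<in> Sp4R" unfolding Sp4R_iff .
qed

lemma int_J: "J$i$j \<in> \<int>"
proof -
  have "\<forall>i j. J$i$j \<in> \<int>" by (simp add: forall_4 J_rows)
  thus ?thesis by blast
qed

lemma int_mult: "(\<And>i j. (A::real^4^4)$i$j \<in> \<int>) \<Longrightarrow> (\<And>i j. (B::real^4^4)$i$j \<in> \<int>) \<Longrightarrow> (A ** B)$i$j \<in> \<int>"
  by (auto simp: matrix_mult_nth4)

lemma Sp4Z_mult: "g \<in> Sp4Z \<Longrightarrow> h \<in> Sp4Z \<Longrightarrow> g ** h \<in> Sp4Z"
  unfolding Sp4Z_def using Sp4R_mult int_mult by blast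

lemma Sp4Z_symp_inverse: "h \<in> Sp4Z \<Longrightarrow> symp_inverse h \<in> Sp4Z"
proof -
  assume h: "h \<in> Sp4Z"
  have "(J ** transpose h ** J) $ i $ j \<in> \<int>" for i j
    by (intro int_mult int_J) (use h in \<open>auto simp: Sp4Z_def transpose_def\<close>)
  thus ?thesis using h symp_inverse(3) by (auto simp: Sp4Z_def symp_inverse_def)
qed

lemma mat1_Sp4Z: "mat 1 \<in> Sp4Z"
proof -
  have "mat 1 \<in> Sp4R" by (simp add: Sp4R_iff transpose_mat)
  thus ?thesis by (auto simp: Sp4Z_def mat_def)
qed

lemma Sp4Z_coord:
  assumes "g \<in> Sp4Z"
  obtains a where "g$i$j = real_of_int a"
  using assms unfolding Sp4Z_def by (metis (mono_tags, lifting) Ints_cases mem_Collect_eq)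

lemma row3_mult: "((A::real^4^4) ** (B::real^4^4))$i = (A$i) v* B"
  by (simp add: vec4_eq_iff vector_matrix_mult_def matrix_mult_nth4 sum_4 mult.commute)

text \<open>In \<open>P_beta\<close> the entries in positions \<open>(1,1)\<close> and \<open>(3,3)\<close> are inverse to each other; being integers they are
both \<open>1\<close> or both \<open>-1\<close>.\<close>
lemma P_beta_row3:
  assumes "p \<in> P_beta \<inter> Sp4Z"
  obtains \<epsilon> where "\<epsilon> = 1 \<or> \<epsilon> = -1" "p$3 = vector [0,0,\<epsilon>,0]"
proof -
  have z: "p$3$1 = 0" "p$3$2 = 0" "p$3$4 = 0" and pz: "p \<in> Sp4Z" using assms by (auto simp: P_beta_def)
  hence "symp (p$1) (p$3) = 1" using Sp4R_symp[of p 1 3] by (simp add: Sp4Z_def J_rows)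
  hence e: "p$1$1 * p$3$3 = 1" using z by (simp add: symp_4)
  obtain a b where ab: "p$1$1 = of_int a" "p$3$3 = of_int b" using Sp4Z_coord[OF pz] by metis
  have "of_int (a * b) = (of_int 1 :: real)" using e ab by simp
  hence "a * b = 1" by (rule of_int_eq_iff[THEN iffD1])
  hence "b = 1 \<or> b = -1" by (simp add: zmult_eq_1_iff) blast
  thus thesis using that[of "p$3$3"] z ab by (auto simp: vec4_eq_iff)
qed

lemma row3_coset:
  assumes "\<gamma> \<in> Sp4Z" "p \<in> P_beta \<inter> Sp4Z"
  shows "(p ** \<gamma>)$3 = \<gamma>$3 \<or> (p ** \<gamma>)$3 = - \<gamma>$3"
proof -
  obtain \<epsilon> where "\<epsilon> = 1 \<or> \<epsilon> = -1" "p$3 = vector [0,0,\<epsilon>,0]" using assms(2) by (rule P_beta_row3)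
  thus ?thesis by (auto simp: row3_mult vec4_eq_iff vector_matrix_mult_def sum_4)
qed

text \<open>The third row of \<open>\<gamma>' \<gamma>\<^sup>-\<^sup>1\<close> is \<open>\<plusminus> e\<^sub>3\<close>. Since rows form a symplectic basis, this forces the zeros in the first column
as well, so the quotient lies in the Jacobi parabolic.\<close>
lemma row3_eq_coset:
  assumes g: "\<gamma> \<in> Sp4Z" "\<gamma>' \<in> Sp4Z" and r: "\<gamma>'$3 = \<gamma>$3 \<or> \<gamma>'$3 = - \<gamma>$3"
  shows "\<exists>p \<in> P_beta \<inter> Sp4Z. \<gamma>' = p ** \<gamma>"
proof -
  define p where "p = \<gamma>' ** symp_inverse \<gamma>"
  have gR: "\<gamma> \<in> Sp4R" using g by (simp add: Sp4Z_def)
  have pZ: "p \<in> Sp4Z" unfolding p_def by (intro Sp4Z_mult Sp4Z_symp_inverse g)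
  have "\<gamma>' = p ** \<gamma>" by (simp add: p_def matrix_mul_assoc[symmetric] symp_inverse[OF gR])
  moreover have "p \<in> P_beta"
  proof -
    have 1: "(\<gamma>$3) v* symp_inverse \<gamma> = vector [0,0,1,0]"
      unfolding row3_mult[symmetric] symp_inverse[OF gR] by (simp add: vec4_eq_iff mat_def)
    have "p$3 = vector [0,0,1,0] \<or> p$3 = - vector [0,0,1,0]"
      using r unfolding p_def row3_mult
    proof
      assume "\<gamma>'$3 = - \<gamma>$3"
      hence "\<gamma>'$3 v* symp_inverse \<gamma> = - (\<gamma>$3 v* symp_inverse \<gamma>)" by (simp add: vector_matrix_mult_def vec_eq_iff sum_negf)
      thus "\<gamma>'$3 v* symp_inverse \<gamma> = vector [0,0,1,0] \<or> \<gamma>'$3 v* symp_inverse \<gamma> = - vector [0,0,1,0]" using 1 by simp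
    qed (use 1 in auto)
    then obtain \<epsilon> where p3: "\<epsilon> \<noteq> 0" "p$3$1 = 0" "p$3$2 = 0" "p$3$3 = \<epsilon>" "p$3$4 = 0" by fastforce
    have "symp (p$i) (p$3) = J$i$3" for i using Sp4R_symp[of p] pZ by (simp add: Sp4Z_def)
    from this[of 2] this[of 4] have "p$2$1 = 0" "p$4$1 = 0" using p3 by (auto simp: symp_4 J_rows)
    thus ?thesis using p3 pZ by (auto simp: P_beta_def Sp4Z_def)
  qed
  ultimately show ?thesis using pZ by blast
qed

lemma row3_is_primitive:
  assumes "\<gamma> \<in> Sp4Z"
  shows "\<gamma>$3 \<in> primitive"
  unfolding primitive_def
proof safe
  have i: "\<gamma>$i$j \<in> \<int>" for i j using assms by (simp add: Sp4Z_def)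
  thus "\<gamma>$3 \<in> lattice" by (simp add: lattice_def)
  fix d :: nat assume d: "\<forall>i. \<exists>k. \<gamma> $ 3 $ i = real_of_int (int d * k)"
  then obtain k where k: "\<And>i. \<gamma> $ 3 $ i = real_of_int (int d * k i)" by metis
  have "\<forall>j. \<exists>k. \<gamma>$1$j = real_of_int k" using Sp4Z_coord[OF assms] by metis
  then obtain f where f: "\<And>j. \<gamma>$1$j = real_of_int (f j)" by metis
  have "symp (\<gamma>$1) (\<gamma>$3) = 1" using Sp4R_symp[of \<gamma> 1 3] assms by (simp add: Sp4Z_def J_rows)
  hence "real_of_int (int d * (f 1 * k 3 + f 2 * k 4 - f 3 * k 1 - f 4 * k 2)) = real_of_int 1"
    by (simp add: symp_4 k f algebra_simps)
  hence "int d * (f 1 * k 3 + f 2 * k 4 - f 3 * k 1 - f 4 * k 2) = 1" by (rule of_int_eq_iff[THEN iffD1])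
  hence "int d dvd 1" by (metis dvd_triv_left)
  thus "d = 1" by simp
qed

text \<open>Bezout: after removing the gcd, an integral pair is the bottom row of a matrix in \<open>SL\<^sub>2(\<int>)\<close>.\<close>
lemma SL2_completion:
  fixes x y :: int
  obtains p q r s where "p * s - q * r = 1" "x = gcd x y * r" "y = gcd x y * s"
proof (cases "gcd x y = 0")
  case True
  thus thesis using that[of 1 1 0 0] by simp
next
  case False
  obtain u v where uv: "u * x + v * y = gcd x y" using bezout_int by blast
  define r where "r = x div gcd x y"
  define s where "s = y div gcd x y"
  have rs: "x = gcd x y * r" "y = gcd x y * s" by (simp_all add: r_def s_def)
  have "gcd x y * (u * r + v * s) = u * (gcd x y * r) + v * (gcd x y * s)" by (simp add: algebra_simps)
  also have "\<dots> = gcd x y * 1" unfolding rs[symmetric] using uv by simp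
  finally have "gcd x y * (u * r + v * s) = gcd x y * 1" .
  hence "u * r + v * s = 1" using False by auto
  thus thesis using that[of v s "-u" r] rs by (simp add: algebra_simps)
qed

text \<open>Two commuting copies of \<open>SL\<^sub>2(\<int>)\<close>, on the coordinates \<open>1, 3\<close> and \<open>2, 4\<close>, provide a matrix \<open>M\<close> whose
third and fourth rows combine to \<open>v\<close> with coefficients \<open>d\<^sub>1\<close>, \<open>d\<^sub>2\<close>, the gcds of the two pairs. These are
coprime, and a matrix \<open>D\<close> in the Levi subgroup of the Siegel parabolic with third row \<open>(0, 0, d\<^sub>1, d\<^sub>2)\<close> forms
this combination.\<close>
lemma primitive_is_row3:
  assumes "v \<in> primitive"
  shows "\<exists>\<gamma>\<in>Sp4Z. \<gamma>$3 = v"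
proof -
  obtain f where f: "v = (\<chi> i. real_of_int (f i))" using lattice_vec[OF primitive_lattice[OF assms]] by blast
  have G: "Gcd (range f) = 1" using assms f primitive_Gcd by metis
  obtain p1 q1 r1 s1 where 1: "p1 * s1 - q1 * r1 = 1" "f 1 = gcd (f 1) (f 3) * r1" "f 3 = gcd (f 1) (f 3) * s1" by (rule SL2_completion[of "f 1" "f 3"])
  obtain p2 q2 r2 s2 where 2: "p2 * s2 - q2 * r2 = 1" "f 2 = gcd (f 2) (f 4) * r2" "f 4 = gcd (f 2) (f 4) * s2" by (rule SL2_completion[of "f 2" "f 4"])
  define d1 where "d1 = gcd (f 1) (f 3)"
  define d2 where "d2 = gcd (f 2) (f 4)"
  have "range f = {f 1, f 2, f 3, f 4}" by (auto simp: UNIV_4)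
  hence "Gcd {f 1, f 2, f 3, f 4} = 1" using G by (simp only:)
  hence "gcd d1 d2 = 1" by (simp add: d1_def d2_def ac_simps)
  then obtain a b where ab: "a * d1 + b * d2 = 1" using bezout_int[of d1 d2] by auto
  have det1: "real_of_int p1 * s1 - q1 * r1 = 1" using 1(1) by (metis of_int_1 of_int_diff of_int_mult)
  have det2: "real_of_int p2 * s2 - q2 * r2 = 1" using 2(1) by (metis of_int_1 of_int_diff of_int_mult)
  have ab': "real_of_int a * d1 + b * d2 = 1" using ab by (metis of_int_1 of_int_add of_int_mult)
  define M :: "real^4^4" where "M = vector [vector [of_int p1, 0, of_int q1, 0], vector [0, of_int p2, 0, of_int q2], 
      vector [of_int r1, 0, of_int s1, 0], vector [0, of_int r2, 0, of_int s2]]"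
  define D :: "real^4^4" where "D = vector [vector [of_int a, of_int b, 0, 0], vector [- of_int d2, of_int d1, 0, 0],
      vector [0, 0, of_int d1, of_int d2], vector [0, 0, - of_int b, of_int a]]"
  have "M \<in> Sp4R" unfolding Sp4R_iff vec4_eq_iff matrix_mult_nth4
    using det1 det2 by (simp add: M_def J_rows transpose_def algebra_simps)
  hence MZ: "M \<in> Sp4Z" unfolding Sp4Z_def by (auto simp: forall_4 M_def)
  have "D \<in> Sp4R" unfolding Sp4R_iff vec4_eq_iff matrix_mult_nth4
    using ab' by (simp add: D_def J_rows transpose_def algebra_simps)
  hence DZ: "D \<in> Sp4Z" unfolding Sp4Z_def by (auto simp: forall_4 D_def)
  have "(D ** M)$3 = v" unfolding vec4_eq_iff matrix_mult_nth4
    using 1(2,3) 2(2,3) by (simp add: D_def M_def f d1_def d2_def flip: of_int_mult)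
  thus ?thesis using Sp4Z_mult[OF DZ MZ] by blast
qed

lemma eq_up_to_sign:
  fixes a b x y :: "real^4"
  shows "x = a \<or> x = - a \<Longrightarrow> y = b \<or> y = - b \<Longrightarrow> x = y \<or> x = - y \<Longrightarrow> a = b \<or> a = - b"
  by (metis (no_types) minus_minus)

text \<open>The third rows of the chosen coset representatives contain exactly one of \<open>v\<close> and \<open>- v\<close> for each primitive
\<open>v\<close>, which accounts for the factor \<open>1/2\<close>. Any choice of representatives will do because \<open>F\<close> is even.\<close>
theorem coset_sum_Sp4:
  fixes F :: "real^4 \<Rightarrow> complex"
  assumes F: "\<And>v. F (- v) = F v" and s: "F summable_on primitive"
    and f: "\<And>\<gamma>. \<gamma> \<in> Sp4Z \<Longrightarrow> f \<gamma> = F (\<gamma>$3)"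
  shows "coset_sum (P_beta \<inter> Sp4Z) Sp4Z f = (1/2) * infsum F primitive"
proof -
  define H where "H = P_beta \<inter> Sp4Z"
  define cos where "cos = (\<lambda>\<gamma>::real^4^4. (\<lambda>h. h ** \<gamma>) ` H)"
  define rep where "rep = (\<lambda>c::(real^4^4) set. SOME \<gamma>. \<gamma> \<in> c)"
  define \<phi> where "\<phi> = (\<lambda>c. rep c $ 3)"
  have 1: "mat 1 \<in> H" using mat1_Sp4Z by (auto simp: H_def P_beta_def Sp4Z_def mat_def)
  have repc: "\<exists>h\<in>H. rep (cos \<gamma>) = h ** \<gamma>" for \<gamma>
  proof -
    have "\<gamma> \<in> cos \<gamma>" using 1 by (auto simp: cos_def intro!: image_eqI[of _ _ "mat 1"])
    hence "rep (cos \<gamma>) \<in> cos \<gamma>" unfolding rep_def by (rule someI)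
    thus ?thesis by (auto simp: cos_def)
  qed
  have repZ: "rep (cos \<gamma>) \<in> Sp4Z" if "\<gamma> \<in> Sp4Z" for \<gamma>
    using repc[of \<gamma>] that Sp4Z_mult by (auto simp: H_def)
  have Hmult: "h ** k \<in> H" if "h \<in> H" "k \<in> H" for h k
  proof -
    have hk: "h \<in> Sp4Z" "k \<in> Sp4Z" using that by (auto simp: H_def)
    have "(h ** k)$3 = k$3 \<or> (h ** k)$3 = - k$3" using row3_coset[OF hk(2)] that by (auto simp: H_def)
    moreover have "k \<in> P_beta \<inter> Sp4Z" using that by (simp add: H_def)
    then obtain \<epsilon> where "\<epsilon> = 1 \<or> \<epsilon> = -1" "k$3 = vector [0,0,\<epsilon>,0]" by (rule P_beta_row3)
    ultimately have "(h ** k)$3 = mat 1 $ 3 \<or> (h ** k)$3 = - (mat 1 $ 3 :: real^4)" by (auto simp: vec4_eq_iff mat_def)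
    from row3_eq_coset[OF mat1_Sp4Z Sp4Z_mult[OF hk] this]
    show ?thesis by (auto simp: H_def)
  qed
  have same: "cos \<gamma> \<subseteq> cos \<gamma>'" if g3: "\<gamma> \<in> Sp4Z" "\<gamma>' \<in> Sp4Z" "\<gamma>$3 = \<gamma>'$3 \<or> \<gamma>$3 = - \<gamma>'$3" for \<gamma> \<gamma>'
  proof -
    obtain p where p: "p \<in> H" "\<gamma> = p ** \<gamma>'" using row3_eq_coset[OF g3(2,1,3)] by (auto simp: H_def)
    show ?thesis unfolding cos_def p(2)
    proof (rule image_subsetI)
      fix h assume "h \<in> H"
      moreover have "h ** (p ** \<gamma>') = (h ** p) ** \<gamma>'" by (simp add: matrix_mul_assoc)
      ultimately show "h ** (p ** \<gamma>') \<in> (\<lambda>h. h ** \<gamma>') ` H" using Hmult[OF _ p(1)] by simp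
    qed
  qed
  have same': "cos \<gamma> = cos \<gamma>'" if "\<gamma> \<in> Sp4Z" "\<gamma>' \<in> Sp4Z" "\<gamma>$3 = \<gamma>'$3 \<or> \<gamma>$3 = - \<gamma>'$3" for \<gamma> \<gamma>'
  proof -
    have "\<gamma>'$3 = \<gamma>$3 \<or> \<gamma>'$3 = - \<gamma>$3" using that(3) by auto
    thus ?thesis using same[OF that] same[OF that(2,1)] by blast
  qed
  have phic: "\<phi> (cos \<gamma>) = \<gamma>$3 \<or> \<phi> (cos \<gamma>) = - \<gamma>$3" if "\<gamma> \<in> Sp4Z" for \<gamma>
  proof -
    obtain h where h: "h \<in> H" "rep (cos \<gamma>) = h ** \<gamma>" using repc by blast
    show ?thesis unfolding \<phi>_def h(2) by (rule row3_coset[OF that]) (use h in \<open>simp add: H_def\<close>)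
  qed
  have phieq: "cos \<gamma> = cos \<gamma>'" if "\<gamma> \<in> Sp4Z" "\<gamma>' \<in> Sp4Z" "\<phi> (cos \<gamma>) = \<phi> (cos \<gamma>') \<or> \<phi> (cos \<gamma>) = - \<phi> (cos \<gamma>')" for \<gamma> \<gamma>'
  proof (rule same'[OF that(1,2)])
    show "\<gamma>$3 = \<gamma>'$3 \<or> \<gamma>$3 = - \<gamma>'$3"
      by (rule eq_up_to_sign[OF phic[OF that(1)] phic[OF that(2)] that(3)])
  qed
  define C where "C = cos ` Sp4Z"
  have inj: "inj_on \<phi> C" using phieq by (auto simp: C_def inj_on_def)
  have primC: "\<phi> c \<in> primitive" if "c \<in> C" for c using that repZ row3_is_primitive by (auto simp: C_def \<phi>_def)
  have unC: "primitive = \<phi> ` C \<union> uminus ` \<phi> ` C"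
  proof (intro equalityI subsetI)
    fix v :: "real^4" assume "v \<in> primitive"
    then obtain \<gamma> where g: "\<gamma> \<in> Sp4Z" "\<gamma>$3 = v" using primitive_is_row3 by blast
    have "\<phi> (cos \<gamma>) = v \<or> \<phi> (cos \<gamma>) = - v" using phic[OF g(1)] g(2) by simp
    hence "v = \<phi> (cos \<gamma>) \<or> v = - \<phi> (cos \<gamma>)" by auto
    moreover have "cos \<gamma> \<in> C" using g(1) by (simp add: C_def)
    ultimately show "v \<in> \<phi> ` C \<union> uminus ` \<phi> ` C" by blast
  qed (use primC primitive_uminus in auto)
  have disj: "\<phi> ` C \<inter> uminus ` \<phi> ` C = {}"
  proof (rule ccontr)
    assume "\<phi> ` C \<inter> uminus ` \<phi> ` C \<noteq> {}"
    then obtain g g' where g: "g \<in> Sp4Z" "g' \<in> Sp4Z" "\<phi> (cos g) = - \<phi> (cos g')" by (auto simp: C_def)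
    hence "cos g = cos g'" using phieq by blast
    hence "\<phi> (cos g) = - \<phi> (cos g)" using g by simp
    hence "\<phi> (cos g) = 0" by (simp add: vec_eq_iff)
    moreover have "cos g \<in> C" using g(1) by (simp add: C_def)
    ultimately show False using primC primitive_nonzero by blast
  qed
  have sub: "\<phi> ` C \<subseteq> primitive" "uminus ` \<phi> ` C \<subseteq> primitive" using unC by auto
  have "infsum F primitive = infsum F (\<phi> ` C) + infsum F (uminus ` \<phi> ` C)"
    unfolding unC by (rule infsum_Un_disjoint[OF _ _ disj]) (use s sub summable_on_subset_banach in blast)+
  also have "infsum F (uminus ` \<phi> ` C) = infsum F (\<phi> ` C)"
    by (subst infsum_reindex) (auto simp: o_def F)
  also have "infsum F (\<phi> ` C) = infsum (\<lambda>c. f (rep c)) C"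
  proof (subst infsum_reindex[OF inj], rule infsum_cong)
    fix c assume "c \<in> C"
    hence "rep c \<in> Sp4Z" using repZ by (auto simp: C_def)
    thus "(F \<circ> \<phi>) c = f (rep c)" by (simp add: \<phi>_def f)
  qed
  also have "infsum (\<lambda>c. f (rep c)) C = coset_sum (P_beta \<inter> Sp4Z) Sp4Z f"
    by (simp add: coset_sum_def C_def rep_def cos_def H_def)
  finally show ?thesis by simp
qed

section \<open>The zeta function and sums over primitive vectors\<close>

lemma SL2_row_mult:
  "((vector [vector [1, b], vector [0, 1]] :: int^2^2) ** \<delta>) $ 2 = \<delta>$2"
  "((vector [vector [1, b], vector [0, 1]] :: int^2^2) ** \<delta>) $ 1 = (\<chi> i. \<delta>$1$i + b * \<delta>$2$i)"
  by (simp_all add: vec_eq_iff forall_2 matrix_matrix_mult_def sum_2)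

text \<open>Left multiplication by a unipotent matrix keeps the bottom row, and two matrices with the same bottom row differ
by such a multiplication. So the cosets correspond to primitive pairs, without a factor \<open>1/2\<close>.\<close>
theorem coset_sum_SL2:
  fixes F :: "real^2 \<Rightarrow> complex"
  assumes f: "\<And>\<delta>. \<delta> \<in> SL2Z \<Longrightarrow> f \<delta> = F (\<chi> i. real_of_int (\<delta>$2$i))"
  shows "coset_sum Gamma_inf2 SL2Z f = infsum F primitive"
proof -
  define U :: "int \<Rightarrow> int^2^2" where "U = (\<lambda>b. vector [vector [1, b], vector [0, 1]])"
  have G: "Gamma_inf2 = range U" by (auto simp: Gamma_inf2_def U_def)
  have U2: "(U b ** \<delta>)$2 = \<delta>$2" "(U b ** \<delta>)$1 = (\<chi> i. \<delta>$1$i + b * \<delta>$2$i)" for b \<delta>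
    unfolding U_def by (rule SL2_row_mult)+
  have Ueq: "\<delta> = U b ** \<delta>'" if "\<delta>$1$1 = \<delta>'$1$1 + b * \<delta>'$2$1" "\<delta>$1$2 = \<delta>'$1$2 + b * \<delta>'$2$2" "\<delta>$2 = \<delta>'$2" for \<delta> \<delta>' :: "int^2^2" and b
    using that U2[of b \<delta>'] by (simp add: vec_eq_iff forall_2)
  define cos where "cos = (\<lambda>\<delta>::int^2^2. (\<lambda>h. h ** \<delta>) ` Gamma_inf2)"
  define rep where "rep = (\<lambda>c::(int^2^2) set. SOME \<delta>. \<delta> \<in> c)"
  define \<phi> where "\<phi> = (\<lambda>c. (\<chi> i. real_of_int (rep c $ 2 $ i)))"
  have repc: "\<exists>b. rep (cos \<delta>) = U b ** \<delta>" for \<delta>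
  proof -
    have "U 0 ** \<delta> \<in> cos \<delta>" by (auto simp: cos_def G)
    hence "rep (cos \<delta>) \<in> cos \<delta>" unfolding rep_def by (rule someI)
    thus ?thesis by (auto simp: cos_def G)
  qed
  have rep2: "rep (cos \<delta>) $ 2 = \<delta>$2" for \<delta>
    using repc[of \<delta>] U2 by auto
  have det: "\<delta>$1$1 * \<delta>$2$2 - \<delta>$1$2 * \<delta>$2$1 = 1" if "\<delta> \<in> SL2Z" for \<delta>
    using that by (simp add: SL2Z_def det_2)
  have repZ: "rep (cos \<delta>) \<in> SL2Z" if "\<delta> \<in> SL2Z" for \<delta>
  proof -
    obtain b where b: "rep (cos \<delta>) = U b ** \<delta>" using repc by blast
    show ?thesis using det[OF that] unfolding b SL2Z_def by (simp add: det_2 U2 algebra_simps)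
  qed
  have same: "cos \<delta> \<subseteq> cos \<delta>'" if h: "\<delta> \<in> SL2Z" "\<delta>' \<in> SL2Z" "\<delta>$2 = \<delta>'$2" for \<delta> \<delta>'
  proof -
    define c where "c = \<delta>'$2$1"
    define d where "d = \<delta>'$2$2"
    \<comment> \<open>Matrices with a common bottom row satisfy \<open>\<delta> = U m ** \<delta>'\<close>, and \<open>m\<close> is the upper right entry of
    \<open>\<delta> \<delta>'\<^sup>-\<^sup>1\<close>.\<close>
    define m where "m = \<delta>'$1$1 * \<delta>$1$2 - \<delta>$1$1 * \<delta>'$1$2"
    have e: "\<delta>$1$1 * d - \<delta>$1$2 * c = 1" "\<delta>'$1$1 * d - \<delta>'$1$2 * c = 1"
      using det[OF h(1)] det[OF h(2)] h(3) by (auto simp: c_def d_def)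
    have "\<delta>$1$1 = \<delta>'$1$1 + m * c" "\<delta>$1$2 = \<delta>'$1$2 + m * d" 
      using e unfolding m_def by algebra+
    hence eq: "\<delta> = U m ** \<delta>'" by (intro Ueq) (auto simp: c_def d_def h)
    have UU: "U b ** (U m ** \<delta>') = U (b + m) ** \<delta>'" for b
      by (intro Ueq) (auto simp: U2 algebra_simps)
    show ?thesis unfolding cos_def G eq by (auto simp: UU)
  qed
  have same': "cos \<delta> = cos \<delta>'" if h: "\<delta> \<in> SL2Z" "\<delta>' \<in> SL2Z" "\<delta>$2 = \<delta>'$2" for \<delta> \<delta>'
    using same[OF h] same[OF h(2,1) h(3)[symmetric]] by blast
  define C where "C = cos ` SL2Z"
  have inj: "inj_on \<phi> C"
  proof (rule inj_onI)
    fix x y assume "x \<in> C" "y \<in> C" and eq: "\<phi> x = \<phi> y"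
    then obtain \<delta> \<delta>' where d: "\<delta> \<in> SL2Z" "\<delta>' \<in> SL2Z" "x = cos \<delta>" "y = cos \<delta>'" by (auto simp: C_def)
    have "\<delta>$2 = \<delta>'$2" using eq by (simp add: \<phi>_def d rep2 vec_eq_iff)
    thus "x = y" using same'[OF d(1,2)] d by simp
  qed
  have ran: "\<phi> ` C = primitive"
  proof (intro equalityI subsetI)
    fix v assume "v \<in> \<phi> ` C"
    then obtain \<delta> where d: "\<delta> \<in> SL2Z" "v = \<phi> (cos \<delta>)" by (auto simp: C_def)
    have "v = (\<chi> i. real_of_int (\<delta>$2$i))" by (simp add: d \<phi>_def rep2)
    moreover have "Gcd (range (\<lambda>i. \<delta>$2$i)) = 1"
    proof -
      have "Gcd (range (\<lambda>i. \<delta>$2$i)) dvd \<delta>$2$i" for i by (rule Gcd_dvd) auto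
      hence "Gcd (range (\<lambda>i. \<delta>$2$i)) dvd \<delta>$1$1 * \<delta>$2$2 - \<delta>$1$2 * \<delta>$2$1" by (intro dvd_diff dvd_mult)
      hence "\<bar>Gcd (range (\<lambda>i. \<delta>$2$i))\<bar> = 1" unfolding det[OF d(1)] zdvd1_eq .
      moreover have "Gcd (range (\<lambda>i. \<delta>$2$i)) \<ge> 0" by (rule Gcd_int_greater_eq_0)
      ultimately show ?thesis by linarith
    qed
    ultimately show "v \<in> primitive" using primitive_Gcd by metis
  next
    fix v :: "real^2" assume v: "v \<in> primitive"
    obtain f where f: "v = (\<chi> i. real_of_int (f i))" using lattice_vec[OF primitive_lattice[OF v]] by blast
    have G: "Gcd (range f) = 1" using v f primitive_Gcd by metis
    have "range f = {f 1, f 2}" by (auto simp: UNIV_2)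
    hence "Gcd {f 1, f 2} = 1" using G by (simp only:)
    hence g: "gcd (f 1) (f 2) = 1" by simp
    obtain p q r s where 1: "p * s - q * r = 1" "f 1 = gcd (f 1) (f 2) * r" "f 2 = gcd (f 1) (f 2) * s" by (rule SL2_completion[of "f 1" "f 2"])
    define \<delta> :: "int^2^2" where "\<delta> = vector [vector [p, q], vector [r, s]]"
    have "\<delta> \<in> SL2Z" using 1(1) by (simp add: SL2Z_def det_2 \<delta>_def)
    moreover have "\<phi> (cos \<delta>) = v" using 1(2,3) unfolding g by (simp add: \<phi>_def rep2 f vec_eq_iff forall_2 \<delta>_def)
    ultimately show "v \<in> \<phi> ` C" by (auto simp: C_def)
  qed
  have "infsum F primitive = infsum (\<lambda>c. f (rep c)) C"
    unfolding ran[symmetric]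
  proof (subst infsum_reindex[OF inj], rule infsum_cong)
    fix c assume "c \<in> C"
    hence "rep c \<in> SL2Z" using repZ by (auto simp: C_def)
    thus "(F \<circ> \<phi>) c = f (rep c)" by (simp add: \<phi>_def f)
  qed
  also have "infsum (\<lambda>c. f (rep c)) C = coset_sum Gamma_inf2 SL2Z f"
    by (simp add: coset_sum_def C_def rep_def cos_def)
  finally show ?thesis by simp
qed

definition prim_sum :: "(real^'n \<Rightarrow> real) \<Rightarrow> complex \<Rightarrow> complex" where
  "prim_sum N w = (\<Sum>\<^sub>\<infinity>v\<in>primitive. of_real (N v) powr (- w))"

lemma primitive_1: "(primitive :: (real^1) set) = {1, -1}"
proof -
  have "v \<in> primitive \<longleftrightarrow> v = 1 \<or> v = -1" if vl: "v \<in> lattice" for v :: "real^1"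
  proof -
    obtain f where f: "v = (\<chi> i. real_of_int (f i))" using lattice_vec[OF vl] by blast
    have "v \<in> primitive \<longleftrightarrow> Gcd (range f) = 1" unfolding f by (rule primitive_Gcd)
    also have "range f = {f 1}" by auto
    also have "Gcd {f 1} = \<bar>f 1\<bar>" by simp
    also have "\<bar>f 1\<bar> = 1 \<longleftrightarrow> v = 1 \<or> v = -1" by (auto simp: f vec_eq_iff abs_if)
    finally show ?thesis .
  qed
  moreover have "(1::real^1) \<in> lattice" "(-1::real^1) \<in> lattice" by (auto simp: lattice_def)
  ultimately show ?thesis using primitive_lattice by blast
qed

interpretation line: linear_family "{0::real}" "\<lambda>_. \<lambda>v::real^1. v"
  by unfold_locales (auto simp: case_prod_unfold intro!: continuous_intros linear_id[unfolded id_def])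

text \<open>The primitive vectors of the line are \<open>1\<close> and \<open>-1\<close>. The zeta function is thus the case of dimension one.\<close>
lemma line_sum:
  assumes "Re w > 1"
  shows "(\<Sum>\<^sub>\<infinity>v\<in>lattice - {0}. complex_of_real (norm (v::real^1)) powr (- w)) = 2 * zeta_series w"
proof -
  have n1: "norm (1::real^1) = 1" "norm (-1::real^1) = 1" by (simp_all add: norm_vector_1)
  have "(\<Sum>\<^sub>\<infinity>v\<in>lattice - {0}. complex_of_real (norm (v::real^1)) powr (- w)) = zeta_series w * infsum (\<lambda>v::real^1. complex_of_real (norm v) powr (- w)) primitive"
    by (rule sum_primitive) (use line.norm_powr_summable[of "lattice - {0}" 0 w] assms in auto)
  also have "infsum (\<lambda>v::real^1. complex_of_real (norm v) powr (- w)) primitive = 2"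
  proof -
    have "(1::real^1) \<noteq> -1" by (simp add: vec_eq_iff)
    thus ?thesis unfolding primitive_1 using n1 by simp
  qed
  finally show ?thesis by simp
qed

lemma zeta_series_mero_family: "mero_family {0::real} 1 b (\<lambda>_. zeta_series)"
proof -
  have "mero_family {0::real} 1 b (\<lambda>p w. 2 * zeta_series w)"
    by (rule mero_family_cong[THEN iffD2, OF _ line.norm_powr_sum_continuation[simplified]]) (simp add: line_sum)
  thus ?thesis by (rule mero_family_divide_entire[where h = "\<lambda>_. 2" and a = 0]) auto
qed

lemma zeta_series_holomorphic: "zeta_series holomorphic_on {w. Re w > 1}"
proof -
  have "joint_hol {0::real} {w. Re w > real CARD(1)} (\<lambda>p w. \<Sum>\<^sub>\<infinity>v\<in>lattice - {0}. of_real (norm (v::real^1)) powr (- w))"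
    by (rule line.norm_powr_sum_joint_hol) simp
  hence "(\<lambda>w. (1/2) * (\<Sum>\<^sub>\<infinity>v\<in>lattice - {0}. of_real (norm (v::real^1)) powr (- w))) holomorphic_on {w. Re w > 1}"
    by (intro holomorphic_intros) (simp add: joint_hol_def)
  thus ?thesis by (rule holomorphic_transform) (simp add: line_sum)
qed

lemma mero_family_left_continuable:
  assumes "mero_family P \<sigma> b G" "p \<in> P" "b \<le> \<sigma>"
  shows "\<exists>D W. D holomorphic_on {s. Re s > b} \<and> W holomorphic_on {s. Re s > b} \<and> (\<exists>s. Re s > b \<and> D s \<noteq> 0)
         \<and> (\<forall>s. Re s > \<sigma> \<longrightarrow> D s * G p s = W s)"
proof -
  obtain D W where 1: "D holomorphic_on UNIV" "\<exists>w. D w \<noteq> 0" "joint_hol P {w. Re w > b} W"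
     "\<And>w. Re w > \<sigma> \<Longrightarrow> D w * G p w = W p w" using assms unfolding mero_family_def by blast
  have "\<exists>s. Re s > b \<and> D s \<noteq> 0"
  proof (rule ccontr)
    assume "\<not> ?thesis"
    hence z: "\<And>s. Re s > b \<Longrightarrow> D s = 0" by auto
    obtain a where a: "D a \<noteq> 0" using 1 by blast
    have "D a = 0"
      by (rule analytic_continuation_open[of "{s. Re s > b}" UNIV D "\<lambda>_. 0"])
         (use 1 z open_halfspace_Re_gt in \<open>auto intro!: exI[of _ "of_real (b + 1)"]\<close>)
    with a show False by simp
  qed
  thus ?thesis using 1 assms by (intro exI[of _ D] exI[of _ "W p"]) (auto simp: joint_hol_def intro: holomorphic_on_subset)
qed

lemma zeta_series_left_continuable: "left_continuable 1 zeta_series"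
  unfolding left_continuable_def using mero_family_left_continuable[OF zeta_series_mero_family, of 0] by auto

lemma zeta_nicely: "zeta nicely_meromorphic_on UNIV"
  and zeta_eq: "Re s > 1 \<Longrightarrow> zeta s = zeta_series s"
  using mero_cont_nicely[OF zeta_series_holomorphic zeta_series_left_continuable] mero_cont_eq[OF zeta_series_holomorphic zeta_series_left_continuable, of s]
  by (simp_all add: zeta_def zeta_series_def[abs_def])

text \<open>The series has positive terms, the first of which is \<open>1\<close>.\<close>
lemma zeta_series_real: 
  assumes "x > 1"
  shows "zeta_series (of_real x) \<noteq> 0"
proof -
  have "((\<lambda>n. of_nat (Suc n) powr (- complex_of_real x)) has_sum zeta_series (of_real x)) UNIV"
    by (rule zeta_series_has_sum) (use assms in auto)
  hence h: "((\<lambda>n. Re (of_nat (Suc n) powr (- complex_of_real x))) has_sum Re (zeta_series (of_real x))) UNIV"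
    by (rule has_sum_Re)
  have e: "Re (of_nat (Suc n) powr (- complex_of_real x)) = real (Suc n) powr (- x)" for n
    using powr_of_real[of "real (Suc n)" "-x"] by (metis Re_complex_of_real of_nat_0_le_iff of_real_minus of_real_of_nat_eq)
  have "1 \<le> Re (zeta_series (of_real x))"
  proof -
    have "((\<lambda>n. Re (of_nat (Suc n) powr (- complex_of_real x))) has_sum 1) {0::nat}" 
      by (rule has_sum_finiteI) (auto simp: e)
    from has_sum_mono2[OF this h] show ?thesis by (auto simp: e simp del: of_nat_Suc)
  qed
  thus ?thesis by auto
qed

context linear_family
begin

lemma norm_hom: "p \<in> P \<Longrightarrow> k > 0 \<Longrightarrow> norm (L p (k *\<^sub>R v)) = k * norm (L p v)"
  using linL by (simp add: linear_cmul)

lemma prim_sum_joint_hol: "joint_hol P {w. Re w > real CARD('n)} (\<lambda>p. prim_sum (\<lambda>v. norm (L p v)))"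
  unfolding prim_sum_def[abs_def] by (rule norm_powr_sum_joint_hol[OF primitive_sub])

lemma prim_sum_zeta_series:
  assumes "p \<in> P" "Re w > real CARD('n)"
  shows "(\<Sum>\<^sub>\<infinity>v\<in>lattice - {0}. of_real (norm (L p v)) powr (- w)) = zeta_series w * prim_sum (\<lambda>v. norm (L p v)) w"
  unfolding prim_sum_def
proof (rule sum_primitive)
  have "real CARD('n) \<ge> 1" by (simp add: Suc_leI)
  thus "Re w > 1" using assms by linarith
qed (use assms norm_powr_summable[OF order_refl] norm_hom in auto)

text \<open>The sum over primitive vectors is the quotient of the lattice sum by the zeta series. Writing both as quotients,
the numerator of the zeta series enters the denominator, which is again independent of the parameter.\<close>
theorem prim_sum_continuation:
  assumes b: "b \<le> real CARD('n)"
  shows "\<exists>D W. D holomorphic_on {w. Re w > b} \<and> (\<exists>w. Re w > b \<and> D w \<noteq> 0) \<and> joint_hol P {w. Re w > b} W \<and>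
    (\<forall>p\<in>P. \<forall>w. Re w > real CARD('n) \<longrightarrow> D w * prim_sum (\<lambda>v. norm (L p v)) w = W p w)"
proof -
  let ?n = "real CARD('n)"
  have n1: "?n \<ge> 1" by (simp add: Suc_leI)
  obtain D1 W1 where 1: "D1 holomorphic_on UNIV" "\<exists>w. D1 w \<noteq> 0" "joint_hol P {w. Re w > b} W1"
     "\<And>p w. p \<in> P \<Longrightarrow> Re w > ?n \<Longrightarrow> D1 w * (\<Sum>\<^sub>\<infinity>v\<in>lattice - {0}. of_real (norm (L p v)) powr (- w)) = W1 p w"
    using norm_powr_sum_continuation[of b] unfolding mero_family_def by blast
  obtain D2 W2 where 2: "D2 holomorphic_on UNIV" "\<exists>w. D2 w \<noteq> 0" "joint_hol {0::real} {w. Re w > b} W2"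
     "\<And>w. Re w > 1 \<Longrightarrow> D2 w * zeta_series w = W2 0 w"
    using zeta_series_mero_family[of b] unfolding mero_family_def by blast
  define x where "x = ?n + 1"
  \<comment> \<open>The zeros of \<open>D1 * D2\<close> and of the zeta series are isolated, so \<open>w0\<close> exists near \<open>x\<close>. There
  \<open>D1 * W2\<close>, the denominator to be used, is nonzero.\<close>
  obtain w0 where w0: "Re w0 > ?n" "D1 w0 * D2 w0 \<noteq> 0" "zeta_series w0 \<noteq> 0"
  proof -
    have h: "(\<lambda>w. D1 w * D2 w) holomorphic_on UNIV" using 1 2 by (intro holomorphic_intros)
    obtain a where "D1 a * D2 a \<noteq> 0" using entire_mult_nonzero[OF 1(1) 2(1)] 1(2) 2(2) by blast
    from holomorphic_nonzero_cosparse[OF h open_UNIV connected_UNIV UNIV_I this]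
    have "\<forall>\<^sub>F w in at (of_real x). D1 w * D2 w \<noteq> 0" by (simp add: eventually_cosparse_open_eq)
    moreover have "\<forall>\<^sub>\<approx>w\<in>{w. Re w > 1}. zeta_series w \<noteq> 0"
      by (rule holomorphic_nonzero_cosparse[OF zeta_series_holomorphic _ connected_halfspace_Re _ zeta_series_real[of 2]]) (auto simp: open_halfspace_Re_gt)
    hence "\<forall>\<^sub>F w in at (of_real x). zeta_series w \<noteq> 0" using n1 by (auto simp: eventually_cosparse_open_eq open_halfspace_Re_gt x_def)
    moreover have "\<forall>\<^sub>F w in at (of_real x). w \<in> {w. Re w > ?n}"
      by (rule eventually_at_in_open') (auto simp: open_halfspace_Re_gt x_def)
    ultimately have "\<forall>\<^sub>F w in at (complex_of_real x). Re w > ?n \<and> D1 w * D2 w \<noteq> 0 \<and> zeta_series w \<noteq> 0"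
      by eventually_elim auto
    from eventually_happens'[OF _ this] show thesis using that by auto
  qed
  have hW2: "W2 0 holomorphic_on {w. Re w > b}" using 2 by (simp add: joint_hol_def)
  show ?thesis
  proof (intro exI conjI ballI allI impI)
    show "(\<lambda>w. D1 w * W2 0 w) holomorphic_on {w. Re w > b}" using 1(1) hW2 by (auto intro!: holomorphic_intros intro: holomorphic_on_subset)
    show "Re w0 > b" using w0 b by simp
    show "D1 w0 * W2 0 w0 \<noteq> 0" using w0 2(4)[of w0] n1 by auto
    show "joint_hol P {w. Re w > b} (\<lambda>p w. D2 w * W1 p w)"
      using 1(3) 2(1) by (intro joint_hol_mult joint_hol_const_param) (auto intro: holomorphic_on_subset)
    fix p w assume p: "p \<in> P" "?n < Re w"
    show "D1 w * W2 0 w * prim_sum (\<lambda>v. norm (L p v)) w = D2 w * W1 p w"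
    proof -
      have "W2 0 w = D2 w * zeta_series w" using 2(4)[of w] n1 p(2) by simp
      moreover have "W1 p w = D1 w * (zeta_series w * prim_sum (\<lambda>v. norm (L p v)) w)"
        using 1(4)[OF p] unfolding prim_sum_zeta_series[OF p] by simp
      ultimately show ?thesis by (simp add: mult_ac)
    qed
  qed
qed

end

section \<open>Unfolding the integral over the unit cube\<close>

lemma borel_measurable_nn_sum:
  fixes f :: "'i \<Rightarrow> 'a \<Rightarrow> ennreal"
  assumes "countable I" and [measurable]: "\<And>i. i \<in> I \<Longrightarrow> f i \<in> borel_measurable M"
  shows "(\<lambda>x. \<integral>\<^sup>+i. f i x \<partial>count_space I) \<in> borel_measurable M"
proof cases
  assume "finite I" then show ?thesis
    by (simp add: nn_integral_count_space_finite)
next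
  assume "infinite I"
  then have ne: "I \<noteq> {}" by auto
  note * = bij_betw_from_nat_into[OF \<open>countable I\<close> \<open>infinite I\<close>]
  have e: "(\<integral>\<^sup>+i. g i \<partial>count_space I) = (\<Sum>n. g (from_nat_into I n))" for g :: "'i \<Rightarrow> ennreal"
    by (simp add: nn_integral_bij_count_space[symmetric, OF *] nn_integral_count_space_nat)
  show ?thesis unfolding e using ne by (intro borel_measurable_suminf_order assms from_nat_into)
qed

abbreviation int_sum :: "(int \<Rightarrow> ennreal) \<Rightarrow> ennreal" where
  "int_sum f \<equiv> \<integral>\<^sup>+b. f b \<partial>count_space UNIV"

lemma int_sum_measurable:
  "(\<And>b. (\<lambda>x. f b x) \<in> borel_measurable M) \<Longrightarrow> (\<lambda>x. int_sum (\<lambda>b. f b x)) \<in> borel_measurable M"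
  by (rule borel_measurable_nn_sum) auto

lemma int_sum_swap:
  "(\<And>b. f b \<in> borel_measurable M) \<Longrightarrow> (\<integral>\<^sup>+x. int_sum (\<lambda>b. f b x) \<partial>M) = int_sum (\<lambda>b. \<integral>\<^sup>+x. f b x \<partial>M)"
  by (rule nn_integral_count_space_nn_integral) auto

definition unit_ind :: "real \<Rightarrow> ennreal" where "unit_ind s = indicator {0..<1} s"

lemma unit_ind_measurable [measurable]: "unit_ind \<in> borel_measurable borel"
  unfolding unit_ind_def[abs_def] by measurable

lemma nn_integral_unit_ind: "(\<integral>\<^sup>+s. unit_ind s * c \<partial>lborel) = c"
  by (simp add: unit_ind_def mult.commute nn_integral_cmult_indicator)

text \<open>The numbers \<open>(y - b) / a\<close> fall into \<open>[0, 1)\<close> for exactly \<open>\<bar>a\<bar>\<close> consecutive integers \<open>b\<close>.\<close>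
lemma count_window:
  fixes a :: int and y :: real
  assumes "a \<noteq> 0"
  shows "int_sum (\<lambda>b. unit_ind ((y - of_int b) / of_int a)) = ennreal \<bar>of_int a\<bar>"
proof -
  define B where "B = {b::int. (y - of_int b) / of_int a \<in> {0..<1}}"
  have "int_sum (\<lambda>b. unit_ind ((y - of_int b) / of_int a)) = int_sum (\<lambda>b. indicator B b)"
    by (rule nn_integral_cong) (simp add: unit_ind_def B_def indicator_def)
  also have "\<dots> = emeasure (count_space UNIV) B" by simp
  also have "finite B \<and> card B = nat \<bar>a\<bar>"
  proof (cases "a > 0")
    case True
    have "B = {\<lfloor>y\<rfloor> - a + 1..\<lfloor>y\<rfloor>}"
    proof (intro equalityI subsetI)
      fix b assume "b \<in> B"
      hence "0 \<le> y - of_int b" "y - of_int b < of_int a" using True by (auto simp: B_def field_simps)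
      thus "b \<in> {\<lfloor>y\<rfloor> - a + 1..\<lfloor>y\<rfloor>}" by (auto simp: le_floor_iff) linarith
    next
      fix b assume "b \<in> {\<lfloor>y\<rfloor> - a + 1..\<lfloor>y\<rfloor>}"
      hence "0 \<le> y - of_int b" "y - of_int b < of_int a" by (auto simp: le_floor_iff) linarith
      thus "b \<in> B" using True by (auto simp: B_def field_simps)
    qed
    thus ?thesis using True by simp
  next
    case False
    hence a: "a < 0" using assms by simp
    have "B = {\<lceil>y\<rceil>..\<lceil>y\<rceil> - a - 1}"
    proof (intro equalityI subsetI)
      fix b assume "b \<in> B"
      hence "y - of_int b \<le> 0" "of_int a < y - of_int b" using a by (auto simp: B_def field_simps)
      thus "b \<in> {\<lceil>y\<rceil>..\<lceil>y\<rceil> - a - 1}" by (auto simp: ceiling_le_iff) linarith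
    next
      fix b assume "b \<in> {\<lceil>y\<rceil>..\<lceil>y\<rceil> - a - 1}"
      hence "y - of_int b \<le> 0" "of_int a < y - of_int b" by (auto simp: ceiling_le_iff) linarith
      thus "b \<in> B" using a by (auto simp: B_def field_simps)
    qed
    thus ?thesis using a by simp
  qed
  hence "emeasure (count_space UNIV) B = ennreal \<bar>of_int a\<bar>"
    by (simp add: ennreal_of_nat_eq_real_of_nat)
  finally show ?thesis .
qed

text \<open>Multiplication by a nonzero integer preserves Haar measure on the circle. Concretely, the windows
\<open>a [0, 1) + c + b\<close> cover each point of the line \<open>\<bar>a\<bar>\<close> times, which cancels the Jacobian.\<close>
lemma line_unfold:
  fixes a :: int and c :: real and h :: "real \<Rightarrow> ennreal"
  assumes a: "a \<noteq> 0" and [measurable]: "h \<in> borel_measurable borel"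
  shows "(\<integral>\<^sup>+s. unit_ind s * int_sum (\<lambda>b. h (of_int a * s + c + of_int b)) \<partial>lborel) = (\<integral>\<^sup>+x. h x \<partial>lborel)"
proof -
  let ?a = "ennreal \<bar>of_int a\<bar>"
  have "(\<integral>\<^sup>+s. unit_ind s * int_sum (\<lambda>b. h (of_int a * s + c + of_int b)) \<partial>lborel) = 
      (\<integral>\<^sup>+s. int_sum (\<lambda>b. unit_ind s * h (of_int a * s + c + of_int b)) \<partial>lborel)"
    by (simp add: nn_integral_cmult)
  also have "\<dots> = int_sum (\<lambda>b. \<integral>\<^sup>+s. unit_ind s * h (of_int a * s + c + of_int b) \<partial>lborel)"
    by (rule int_sum_swap) simp
  finally have 1: "?a * (\<integral>\<^sup>+s. unit_ind s * int_sum (\<lambda>b. h (of_int a * s + c + of_int b)) \<partial>lborel) =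
      int_sum (\<lambda>b. ?a * (\<integral>\<^sup>+s. unit_ind s * h (of_int a * s + c + of_int b) \<partial>lborel))"
    by (simp add: nn_integral_cmult)
  have 2: "?a * (\<integral>\<^sup>+s. unit_ind s * h (of_int a * s + c + of_int b) \<partial>lborel) = (\<integral>\<^sup>+x. unit_ind ((x - c - of_int b) / of_int a) * h x \<partial>lborel)" for b
    using a by (subst nn_integral_real_affine[of "\<lambda>x. unit_ind ((x - c - of_int b) / of_int a) * h x" "of_int a" "c + of_int b"])
       (simp_all add: algebra_simps)
  have "?a * (\<integral>\<^sup>+s. unit_ind s * int_sum (\<lambda>b. h (of_int a * s + c + of_int b)) \<partial>lborel) =
     (\<integral>\<^sup>+x. int_sum (\<lambda>b. unit_ind ((x - c - of_int b) / of_int a) * h x) \<partial>lborel)"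
    unfolding 1 2 by (rule int_sum_swap[symmetric]) simp
  also have "\<dots> = (\<integral>\<^sup>+x. ?a * h x \<partial>lborel)"
    by (simp add: nn_integral_multc count_window[OF a])
  also have "\<dots> = ?a * (\<integral>\<^sup>+x. h x \<partial>lborel)" by (rule nn_integral_cmult) simp
  finally show ?thesis using a by (simp add: ennreal_mult_cancel_left)
qed

text \<open>Here \<open>(s1, s2, s3)\<close> are the entries of a symmetric matrix \<open>S\<close>, and the arguments of \<open>H\<close> are the coordinates of
\<open>a S + b\<close>. If \<open>a1 \<noteq> 0\<close>, the variable \<open>s1\<close> unfolds the first coordinate and then \<open>s2\<close> the second; if \<open>a1 = 0\<close>, the
variables \<open>s2\<close> and \<open>s3\<close> do. The remaining variable integrates to \<open>1\<close>.\<close>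
lemma cube_unfold:
  fixes H :: "real \<Rightarrow> real \<Rightarrow> ennreal" and a1 a2 :: int
  assumes [measurable]: "(\<lambda>(x,y). H x y) \<in> borel_measurable (borel \<Otimes>\<^sub>M borel)"
    and a: "a1 \<noteq> 0 \<or> a2 \<noteq> 0"
  shows "(\<integral>\<^sup>+s3. unit_ind s3 * (\<integral>\<^sup>+s2. unit_ind s2 * (\<integral>\<^sup>+s1. unit_ind s1 * 
      int_sum (\<lambda>b2. int_sum (\<lambda>b1. H (of_int a1 * s1 + of_int a2 * s2 + of_int b1) (of_int a1 * s2 + of_int a2 * s3 + of_int b2))) \<partial>lborel) \<partial>lborel) \<partial>lborel)
     = (\<integral>\<^sup>+y. \<integral>\<^sup>+x. H x y \<partial>lborel \<partial>lborel)"
proof -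
  let ?B = "\<lambda>s1 s2 s3. int_sum (\<lambda>b2. int_sum (\<lambda>b1. H (of_int a1 * s1 + of_int a2 * s2 + of_int b1) (of_int a1 * s2 + of_int a2 * s3 + of_int b2)))"
  define h where "h = (\<lambda>y. \<integral>\<^sup>+x. H x y \<partial>lborel)"
  have [measurable]: "h \<in> borel_measurable borel"
    unfolding h_def by measurable
  have Hm: "(\<lambda>s. H (f s) (g s)) \<in> borel_measurable lborel" if [measurable]: "f \<in> borel_measurable borel" "g \<in> borel_measurable borel" for f g
    by measurable
  show ?thesis
  proof (cases "a1 = 0")
    case False
    have "(\<integral>\<^sup>+s1. unit_ind s1 * ?B s1 s2 s3 \<partial>lborel)
       = int_sum (\<lambda>b2. h (of_int a1 * s2 + of_int a2 * s3 + of_int b2))" for s2 s3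
    proof -
      have "(\<integral>\<^sup>+s1. unit_ind s1 * ?B s1 s2 s3 \<partial>lborel) =
        (\<integral>\<^sup>+s1. int_sum (\<lambda>b2. unit_ind s1 * int_sum (\<lambda>b1. H (of_int a1 * s1 + of_int a2 * s2 + of_int b1) (of_int a1 * s2 + of_int a2 * s3 + of_int b2))) \<partial>lborel)"
        by (simp add: nn_integral_cmult)
      also have "\<dots> = int_sum (\<lambda>b2. \<integral>\<^sup>+s1. unit_ind s1 * int_sum (\<lambda>b1. H (of_int a1 * s1 + of_int a2 * s2 + of_int b1) (of_int a1 * s2 + of_int a2 * s3 + of_int b2)) \<partial>lborel)"
        by (rule int_sum_swap) (intro borel_measurable_times_ennreal int_sum_measurable Hm, measurable)
      also have "\<dots> = int_sum (\<lambda>b2. h (of_int a1 * s2 + of_int a2 * s3 + of_int b2))"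
        unfolding h_def by (intro nn_integral_cong line_unfold[OF False, of "\<lambda>x. H x _"]) measurable
      finally show ?thesis .
    qed
    hence E: "?thesis \<longleftrightarrow> (\<integral>\<^sup>+s3. unit_ind s3 * (\<integral>\<^sup>+s2. unit_ind s2 * int_sum (\<lambda>b2. h (of_int a1 * s2 + of_int a2 * s3 + of_int b2)) \<partial>lborel) \<partial>lborel) = (\<integral>\<^sup>+y. h y \<partial>lborel)"
      by (simp add: h_def)
    show ?thesis unfolding E by (subst line_unfold[OF False]) (simp_all add: nn_integral_unit_ind)
  next
    case True
    hence a2: "a2 \<noteq> 0" using a by simp
    have "(\<integral>\<^sup>+s2. unit_ind s2 * (\<integral>\<^sup>+s1. unit_ind s1 * ?B s1 s2 s3 \<partial>lborel) \<partial>lborel)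
       = int_sum (\<lambda>b2. h (of_int a2 * s3 + 0 + of_int b2))" for s3
    proof -
      have "(\<integral>\<^sup>+s2. unit_ind s2 * (\<integral>\<^sup>+s1. unit_ind s1 * ?B s1 s2 s3 \<partial>lborel) \<partial>lborel) =
        (\<integral>\<^sup>+s2. int_sum (\<lambda>b2. unit_ind s2 * int_sum (\<lambda>b1. H (of_int a2 * s2 + 0 + of_int b1) (of_int a2 * s3 + of_int b2))) \<partial>lborel)"
        unfolding True by (simp add: nn_integral_unit_ind nn_integral_cmult)
      also have "\<dots> = int_sum (\<lambda>b2. \<integral>\<^sup>+s2. unit_ind s2 * int_sum (\<lambda>b1. H (of_int a2 * s2 + 0 + of_int b1) (of_int a2 * s3 + of_int b2)) \<partial>lborel)"
        by (rule int_sum_swap) (intro borel_measurable_times_ennreal int_sum_measurable Hm, measurable)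
      also have "\<dots> = int_sum (\<lambda>b2. h (of_int a2 * s3 + of_int b2))"
        unfolding h_def by (intro nn_integral_cong line_unfold[OF a2, of "\<lambda>x. H x _"]) measurable
      finally show ?thesis by simp
    qed
    hence E: "?thesis \<longleftrightarrow> (\<integral>\<^sup>+s3. unit_ind s3 * int_sum (\<lambda>b2. h (of_int a2 * s3 + 0 + of_int b2)) \<partial>lborel) = (\<integral>\<^sup>+y. h y \<partial>lborel)"
      by (simp add: h_def)
    show ?thesis unfolding E by (subst line_unfold[OF a2]) simp_all
  qed
qed

lemma vector3_measurable: "(\<lambda>(z,y,x). vector [x,y,z] :: real^3) \<in> borel_measurable borel"
proof (rule borel_measurable_continuous_onI)
  have "(\<lambda>(z,y,x). vector [x,y,z] :: real^3) = (\<lambda>p. \<chi> i. if i = 1 then snd (snd p) else if i = 2 then fst (snd p) else fst p)"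
    by (auto simp: vec_eq_iff forall_3)
  moreover have "continuous_on UNIV (\<lambda>p::real\<times>real\<times>real. if (i::3) = 1 then snd (snd p) else if i = 2 then fst (snd p) else fst p)" for i
    by (cases "i = 1"; cases "i = 2") (auto intro!: continuous_intros)
  ultimately show "continuous_on UNIV (\<lambda>(z,y,x). vector [x,y,z] :: real^3)"
    by (simp add: continuous_on_vec_lambda)
qed

text \<open>Lebesgue measure is determined by its values on boxes. The order of the factors makes the first coordinate the innermost variable of integration.\<close>
lemma lborel_real3: "lborel = distr (lborel :: (real \<times> real \<times> real) measure) borel (\<lambda>(z,y,x). vector [x,y,z] :: real^3)"
proof (rule lborel_eqI)
  note m = vector3_measurable
  fix l u :: "real^3" assume le: "\<And>b. b \<in> Basis \<Longrightarrow> l \<bullet> b \<le> u \<bullet> b"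
  have le': "l$i \<le> u$i" for i using le[of "axis i 1"] by (simp add: cart_eq_inner_axis axis_in_Basis_iff)
  have "(\<lambda>(z,y,x). vector [x,y,z] :: real^3) -` box l u = box (l$3) (u$3) \<times> (box (l$2) (u$2) \<times> box (l$1) (u$1))"
    by (auto simp: mem_box_cart forall_3)
  hence "emeasure (distr (lborel :: (real \<times> real \<times> real) measure) borel (\<lambda>(z,y,x). vector [x,y,z] :: real^3)) (box l u) = 
     emeasure lborel (box (l$3) (u$3) \<times> (box (l$2) (u$2) \<times> box (l$1) (u$1)))"
    using m by (subst emeasure_distr) auto
  also have "\<dots> = emeasure (lborel \<Otimes>\<^sub>M (lborel :: (real \<times> real) measure)) (box (l$3) (u$3) \<times> (box (l$2) (u$2) \<times> box (l$1) (u$1)))"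
    by (simp add: lborel_prod)
  also have "\<dots> = emeasure lborel (box (l$3) (u$3)) * emeasure lborel (box (l$2) (u$2) \<times> box (l$1) (u$1))"
    by (rule lborel.emeasure_pair_measure_Times) (auto simp: open_Times)
  also have "emeasure lborel (box (l$2) (u$2) \<times> box (l$1) (u$1)) = emeasure (lborel \<Otimes>\<^sub>M (lborel :: real measure)) (box (l$2) (u$2) \<times> box (l$1) (u$1))"
    by (simp add: lborel_prod)
  also have "\<dots> = emeasure lborel (box (l$2) (u$2)) * emeasure lborel (box (l$1) (u$1))"
    by (rule lborel.emeasure_pair_measure_Times) auto
  also have "emeasure lborel (box (l$3) (u$3)) * (emeasure lborel (box (l$2) (u$2)) * emeasure lborel (box (l$1) (u$1))) = ennreal ((u$3 - l$3) * ((u$2 - l$2) * (u$1 - l$1)))"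
    using le' by (simp add: ennreal_mult)
  also have "(u$3 - l$3) * ((u$2 - l$2) * (u$1 - l$1)) = (\<Prod>b\<in>Basis. (u - l) \<bullet> b)"
  proof -
    have "(\<Prod>b\<in>(Basis :: (real^3) set). (u - l) \<bullet> b) = (\<Prod>i\<in>UNIV. (u - l)$i)"
      by (simp add: Basis_vec_def cart_eq_inner_axis axis_eq_axis prod.UNION_disjoint)
    also have "\<dots> = (u - l)$1 * ((u - l)$2 * (u - l)$3)"
      unfolding UNIV_3 by (simp add: mult.assoc)
    finally show ?thesis by (simp only: vector_minus_component mult.commute mult.left_commute)
  qed
  finally show "emeasure (distr (lborel :: (real \<times> real \<times> real) measure) borel (\<lambda>(z,y,x). vector [x,y,z] :: real^3)) (box l u) = (\<Prod>b\<in>Basis. (u - l) \<bullet> b)" .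
qed simp

lemma nn_integral_real3:
  fixes f :: "real^3 \<Rightarrow> ennreal"
  assumes [measurable]: "f \<in> borel_measurable borel"
  shows "(\<integral>\<^sup>+S. f S \<partial>lborel) = (\<integral>\<^sup>+z. \<integral>\<^sup>+y. \<integral>\<^sup>+x. f (vector [x,y,z]) \<partial>lborel \<partial>lborel \<partial>lborel)"
proof -
  note m = vector3_measurable
  define F where "F = (\<lambda>p. f ((\<lambda>(z,y,x). vector [x,y,z]) p))"
  have F [measurable]: "F \<in> borel_measurable (borel :: (real \<times> real \<times> real) measure)"
    unfolding F_def using measurable_compose[OF m assms] by simp
  have "(\<integral>\<^sup>+S. f S \<partial>lborel) = (\<integral>\<^sup>+p. F p \<partial>lborel)"
    unfolding F_def by (subst lborel_real3) (subst nn_integral_distr, use m in auto)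
  also have "\<dots> = (\<integral>\<^sup>+p. F p \<partial>(lborel \<Otimes>\<^sub>M lborel))" by (simp add: lborel_prod)
  also have "\<dots> = (\<integral>\<^sup>+z. \<integral>\<^sup>+q. F (z, q) \<partial>lborel \<partial>lborel)"
    by (rule lborel.nn_integral_fst[symmetric]) (simp add: lborel_prod)
  also have "\<dots> = (\<integral>\<^sup>+z. \<integral>\<^sup>+q. F (z, q) \<partial>(lborel \<Otimes>\<^sub>M lborel) \<partial>lborel)" by (simp add: lborel_prod)
  also have "\<dots> = (\<integral>\<^sup>+z. \<integral>\<^sup>+y. \<integral>\<^sup>+x. F (z, y, x) \<partial>lborel \<partial>lborel \<partial>lborel)"
  proof (rule nn_integral_cong, rule lborel.nn_integral_fst[symmetric])
    fix z :: real
    have "(\<lambda>q. F (z, q)) \<in> borel_measurable borel"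
      by (rule measurable_compose[OF _ F]) (auto intro!: borel_measurable_continuous_onI continuous_intros)
    thus "(\<lambda>q. F (z, q)) \<in> borel_measurable (lborel \<Otimes>\<^sub>M lborel)" by (simp add: lborel_prod)
  qed
  finally show ?thesis by (simp add: F_def)
qed

section \<open>The integral of a power of a quadratic form over the plane\<close>

lemma powr_layer_cake:
  assumes A: "A > 0" and t: "\<tau> > 0"
  shows "ennreal (A powr (- \<tau>)) = (\<integral>\<^sup>+u. ennreal (\<tau> * u powr (- \<tau> - 1)) * indicator {A..} u \<partial>lborel)"
proof -
  have "(\<integral>\<^sup>+u. ennreal (\<tau> * u powr (- \<tau> - 1)) * indicator {A..} u \<partial>lborel) = ennreal (0 - (- (A powr (- \<tau>))))"
  proof (rule nn_integral_FTC_atLeast)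
    fix u assume "A \<le> u"
    hence "u > 0" using A by simp
    thus "DERIV (\<lambda>u. - (u powr (- \<tau>))) u :> \<tau> * u powr (- \<tau> - 1)"
      by (auto intro!: derivative_eq_intros)
    show "0 \<le> \<tau> * u powr (- \<tau> - 1)" using t by simp
  next
    have "((\<lambda>u. u powr (- \<tau>)) \<longlongrightarrow> 0) at_top" by (rule tendsto_neg_powr) (use t in \<open>auto simp: filterlim_ident\<close>)
    from tendsto_minus[OF this] show "((\<lambda>u. - (u powr (- \<tau>))) \<longlongrightarrow> 0) at_top" by simp
  qed measurable
  thus ?thesis by simp
qed

text \<open>A disc of radius \<open>sqrt (u - M)\<close>, empty for \<open>u < M\<close>.\<close>
lemma emeasure_disc:
  "emeasure lborel {p::real\<times>real. M + (snd p)\<^sup>2 + (fst p)\<^sup>2 \<le> u} = ennreal (pi * (u - M)) * indicator {M..} u"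
proof (cases "u \<ge> M")
  case True
  have "{p::real\<times>real. M + (snd p)\<^sup>2 + (fst p)\<^sup>2 \<le> u} = cball 0 (sqrt (u - M))"
  proof (intro set_eqI)
    fix p :: "real \<times> real"
    have "p \<in> cball 0 (sqrt (u - M)) \<longleftrightarrow> norm p \<le> sqrt (u - M)" by simp
    also have "\<dots> \<longleftrightarrow> (fst p)\<^sup>2 + (snd p)\<^sup>2 \<le> u - M" by (cases p) (simp add: norm_Pair)
    finally show "p \<in> {p::real\<times>real. M + (snd p)\<^sup>2 + (fst p)\<^sup>2 \<le> u} \<longleftrightarrow> p \<in> cball 0 (sqrt (u - M))" by auto
  qed
  also have "emeasure lborel (cball (0::real\<times>real) (sqrt (u - M))) = ennreal (unit_ball_vol (real DIM(real\<times>real)) * sqrt (u - M) ^ DIM(real\<times>real))"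
    by (rule emeasure_cball) (use True in auto)
  also have "\<dots> = ennreal (pi * (u - M))" using True by (simp add: unit_ball_vol_2)
  finally show ?thesis using True by simp
next
  case False
  have "M + (snd p)\<^sup>2 + (fst p)\<^sup>2 > u" for p :: "real \<times> real"
    using False zero_le_power2[of "fst p"] zero_le_power2[of "snd p"] by linarith
  hence "{p::real\<times>real. M + (snd p)\<^sup>2 + (fst p)\<^sup>2 \<le> u} = {}" by (auto simp: not_le[symmetric])
  thus ?thesis using False by simp
qed

text \<open>Write the integrand as an integral of \<open>\<tau> u powr (- \<tau> - 1)\<close> over \<open>u \<ge> M + x\<^sup>2 + y\<^sup>2\<close> and integrate over the plane
first: for given \<open>u\<close> the area of the disc is \<open>\<pi> (u - M)\<close>, and an elementary integral remains.\<close>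
theorem plane_integral:
  fixes M \<tau> :: real
  assumes M: "M > 0" and t: "\<tau> > 1"
  shows "(\<integral>\<^sup>+y. \<integral>\<^sup>+x. ennreal ((M + x\<^sup>2 + y\<^sup>2) powr (- \<tau>)) \<partial>lborel \<partial>lborel) = ennreal (pi / (\<tau> - 1) * M powr (1 - \<tau>))"
proof -
  define g where "g = (\<lambda>u. ennreal (\<tau> * u powr (- \<tau> - 1)))"
  have [measurable]: "g \<in> borel_measurable borel" unfolding g_def by measurable
  define S where "S = {q :: (real \<times> real) \<times> real. M + (snd (fst q))\<^sup>2 + (fst (fst q))\<^sup>2 \<le> snd q}"
  have "closed S" unfolding S_def by (intro closed_Collect_le continuous_intros)
  hence S [measurable]: "S \<in> sets borel" by simp
  hence S' [measurable]: "S \<in> sets (lborel \<Otimes>\<^sub>M lborel)" unfolding lborel_prod using S by simp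
  have "(\<integral>\<^sup>+y. \<integral>\<^sup>+x. ennreal ((M + x\<^sup>2 + y\<^sup>2) powr (- \<tau>)) \<partial>lborel \<partial>lborel) =
     (\<integral>\<^sup>+p. ennreal ((M + (snd p)\<^sup>2 + (fst p)\<^sup>2) powr (- \<tau>)) \<partial>(lborel \<Otimes>\<^sub>M lborel))"
    by (subst lborel.nn_integral_fst[symmetric]) auto
  also have "\<dots> = (\<integral>\<^sup>+p. ennreal ((M + (snd p)\<^sup>2 + (fst p)\<^sup>2) powr (- \<tau>)) \<partial>lborel)" by (simp add: lborel_prod)
  also have "\<dots> = (\<integral>\<^sup>+p. \<integral>\<^sup>+u. g u * indicator S (p, u) \<partial>lborel \<partial>lborel)"
  proof (rule nn_integral_cong)
    fix p :: "real \<times> real"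
    have A: "M + (snd p)\<^sup>2 + (fst p)\<^sup>2 > 0" using M zero_le_power2[of "fst p"] zero_le_power2[of "snd p"] by linarith
    have "ennreal ((M + (snd p)\<^sup>2 + (fst p)\<^sup>2) powr (- \<tau>)) = (\<integral>\<^sup>+u. g u * indicator {M + (snd p)\<^sup>2 + (fst p)\<^sup>2..} u \<partial>lborel)"
      unfolding g_def by (rule powr_layer_cake[OF A]) (use t in simp)
    thus "ennreal ((M + (snd p)\<^sup>2 + (fst p)\<^sup>2) powr (- \<tau>)) = (\<integral>\<^sup>+u. g u * indicator S (p, u) \<partial>lborel)"
      by (simp add: S_def indicator_def)
  qed
  also have "\<dots> = (\<integral>\<^sup>+u. \<integral>\<^sup>+p. g u * indicator S (p, u) \<partial>lborel \<partial>lborel)"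
  proof -
    have "(\<lambda>q. g (snd q) * indicator S q) \<in> borel_measurable (lborel \<Otimes>\<^sub>M lborel)" by measurable
    from lborel_pair.Fubini[OF this] show ?thesis by simp
  qed
  also have "\<dots> = (\<integral>\<^sup>+u. ennreal (\<tau> * u powr (- \<tau> - 1) * (pi * (u - M))) * indicator {M..} u \<partial>lborel)"
  proof (rule nn_integral_cong)
    fix u :: real
    have ss: "{p. (p, u) \<in> S} \<in> sets (lborel :: (real \<times> real) measure)"
    proof -
      have "closed {p :: real \<times> real. M + (snd p)\<^sup>2 + (fst p)\<^sup>2 \<le> u}" by (intro closed_Collect_le continuous_intros)
      thus ?thesis by (simp add: S_def)
    qed
    have "(\<integral>\<^sup>+p. g u * indicator S (p, u) \<partial>lborel) = (\<integral>\<^sup>+p. g u * indicator {p. (p, u) \<in> S} p \<partial>lborel)"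
      by (simp add: indicator_def)
    also have "\<dots> = g u * emeasure lborel {p. (p, u) \<in> S}" by (rule nn_integral_cmult_indicator[OF ss])
    also have "{p. (p, u) \<in> S} = {p. M + (snd p)\<^sup>2 + (fst p)\<^sup>2 \<le> u}" by (simp add: S_def)
    also have "g u * emeasure lborel {p :: real \<times> real. M + (snd p)\<^sup>2 + (fst p)\<^sup>2 \<le> u} = ennreal (\<tau> * u powr (- \<tau> - 1) * (pi * (u - M))) * indicator {M..} u"
      unfolding emeasure_disc g_def using t by (cases "u \<ge> M") (simp_all add: ennreal_mult)
    finally show "(\<integral>\<^sup>+p. g u * indicator S (p, u) \<partial>lborel) = ennreal (\<tau> * u powr (- \<tau> - 1) * (pi * (u - M))) * indicator {M..} u" .
  qed
  also have "\<dots> = ennreal (0 - pi * (- (\<tau> / (\<tau> - 1)) * M powr (1 - \<tau>) + M * M powr (- \<tau>)))"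
  proof (rule nn_integral_FTC_atLeast[where F = "\<lambda>u. pi * (- (\<tau> / (\<tau> - 1)) * u powr (1 - \<tau>) + M * u powr (- \<tau>))"])
    fix u assume u: "M \<le> u"
    hence u0: "u > 0" using M by simp
    have e: "u powr (- \<tau>) = u * u powr (- \<tau> - 1)" using u0 powr_add[of u "- \<tau> - 1" 1] by simp
    have "DERIV (\<lambda>u. pi * (- (\<tau> / (\<tau> - 1)) * u powr (1 - \<tau>) + M * u powr (- \<tau>))) u :>
       pi * (- (\<tau> / (\<tau> - 1)) * ((1 - \<tau>) * u powr (1 - \<tau> - 1)) + M * ((- \<tau>) * u powr (- \<tau> - 1)))"
      using u0 t by (auto intro!: derivative_eq_intros)
    also have "- (\<tau> / (\<tau> - 1)) * ((1 - \<tau>) * u powr (1 - \<tau> - 1)) = \<tau> * u powr (- \<tau>)" using t by (simp add: field_simps)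
    also have "pi * (\<tau> * u powr (- \<tau>) + M * ((- \<tau>) * u powr (- \<tau> - 1))) = \<tau> * u powr (- \<tau> - 1) * (pi * (u - M))"
      unfolding e by (simp add: algebra_simps)
    finally show "DERIV (\<lambda>u. pi * (- (\<tau> / (\<tau> - 1)) * u powr (1 - \<tau>) + M * u powr (- \<tau>))) u :> \<tau> * u powr (- \<tau> - 1) * (pi * (u - M))" .
    show "0 \<le> \<tau> * u powr (- \<tau> - 1) * (pi * (u - M))" using u t by simp
  next
    have 1: "((\<lambda>u. u powr (- \<tau>)) \<longlongrightarrow> 0) at_top" by (rule tendsto_neg_powr) (use t in \<open>auto simp: filterlim_ident\<close>)
    have 2: "((\<lambda>u. u powr (1 - \<tau>)) \<longlongrightarrow> 0) at_top" by (rule tendsto_neg_powr) (use t in \<open>auto simp: filterlim_ident\<close>)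
    have "((\<lambda>u. pi * (- (\<tau> / (\<tau> - 1)) * u powr (1 - \<tau>) + M * u powr (- \<tau>))) \<longlongrightarrow> pi * (- (\<tau> / (\<tau> - 1)) * 0 + M * 0)) at_top"
      by (intro tendsto_intros 1 2)
    thus "((\<lambda>u. pi * (- (\<tau> / (\<tau> - 1)) * u powr (1 - \<tau>) + M * u powr (- \<tau>))) \<longlongrightarrow> 0) at_top" by simp
  qed measurable
  also have "0 - pi * (- (\<tau> / (\<tau> - 1)) * M powr (1 - \<tau>) + M * M powr (- \<tau>)) = pi / (\<tau> - 1) * M powr (1 - \<tau>)"
  proof -
    have "M * M powr (- \<tau>) = M powr (1 - \<tau>)" using M powr_add[of M 1 "-\<tau>"] by simp
    thus ?thesis using t by (simp only:) (simp add: field_simps)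
  qed
  finally show ?thesis .
qed

lemma plane_integral_affine:
  fixes M \<tau> n c1 c2 y1 y2 :: real
  assumes M: "M > 0" and t: "\<tau> > 1" and y: "y1 > 0" "y2 > 0"
  shows "(\<integral>\<^sup>+y. \<integral>\<^sup>+x. ennreal ((M + ((x - n * y + c1) / y1)\<^sup>2 + ((y + c2) / y2)\<^sup>2) powr (- \<tau>)) \<partial>lborel \<partial>lborel) = 
    ennreal (y1 * y2 * (pi / (\<tau> - 1)) * M powr (1 - \<tau>))"
proof -
  have "(\<integral>\<^sup>+x. ennreal ((M + ((x - n * y + c1) / y1)\<^sup>2 + ((y + c2) / y2)\<^sup>2) powr (- \<tau>)) \<partial>lborel) =
     ennreal y1 * (\<integral>\<^sup>+x. ennreal ((M + x\<^sup>2 + ((y + c2) / y2)\<^sup>2) powr (- \<tau>)) \<partial>lborel)" for y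
    using y by (subst nn_integral_real_affine[where c = y1 and t = "n * y - c1"]) auto
  hence "(\<integral>\<^sup>+y. \<integral>\<^sup>+x. ennreal ((M + ((x - n * y + c1) / y1)\<^sup>2 + ((y + c2) / y2)\<^sup>2) powr (- \<tau>)) \<partial>lborel \<partial>lborel) =
     (\<integral>\<^sup>+y. ennreal y1 * (\<integral>\<^sup>+x. ennreal ((M + x\<^sup>2 + ((y + c2) / y2)\<^sup>2) powr (- \<tau>)) \<partial>lborel) \<partial>lborel)"
    by simp
  also have "\<dots> = ennreal y1 * (\<integral>\<^sup>+y. (\<integral>\<^sup>+x. ennreal ((M + x\<^sup>2 + ((y + c2) / y2)\<^sup>2) powr (- \<tau>)) \<partial>lborel) \<partial>lborel)"
    by (rule nn_integral_cmult) measurable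
  also have "(\<integral>\<^sup>+y. (\<integral>\<^sup>+x. ennreal ((M + x\<^sup>2 + ((y + c2) / y2)\<^sup>2) powr (- \<tau>)) \<partial>lborel) \<partial>lborel) =
     ennreal y2 * (\<integral>\<^sup>+y. (\<integral>\<^sup>+x. ennreal ((M + x\<^sup>2 + y\<^sup>2) powr (- \<tau>)) \<partial>lborel) \<partial>lborel)"
    using y by (subst nn_integral_real_affine[where c = y2 and t = "- c2"]) auto
  also have "\<dots> = ennreal y2 * ennreal (pi / (\<tau> - 1) * M powr (1 - \<tau>))"
    by (simp only: plane_integral[OF M t])
  also have "ennreal y1 * \<dots> = ennreal (y1 * y2 * (pi / (\<tau> - 1)) * M powr (1 - \<tau>))"
    using y t by (simp add: ennreal_mult[symmetric] mult_ac)
  finally show ?thesis .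
qed

section \<open>The constant term of the lattice sum\<close>

lemma square_powr: "(x::real) \<ge> 0 \<Longrightarrow> (x\<^sup>2) powr t = x powr (2 * t)"
  by (cases "x = 0") (simp_all add: powr_powr flip: powr_numeral)

lemma n_alpha_row:
  "x v* n_alpha S = vector [x$1, x$2, x$1 * S$1 + x$2 * S$2 + x$3, x$1 * S$2 + x$2 * S$3 + x$4]"
  unfolding vec4_eq_iff vector_matrix_mult_def
  by (simp add: sum_4 n_alpha_def blocks_def mat_def algebra_simps)

lemma bij_lattice4:
  "bij_betw (\<lambda>((a1,a2),(b2,b1)). vector [of_int a1, of_int a2, of_int b1, of_int b2] :: real^4) UNIV lattice"
  unfolding bij_betw_def
proof
  show "inj (\<lambda>((a1,a2),(b2,b1)). vector [of_int a1, of_int a2, of_int b1, of_int b2] :: real^4)"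
    by (rule injI) (auto simp: vec4_eq_iff)
  show "range (\<lambda>((a1,a2),(b2,b1)). vector [of_int a1, of_int a2, of_int b1, of_int b2] :: real^4) = lattice"
  proof (intro equalityI subsetI)
    fix v :: "real^4" assume "v \<in> lattice"
    then obtain f where "v = (\<chi> i. real_of_int (f i))" by (rule lattice_vec)
    hence "v = (\<lambda>((a1,a2),(b2,b1)). vector [of_int a1, of_int a2, of_int b1, of_int b2]) ((f 1, f 2), (f 4, f 3))"
      by (simp add: vec4_eq_iff)
    thus "v \<in> range (\<lambda>((a1,a2),(b2,b1)). vector [of_int a1, of_int a2, of_int b1, of_int b2] :: real^4)" by blast
  qed (auto simp: lattice_def forall_4)
qed

lemma bij_lattice2:
  assumes "e = 1 \<or> e = -1"
  shows "bij_betw (\<lambda>(c,d). vector [of_int (e * c), of_int d] :: real^2) UNIV lattice"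
  unfolding bij_betw_def
proof
  show "inj (\<lambda>(c,d). vector [of_int (e * c), of_int d] :: real^2)"
    using assms by (intro injI) (auto simp: vec_eq_iff forall_2)
  show "range (\<lambda>(c,d). vector [of_int (e * c), of_int d] :: real^2) = lattice"
  proof (intro equalityI subsetI)
    fix v :: "real^2" assume "v \<in> lattice"
    then obtain f where "v = (\<chi> i. real_of_int (f i))" by (rule lattice_vec)
    hence "v = (\<lambda>(c,d). vector [of_int (e * c), of_int d]) (e * f 1, f 2)"
      using assms by (auto simp: vec_eq_iff forall_2)
    thus "v \<in> range (\<lambda>(c,d). vector [of_int (e * c), of_int d] :: real^2)" by blast
  qed (auto simp: lattice_def forall_2)
qed

lemma int_sum_pair: "int_sum (\<lambda>a. int_sum (\<lambda>b. f (a, b))) = (\<integral>\<^sup>+p. f p \<partial>count_space UNIV)"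
  by (rule nn_integral_fst_count_space)

lemma lattice4_sum:
  fixes f :: "real^4 \<Rightarrow> ennreal"
  shows "(\<integral>\<^sup>+v. f v \<partial>count_space lattice) = 
    (\<integral>\<^sup>+a. int_sum (\<lambda>b2. int_sum (\<lambda>b1. f (vector [of_int (fst a), of_int (snd a), of_int b1, of_int b2]))) \<partial>count_space UNIV)"
proof -
  have "(\<integral>\<^sup>+v. f v \<partial>count_space lattice) = (\<integral>\<^sup>+p. f ((\<lambda>((a1,a2),(b2,b1)). vector [of_int a1, of_int a2, of_int b1, of_int b2]) p) \<partial>count_space UNIV)"
    by (rule nn_integral_bij_count_space[OF bij_lattice4, symmetric])
  also have "\<dots> = (\<integral>\<^sup>+a. \<integral>\<^sup>+b. f ((\<lambda>((a1,a2),(b2,b1)). vector [of_int a1, of_int a2, of_int b1, of_int b2]) (a, b)) \<partial>count_space UNIV \<partial>count_space UNIV)"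
    by (rule nn_integral_fst_count_space[symmetric])
  also have "\<dots> = (\<integral>\<^sup>+a. int_sum (\<lambda>b2. int_sum (\<lambda>b1. f (vector [of_int (fst a), of_int (snd a), of_int b1, of_int b2]))) \<partial>count_space UNIV)"
    by (rule nn_integral_cong) (subst int_sum_pair[symmetric], simp add: case_prod_unfold)
  finally show ?thesis .
qed

lemma lattice2_sum:
  fixes f :: "real^2 \<Rightarrow> ennreal"
  assumes "e = 1 \<or> e = -1"
  shows "(\<integral>\<^sup>+v. f v \<partial>count_space lattice) = 
    (\<integral>\<^sup>+a. f (vector [of_int (e * fst a), of_int (snd a)]) \<partial>count_space UNIV)"
  using nn_integral_bij_count_space[OF bij_lattice2[OF assms], of f, symmetric] by (simp add: case_prod_unfold)

text \<open>The vector \<open>0\<close> is not excluded explicitly: \<open>0 powr x = 0\<close>, so it contributes nothing. The same convention is used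
for the other sums over full lattices with values in the extended nonnegative reals.\<close>
definition planar_sum :: "complex \<Rightarrow> real \<Rightarrow> ennreal" where
  "planar_sum z s = (\<integral>\<^sup>+v. ennreal (cmod (of_real (v$1) * z + of_real (v$2)) powr (- s)) \<partial>count_space (lattice :: (real^2) set))"

definition unit_cube :: "(real^3) set" where "unit_cube = {s. \<forall>i. 0 \<le> s$i \<and> s$i < 1}"

lemma indicator_unit_cube: "indicator unit_cube (vector [x,y,z] :: real^3) = unit_ind x * unit_ind y * unit_ind z"
  by (auto simp: unit_cube_def unit_ind_def indicator_def forall_3)

lemma unit_cube_sets [measurable]: "unit_cube \<in> sets borel"
  unfolding unit_cube_def by measurable

text \<open>Sum over \<open>a\<close> outside. For \<open>a = 0\<close> the summand is constant on the cube; for \<open>a \<noteq> 0\<close> it unfolds to the plane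
integral with \<open>M = m a\<close>, the square of the part of the length that does not depend on \<open>S\<close> and \<open>b\<close>. Both \<open>m a\<close>
and the form for \<open>a = 0\<close> are multiples of \<open>\<bar>c z + d\<bar>\<^sup>2\<close>, with \<open>(c, d) = (- a\<^sub>1, a\<^sub>2)\<close> and \<open>(c, d) = (b\<^sub>2, b\<^sub>1)\<close>.
Values are extended nonnegative reals, so interchanging sums and integrals is free.\<close>
theorem cube_lattice_sum:
  fixes s n1 n2 n3 n4 n5 y1 y2 :: real
  assumes g: "is_iwasawa g n1 n2 n3 n4 n5 y1 y2" and s: "s > 2"
  defines "z \<equiv> Complex (- n1) (y1 / y2)"
  shows "(\<integral>\<^sup>+S. indicator unit_cube S * (\<integral>\<^sup>+v. ennreal (norm (v v* (n_alpha S ** g)) powr (- s)) \<partial>count_space lattice) \<partial>lborel)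
   = ennreal (y1 powr s) * planar_sum z s + ennreal (y1 * y2 * (pi / (s / 2 - 1)) * y2 powr (2 - s)) * planar_sum z (s - 2)"
proof -
  have y: "y1 > 0" "y2 > 0" using g by (auto simp: is_iwasawa_def)
  define m where "m = (\<lambda>a::int\<times>int. (of_int (fst a) * y1)\<^sup>2 + ((of_int (fst a) * n1 + of_int (snd a)) * y2)\<^sup>2)"
  define c1 where "c1 = (\<lambda>a::int\<times>int. of_int (fst a) * n2 + of_int (snd a) * n4)"
  define c2 where "c2 = (\<lambda>a::int\<times>int. of_int (fst a) * n3 + of_int (snd a) * n5)"
  define H where "H = (\<lambda>a x y. ennreal ((m a + ((x - n1 * y + c1 a) / y1)\<^sup>2 + ((y + c2 a) / y2)\<^sup>2) powr (- (s / 2))))"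
  have Hm: "(\<lambda>(x,y). H a x y) \<in> borel_measurable (borel \<Otimes>\<^sub>M borel)" for a
    unfolding H_def by measurable
  have Hm': "(\<lambda>t. H a (f t) (h t)) \<in> borel_measurable M" if [measurable]: "f \<in> borel_measurable M" "h \<in> borel_measurable M" for a f h M
    unfolding H_def by measurable
  have term_eq: "ennreal (norm ((vector [of_int (fst a), of_int (snd a), of_int b1, of_int b2] :: real^4) v* (n_alpha S ** g)) powr (- s)) = 
     H a (of_int (fst a) * S$1 + of_int (snd a) * S$2 + of_int b1) (of_int (fst a) * S$2 + of_int (snd a) * S$3 + of_int b2)" for a b1 b2 S
  proof -
    let ?v = "vector [of_int (fst a), of_int (snd a), of_int b1, of_int b2] :: real^4"
    have "norm (?v v* (n_alpha S ** g)) powr (- s) = ((norm (?v v* (n_alpha S ** g)))\<^sup>2) powr (- (s / 2))"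
      by (cases "norm (?v v* (n_alpha S ** g)) = 0") (simp_all add: powr_powr flip: powr_numeral)
    also have "?v v* (n_alpha S ** g) = (?v v* n_alpha S) v* g" by (simp add: vector_matrix_mul_assoc)
    also have "(norm \<dots>)\<^sup>2 = m a + ((of_int (fst a) * S$1 + of_int (snd a) * S$2 + of_int b1 - n1 * (of_int (fst a) * S$2 + of_int (snd a) * S$3 + of_int b2) + c1 a) / y1)\<^sup>2 + 
       ((of_int (fst a) * S$2 + of_int (snd a) * S$3 + of_int b2 + c2 a) / y2)\<^sup>2"
      unfolding iwasawa_norm[OF g] n_alpha_row by (simp add: m_def c1_def c2_def algebra_simps)
    finally show ?thesis by (simp add: H_def vector_matrix_mul_assoc)
  qed
  let ?B = "\<lambda>a s1 s2 s3. int_sum (\<lambda>b2. int_sum (\<lambda>b1. H a (of_int (fst a) * s1 + of_int (snd a) * s2 + of_int b1) (of_int (fst a) * s2 + of_int (snd a) * s3 + of_int b2)))"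
  define T where "T = (\<lambda>a. \<integral>\<^sup>+s3. unit_ind s3 * (\<integral>\<^sup>+s2. unit_ind s2 * (\<integral>\<^sup>+s1. unit_ind s1 * 
      ?B a s1 s2 s3 \<partial>lborel) \<partial>lborel) \<partial>lborel)"
  define A0 where "A0 = int_sum (\<lambda>b2. int_sum (\<lambda>b1. H 0 (of_int b1) (of_int b2)))"
  define R where "R = (\<lambda>a. ennreal (y1 * y2 * (pi / (s / 2 - 1)) * m a powr (1 - s / 2)))"
  have meas: "(\<lambda>S::real^3. ?B a (S$1) (S$2) (S$3)) \<in> borel_measurable borel" for a
    by (intro int_sum_measurable Hm') measurable
  have m0: "m 0 = 0" by (simp add: m_def)
  have mp: "m a > 0" if "a \<noteq> 0" for a
  proof (cases "fst a = 0")
    case True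
    thus ?thesis using that y by (cases a) (auto simp: m_def zero_prod_def)
  next
    case False
    hence "(of_int (fst a) * y1)\<^sup>2 > 0" using y by simp
    thus ?thesis unfolding m_def by (intro add_pos_nonneg) auto
  qed
  have T: "T a = A0 * indicator {0} a + R a" for a
  proof (cases "a = 0")
    case True
    have "T a = A0" unfolding T_def True A0_def by (simp add: nn_integral_unit_ind)
    moreover have "R a = 0" by (simp add: R_def True m0)
    ultimately show ?thesis using True by simp
  next
    case False
    hence a: "fst a \<noteq> 0 \<or> snd a \<noteq> 0" by (cases a) (auto simp: zero_prod_def)
    have "T a = (\<integral>\<^sup>+y. \<integral>\<^sup>+x. H a x y \<partial>lborel \<partial>lborel)"
      unfolding T_def by (rule cube_unfold[OF Hm a])
    also have "\<dots> = R a" unfolding H_def R_def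
      by (subst plane_integral_affine) (use mp[OF False] y s in auto)
    finally show ?thesis using False by simp
  qed
  have "(\<integral>\<^sup>+S. indicator unit_cube S * (\<integral>\<^sup>+v. ennreal (norm (v v* (n_alpha S ** g)) powr (- s)) \<partial>count_space lattice) \<partial>lborel)
     = (\<integral>\<^sup>+S. (\<integral>\<^sup>+a. indicator unit_cube S * ?B a (S$1) (S$2) (S$3) \<partial>count_space UNIV) \<partial>lborel)"
    unfolding lattice4_sum term_eq by (simp add: nn_integral_cmult)
  also have "\<dots> = (\<integral>\<^sup>+a. (\<integral>\<^sup>+S. indicator unit_cube S * ?B a (S$1) (S$2) (S$3) \<partial>lborel) \<partial>count_space UNIV)"
    by (rule nn_integral_count_space_nn_integral) (use meas in \<open>auto intro!: borel_measurable_times_ennreal\<close>)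
  also have "\<dots> = (\<integral>\<^sup>+a. T a \<partial>count_space UNIV)"
  proof (rule nn_integral_cong)
    fix a
    have "(\<integral>\<^sup>+S. indicator unit_cube S * ?B a (S$1) (S$2) (S$3) \<partial>lborel)
      = (\<integral>\<^sup>+s3. \<integral>\<^sup>+s2. \<integral>\<^sup>+s1. (unit_ind s1 * unit_ind s2 * unit_ind s3) * ?B a s1 s2 s3 \<partial>lborel \<partial>lborel \<partial>lborel)"
      by (subst nn_integral_real3) (use meas in \<open>auto simp: indicator_unit_cube intro!: borel_measurable_times_ennreal\<close>)
    also have "\<dots> = T a"
    proof -
      have m1: "(\<lambda>s1. ?B a s1 s2 s3) \<in> borel_measurable lborel" for s2 s3
        by (intro int_sum_measurable Hm') measurable
      define B where "B = (\<lambda>(s3,s2) s1. ?B a s1 s2 s3)"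
      have Bm: "(\<lambda>(q, s1). B q s1) \<in> borel_measurable ((borel \<Otimes>\<^sub>M borel) \<Otimes>\<^sub>M lborel)"
        unfolding B_def case_prod_unfold by (intro int_sum_measurable Hm') measurable
      have m2: "(\<lambda>q. \<integral>\<^sup>+s1. unit_ind s1 * B q s1 \<partial>lborel) \<in> borel_measurable (borel \<Otimes>\<^sub>M borel)"
        using Bm by (intro lborel.borel_measurable_nn_integral) (auto simp: case_prod_unfold)
      have m2': "(\<lambda>s2. \<integral>\<^sup>+s1. unit_ind s1 * B (s3,s2) s1 \<partial>lborel) \<in> borel_measurable lborel" for s3
        using measurable_compose[OF _ m2, of "\<lambda>s2. (s3, s2)" lborel] by simp
      have "(\<integral>\<^sup>+s3. \<integral>\<^sup>+s2. \<integral>\<^sup>+s1. (unit_ind s1 * unit_ind s2 * unit_ind s3) * B (s3,s2) s1 \<partial>lborel \<partial>lborel \<partial>lborel) =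
        (\<integral>\<^sup>+s3. unit_ind s3 * (\<integral>\<^sup>+s2. unit_ind s2 * (\<integral>\<^sup>+s1. unit_ind s1 * B (s3,s2) s1 \<partial>lborel) \<partial>lborel) \<partial>lborel)"
      proof (rule nn_integral_cong)
        fix s3 :: real
        have "(\<integral>\<^sup>+s1. (unit_ind s1 * unit_ind s2 * unit_ind s3) * B (s3,s2) s1 \<partial>lborel) = unit_ind s3 * (unit_ind s2 * (\<integral>\<^sup>+s1. unit_ind s1 * B (s3,s2) s1 \<partial>lborel))" for s2
        proof -
          have "(\<integral>\<^sup>+s1. (unit_ind s1 * unit_ind s2 * unit_ind s3) * B (s3,s2) s1 \<partial>lborel) = (\<integral>\<^sup>+s1. (unit_ind s3 * unit_ind s2) * (unit_ind s1 * B (s3,s2) s1) \<partial>lborel)"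
            by (simp add: mult_ac)
          also have "\<dots> = (unit_ind s3 * unit_ind s2) * (\<integral>\<^sup>+s1. unit_ind s1 * B (s3,s2) s1 \<partial>lborel)"
            by (rule nn_integral_cmult) (use m1[of s2 s3] in \<open>simp add: B_def\<close>)
          finally show ?thesis by (simp add: mult_ac)
        qed
        thus "(\<integral>\<^sup>+s2. \<integral>\<^sup>+s1. (unit_ind s1 * unit_ind s2 * unit_ind s3) * B (s3,s2) s1 \<partial>lborel \<partial>lborel) = unit_ind s3 * (\<integral>\<^sup>+s2. unit_ind s2 * (\<integral>\<^sup>+s1. unit_ind s1 * B (s3,s2) s1 \<partial>lborel) \<partial>lborel)"
          using m2'[of s3] by (simp add: nn_integral_cmult)
      qed
      thus ?thesis by (simp add: T_def B_def)
    qed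
    finally show "(\<integral>\<^sup>+S. indicator unit_cube S * ?B a (S$1) (S$2) (S$3) \<partial>lborel) = T a" .
  qed
  also have "\<dots> = (\<integral>\<^sup>+a. A0 * indicator {0::int\<times>int} a \<partial>count_space UNIV) + (\<integral>\<^sup>+a. R a \<partial>count_space UNIV)"
    unfolding T by (rule nn_integral_add[where f = "\<lambda>a. A0 * indicator {0} a" and g = R]) auto
  also have "(\<integral>\<^sup>+a. A0 * indicator {0::int\<times>int} a \<partial>count_space UNIV) = A0"
    by (subst nn_integral_cmult_indicator) auto
  also have "A0 = ennreal (y1 powr s) * planar_sum z s"
  proof -
    have e: "H 0 (of_int b1) (of_int b2) = ennreal (y1 powr s) * ennreal (cmod (of_int b2 * z + of_int b1) powr (- s))" for b1 b2
    proof -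
      have "(cmod (of_int b2 * z + of_int b1))\<^sup>2 = (of_int b1 - n1 * of_int b2)\<^sup>2 + (of_int b2 * y1 / y2)\<^sup>2"
        unfolding cmod_power2 z_def by (simp add: algebra_simps)
      hence "((of_int b1 - n1 * of_int b2) / y1)\<^sup>2 + (of_int b2 / y2)\<^sup>2 = (cmod (of_int b2 * z + of_int b1) / y1)\<^sup>2"
        using y by (simp add: power_divide field_simps power_mult_distrib)
      hence "H 0 (of_int b1) (of_int b2) = ennreal (((cmod (of_int b2 * z + of_int b1) / y1)\<^sup>2) powr (- (s / 2)))"
        by (simp add: H_def m0 c1_def c2_def)
      also have "((cmod (of_int b2 * z + of_int b1) / y1)\<^sup>2) powr (- (s / 2)) = (cmod (of_int b2 * z + of_int b1) / y1) powr (- s)"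
        using y by (cases "cmod (of_int b2 * z + of_int b1) = 0") (simp_all add: powr_powr flip: powr_numeral)
      also have "\<dots> = y1 powr s * cmod (of_int b2 * z + of_int b1) powr (- s)"
        using y by (simp add: powr_divide powr_minus field_simps)
      finally show ?thesis by (simp add: ennreal_mult)
    qed
    have "A0 = int_sum (\<lambda>b2. int_sum (\<lambda>b1. ennreal (y1 powr s) * ennreal (cmod (of_int b2 * z + of_int b1) powr (- s))))"
      unfolding A0_def e ..
    also have "\<dots> = ennreal (y1 powr s) * int_sum (\<lambda>b2. int_sum (\<lambda>b1. ennreal (cmod (of_int b2 * z + of_int b1) powr (- s))))"
      by (simp add: nn_integral_cmult)
    also have "int_sum (\<lambda>b2. int_sum (\<lambda>b1. ennreal (cmod (of_int b2 * z + of_int b1) powr (- s)))) = planar_sum z s"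
      unfolding planar_sum_def by (subst lattice2_sum[of 1], simp, subst int_sum_pair[symmetric]) simp
    finally show ?thesis .
  qed
  also have "(\<integral>\<^sup>+a. R a \<partial>count_space UNIV) = ennreal (y1 * y2 * (pi / (s / 2 - 1)) * y2 powr (2 - s)) * planar_sum z (s - 2)"
  proof -
    have e: "R a = ennreal (y1 * y2 * (pi / (s / 2 - 1)) * y2 powr (2 - s)) * ennreal (cmod (of_real (of_int (- 1 * fst a)) * z + of_real (of_int (snd a))) powr (- (s - 2)))" for a
    proof -
      let ?c = "cmod (of_real (of_int (- 1 * fst a)) * z + of_real (of_int (snd a)))"
      have "?c\<^sup>2 = (of_int (fst a) * n1 + of_int (snd a))\<^sup>2 + (of_int (fst a) * y1 / y2)\<^sup>2"
        unfolding cmod_power2 z_def by (simp add: algebra_simps)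
      hence "(y2 * ?c)\<^sup>2 = y2\<^sup>2 * ((of_int (fst a) * n1 + of_int (snd a))\<^sup>2 + (of_int (fst a) * y1 / y2)\<^sup>2)"
        by (simp only: power_mult_distrib)
      also have "\<dots> = m a" unfolding m_def power_mult_distrib power_divide distrib_left using y by simp
      finally have "m a = (y2 * ?c)\<^sup>2" ..
      hence "m a powr (1 - s / 2) = ((y2 * ?c)\<^sup>2) powr (1 - s / 2)" by simp
      also have "\<dots> = (y2 * ?c) powr (2 - s)"
        using square_powr[of "y2 * ?c" "1 - s / 2"] y by (simp add: algebra_simps)
      also have "\<dots> = y2 powr (2 - s) * ?c powr (2 - s)" using y by (simp add: powr_mult)
      finally have "R a = ennreal ((y1 * y2 * (pi / (s / 2 - 1)) * y2 powr (2 - s)) * ?c powr (2 - s))" by (simp add: R_def mult_ac)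
      also have "\<dots> = ennreal (y1 * y2 * (pi / (s / 2 - 1)) * y2 powr (2 - s)) * ennreal (?c powr (2 - s))"
        by (rule ennreal_mult) (use y s in auto)
      finally show ?thesis by simp
    qed
    show ?thesis unfolding e planar_sum_def by (subst nn_integral_cmult, simp, subst lattice2_sum[of "-1"]) simp_all
  qed
  finally show ?thesis .
qed

section \<open>The Eisenstein series as sums over primitive vectors\<close>

lemma of_real_ratio_powr:
  assumes "r > 0" "y > 0"
  shows "complex_of_real (y / r\<^sup>2) powr a = of_real y powr a * of_real r powr (- (2 * a))"
  using assms by (simp add: of_real_powr_exp ln_div ln_realpow exp_add[symmetric] algebra_simps del: of_real_divide of_real_power)

lemma nicely_imp_meromorphic: "f nicely_meromorphic_on A \<Longrightarrow> f meromorphic_on A"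
  by (simp add: nicely_meromorphic_on_def)


definition tau_norm :: "complex \<Rightarrow> real^2 \<Rightarrow> real" where
  "tau_norm z v = cmod (of_real (v$1) * z + of_real (v$2))"

lemma linear_family_z:
  assumes "Im z > 0"
  shows "linear_family {0::real} (\<lambda>_. \<lambda>v::real^2. of_real (v$1) * z + of_real (v$2))"
proof (rule linear_family.intro, goal_cases)
  case (2 p)
  show ?case
    by (rule linearI) (simp_all add: algebra_simps scaleR_conv_of_real[where 'a = complex])
next
  case (3 p x)
  have e: "complex_of_real (x$1) * z + of_real (x$2) = 0" by (rule 3(2))
  have "x$1 * Im z = 0" using arg_cong[OF e, of Im] by simp
  hence "x$1 = 0" using assms by simp
  thus "x = 0" using e by (simp add: vec_eq_iff forall_2)
qed (auto simp: case_prod_unfold intro!: continuous_intros)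

text \<open>The usual formula \<open>Im (\<delta> z) = Im z / \<bar>c z + d\<bar>\<^sup>2\<close>, from determinant one.\<close>
lemma Im_frac_linear:
  assumes d: "\<delta> \<in> SL2Z" and z: "Im z > 0"
  shows "Im (frac_linear \<delta> z) = Im z / (tau_norm z (\<chi> i. real_of_int (\<delta>$2$i)))\<^sup>2" "tau_norm z (\<chi> i. real_of_int (\<delta>$2$i)) > 0"
proof -
  interpret linear_family "{0::real}" "\<lambda>_. \<lambda>v::real^2. of_real (v$1) * z + of_real (v$2)" using linear_family_z[OF z] .
  have det: "\<delta>$1$1 * \<delta>$2$2 - \<delta>$1$2 * \<delta>$2$1 = 1" using d by (simp add: SL2Z_def det_2)
  hence det': "real_of_int (\<delta>$1$1) * \<delta>$2$2 - \<delta>$1$2 * \<delta>$2$1 = 1" by (metis of_int_1 of_int_diff of_int_mult)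
  have nz: "(\<chi> i. real_of_int (\<delta>$2$i)) \<noteq> 0"
  proof -
    have "\<delta>$2$1 \<noteq> 0 \<or> \<delta>$2$2 \<noteq> 0" using det by auto
    thus ?thesis by (auto simp: vec_eq_iff forall_2)
  qed
  show p: "tau_norm z (\<chi> i. real_of_int (\<delta>$2$i)) > 0" unfolding tau_norm_def using L_pos[of 0, OF _ nz] by simp
  let ?w = "complex_of_int (\<delta>$2$1) * z + of_int (\<delta>$2$2)"
  have n: "tau_norm z (\<chi> i. real_of_int (\<delta>$2$i)) = cmod ?w" by (simp add: tau_norm_def)
  have "Im (frac_linear \<delta> z) = (real_of_int (\<delta>$1$1) * \<delta>$2$2 - \<delta>$1$2 * \<delta>$2$1) * Im z / (cmod ?w)\<^sup>2"
    unfolding frac_linear_def Im_divide cmod_power2 by (simp add: algebra_simps)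
  thus "Im (frac_linear \<delta> z) = Im z / (tau_norm z (\<chi> i. real_of_int (\<delta>$2$i)))\<^sup>2" using det' n by simp
qed

lemma holomorphic_on_affine:
  assumes h: "h holomorphic_on {w. Re w > k * b + c}" and k: "k > 0"
  shows "(\<lambda>s. h (of_real k * s + of_real c)) holomorphic_on {s. Re s > b}"
proof -
  have "(h \<circ> (\<lambda>s. of_real k * s + of_real c)) holomorphic_on {s. Re s > b}"
    by (rule holomorphic_on_compose_gen[OF _ h]) (use k in \<open>auto intro!: holomorphic_intros\<close>)
  thus ?thesis by (simp add: o_def)
qed

lemma nonzero_affine:
  assumes D: "\<exists>w. Re w > k * b + c \<and> D w \<noteq> 0" and k: "k > 0"
  shows "\<exists>s. Re s > b \<and> D (of_real k * s + of_real c) \<noteq> (0::complex)"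
proof -
  obtain w where w: "Re w > k * b + c" "D w \<noteq> 0" using D by blast
  have "Re ((w - of_real c) / of_real k) > b" using w k by (simp add: field_simps)
  moreover have "of_real k * ((w - of_real c) / of_real k) + of_real c = w" using k by simp
  ultimately show ?thesis using w(2) by metis
qed

text \<open>By \<open>coset_sum_SL2\<close> the series is a sum over primitive pairs, with lengths measured by \<open>\<bar>c z + d\<bar>\<close>, and
\<open>prim_sum_continuation\<close> applies in dimension two. The exponent is \<open>2 s + 1\<close>, so \<open>Re s > 1/2\<close> is the half plane of
convergence.\<close>
theorem
  assumes z: "Im z > 0"
  shows E_SL2_nicely: "E_SL2 z nicely_meromorphic_on UNIV"
    and E_SL2_eq: "Re s > 1/2 \<Longrightarrow> E_SL2 z s = 1/2 * (of_real (Im z) powr (s + 1/2) * prim_sum (tau_norm z) (2 * s + 1))"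
proof -
  interpret linear_family "{0::real}" "\<lambda>_. \<lambda>v::real^2. of_real (v$1) * z + of_real (v$2)" using linear_family_z[OF z] .
  define f where "f = (\<lambda>s. 1/2 * coset_sum Gamma_inf2 SL2Z (\<lambda>\<delta>. complex_of_real (Im (frac_linear \<delta> z)) powr (s + 1/2)))"
  define y where "y = (\<lambda>s::complex. complex_of_real (Im z) powr (s + 1/2))"
  have f: "f s = 1/2 * (y s * prim_sum (tau_norm z) (2 * s + 1))" for s
  proof -
    have "coset_sum Gamma_inf2 SL2Z (\<lambda>\<delta>. complex_of_real (Im (frac_linear \<delta> z)) powr (s + 1/2)) = 
       infsum (\<lambda>v. y s * of_real (tau_norm z v) powr (- (2 * s + 1))) primitive"
    proof (rule coset_sum_SL2)
      fix \<delta> assume d: "\<delta> \<in> SL2Z"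
      show "complex_of_real (Im (frac_linear \<delta> z)) powr (s + 1/2) = y s * of_real (tau_norm z (\<chi> i. real_of_int (\<delta>$2$i))) powr (- (2 * s + 1))"
        unfolding Im_frac_linear(1)[OF d z] of_real_ratio_powr[OF Im_frac_linear(2)[OF d z] z] by (simp add: y_def algebra_simps)
    qed
    thus ?thesis by (simp add: f_def prim_sum_def infsum_cmult_right')
  qed
  have hy: "y holomorphic_on A" for A unfolding y_def using z by (intro holomorphic_intros) auto
  have N: "(\<lambda>v. cmod (complex_of_real (v$1) * z + of_real (v$2))) = tau_norm z" by (simp add: tau_norm_def[abs_def])
  have hol: "f holomorphic_on {s. Re s > 1/2}"
  proof -
    have "prim_sum (tau_norm z) holomorphic_on {w. Re w > 2}" using prim_sum_joint_hol unfolding N joint_hol_def by simp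
    hence "(\<lambda>s. prim_sum (tau_norm z) (2 * s + 1)) holomorphic_on {s. Re s > 1/2}"
      using holomorphic_on_affine[of "prim_sum (tau_norm z)" 2 "1/2" 1] by simp
    hence "(\<lambda>s. 1/2 * (y s * prim_sum (tau_norm z) (2 * s + 1))) holomorphic_on {s. Re s > 1/2}"
      by (intro holomorphic_intros hy)
    thus ?thesis unfolding f[abs_def] .
  qed
  have semi: "left_continuable (1/2) f"
    unfolding left_continuable_def
  proof (intro allI impI)
    fix b :: real assume b: "b \<le> 1/2"
    obtain D W where DW: "D holomorphic_on {w. Re w > 2 * b + 1}" "\<exists>w. Re w > 2 * b + 1 \<and> D w \<noteq> 0" "joint_hol {0::real} {w. Re w > 2 * b + 1} W" 
       "\<And>w. Re w > 2 \<Longrightarrow> D w * prim_sum (tau_norm z) w = W 0 w"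
      using prim_sum_continuation[of "2 * b + 1"] b unfolding N by auto
    have W: "W 0 holomorphic_on {w. Re w > 2 * b + 1}" using DW(3) by (simp add: joint_hol_def)
    have W': "(\<lambda>s. W 0 (2 * s + 1)) holomorphic_on {s. Re s > b}"
      using holomorphic_on_affine[of "W 0" 2 b 1] W by simp
    have W'': "(\<lambda>s. 1/2 * (y s * W 0 (2 * s + 1))) holomorphic_on {s. Re s > b}" by (intro holomorphic_intros hy W')
    have D': "(\<lambda>s. D (2 * s + 1)) holomorphic_on {s. Re s > b}" "\<exists>s. Re s > b \<and> D (2 * s + 1) \<noteq> 0"
      using holomorphic_on_affine[of D 2 b 1] nonzero_affine[of 2 b 1 D] DW by auto
    have "D (2 * s + 1) * f s = 1/2 * (y s * W 0 (2 * s + 1))" if "Re s > 1/2" for s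
    proof -
      have "Re (2 * s + 1) > 2" using that by simp
      from DW(4)[OF this] show ?thesis unfolding f by (simp add: mult_ac)
    qed
    thus "\<exists>D W. D holomorphic_on {s. b < Re s} \<and> W holomorphic_on {s. b < Re s} \<and> (\<exists>s. b < Re s \<and> D s \<noteq> 0) \<and> (\<forall>s. 1 / 2 < Re s \<longrightarrow> D s * f s = W s)"
      using D' W'' by (intro exI[of _ "\<lambda>s. D (2 * s + 1)"] exI[of _ "\<lambda>s. 1/2 * (y s * W 0 (2 * s + 1))"]) auto
  qed
  have E: "E_SL2 z = mero_cont (1/2) f" by (simp add: E_SL2_def f_def)
  show "E_SL2 z nicely_meromorphic_on UNIV" unfolding E by (rule mero_cont_nicely[OF hol semi])
  show "E_SL2 z s = 1/2 * (of_real (Im z) powr (s + 1/2) * prim_sum (tau_norm z) (2 * s + 1))" if "Re s > 1/2"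
    unfolding E mero_cont_eq[OF hol semi that] f y_def ..
qed


lemma n_alpha_Sp4R: "n_alpha S \<in> Sp4R"
  unfolding Sp4R_iff vec4_eq_iff matrix_mult_nth4
  by (simp add: n_alpha_def blocks_def mat_def J_rows transpose_def)

lemma Sp4R_row_nonzero:
  assumes "h \<in> Sp4R" "v v* h = 0" shows "v = 0"
proof -
  have "v = v v* (h ** symp_inverse h)" by (simp add: symp_inverse(1)[OF assms(1)])
  also have "\<dots> = (v v* h) v* symp_inverse h" by (simp add: vector_matrix_mul_assoc)
  finally show ?thesis by (simp add: assms(2))
qed

lemma linear_family_n:
  assumes g: "g \<in> Sp4R"
  shows "linear_family (cbox (0::real^3) 1) (\<lambda>S v. v v* (n_alpha S ** g))"
proof (rule linear_family.intro, goal_cases)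
  case (2 S)
  show ?case
    by (rule linearI) (simp_all only: vector_matrix_left_distrib scaleR_vector_matrix_assoc)
next
  case (3 S x)
  show ?case by (rule Sp4R_row_nonzero[OF Sp4R_mult[OF n_alpha_Sp4R g] 3(2)])
next
  case 4
  have e: "x v* (n_alpha S ** g) = (vector [x$1, x$2, x$1 * S$1 + x$2 * S$2 + x$3, x$1 * S$2 + x$2 * S$3 + x$4] :: real^4) v* g" for x S
    by (simp add: vector_matrix_mul_assoc[symmetric] n_alpha_row)
  have "continuous_on (cbox (0::real^3) 1 \<times> UNIV) (\<lambda>q. snd q v* (n_alpha (fst q) ** g))"
    unfolding e unfolding vector_matrix_mult_def sum_4 vector_4
    by (intro continuous_intros)
  thus ?case by (simp add: case_prod_unfold)
qed simp

lemma E_beta_series: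
  assumes h: "h \<in> Sp4R" and s: "(\<lambda>v. complex_of_real (norm (v v* h)) powr (- (\<nu> + 2))) summable_on primitive"
  shows "coset_sum (P_beta \<inter> Sp4Z) Sp4Z (\<lambda>\<gamma>. I_beta (\<gamma> ** h) \<nu>) = 1/2 * prim_sum (\<lambda>v. norm (v v* h)) (\<nu> + 2)"
  unfolding prim_sum_def
proof (rule coset_sum_Sp4)
  have "(- v) v* h = - (v v* h)" for v by (simp add: vector_matrix_mult_def vec_eq_iff sum_negf)
  thus "complex_of_real (norm ((- v) v* h)) powr (- (\<nu> + 2)) = of_real (norm (v v* h)) powr (- (\<nu> + 2))" for v by simp
  fix \<gamma> assume g: "\<gamma> \<in> Sp4Z"
  hence gR: "\<gamma> \<in> Sp4R" by (simp add: Sp4Z_def)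
  have nz: "\<gamma>$3 v* h \<noteq> 0" using Sp4R_row_nonzero[OF h] primitive_nonzero[OF row3_is_primitive[OF g]] by blast
  hence n: "norm (\<gamma>$3 v* h) > 0" by simp
  have "I_beta (\<gamma> ** h) \<nu> = complex_of_real (1 / norm (\<gamma>$3 v* h)) powr (\<nu> + 2)"
    by (simp add: I_beta_def iwa_y1_eq[OF Sp4R_mult[OF gR h]] row3_mult)
  also have "\<dots> = of_real (norm (\<gamma>$3 v* h)) powr (- (\<nu> + 2))"
    using n by (simp add: of_real_powr_exp ln_div algebra_simps del: of_real_divide)
  finally show "I_beta (\<gamma> ** h) \<nu> = of_real (norm (\<gamma>$3 v* h)) powr (- (\<nu> + 2))" .
qed (use s in simp)

text \<open>One denominator \<open>D\<close> describes the Eisenstein series at all translates by the unit cube, with actual values away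
from the zeros of \<open>D\<close>.\<close>
theorem E_beta_family:
  assumes g: "g \<in> Sp4R" and b: "b \<le> 2"
  obtains D W where "D holomorphic_on {\<nu>. Re \<nu> > b}" "\<exists>\<nu>. Re \<nu> > b \<and> D \<nu> \<noteq> 0" "joint_hol (cbox (0::real^3) 1) {\<nu>. Re \<nu> > b} W"
    "\<And>S \<nu>. S \<in> cbox 0 1 \<Longrightarrow> Re \<nu> > b \<Longrightarrow> D \<nu> \<noteq> 0 \<Longrightarrow> E_beta (n_alpha S ** g) \<nu> = W S \<nu> / D \<nu>"
    and "\<And>S \<nu>. S \<in> cbox 0 1 \<Longrightarrow> Re \<nu> > 2 \<Longrightarrow> E_beta (n_alpha S ** g) \<nu> = 1/2 * prim_sum (\<lambda>v. norm (v v* (n_alpha S ** g))) (\<nu> + 2)"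
proof -
  interpret linear_family "cbox (0::real^3) 1" "\<lambda>S v. v v* (n_alpha S ** g)" using linear_family_n[OF g] .
  define N where "N = (\<lambda>S v. norm (v v* (n_alpha S ** g)))"
  define f where "f = (\<lambda>S \<nu>. coset_sum (P_beta \<inter> Sp4Z) Sp4Z (\<lambda>\<gamma>. I_beta (\<gamma> ** (n_alpha S ** g)) \<nu>))"
  have f: "f S \<nu> = 1/2 * prim_sum (N S) (\<nu> + 2)" if "S \<in> cbox 0 1" "Re \<nu> > 2" for S \<nu>
    unfolding f_def N_def using that
    by (intro E_beta_series Sp4R_mult[OF n_alpha_Sp4R g] norm_powr_summable[OF primitive_sub]) auto
  have pn: "joint_hol (cbox 0 1) {w. Re w > 4} (\<lambda>S. prim_sum (N S))" using prim_sum_joint_hol unfolding N_def by simp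
  have shift: "(\<lambda>\<nu>. h (\<nu> + 2)) holomorphic_on {\<nu>. Re \<nu> > b}" if "h holomorphic_on {w. Re w > b + 2}" for h b
    using holomorphic_on_affine[of h 1 b 2] that by simp
  have hol: "f S holomorphic_on {\<nu>. Re \<nu> > 2}" if "S \<in> cbox 0 1" for S
  proof -
    have "(\<lambda>\<nu>. 1/2 * prim_sum (N S) (\<nu> + 2)) holomorphic_on {\<nu>. Re \<nu> > 2}"
      by (intro holomorphic_intros shift) (use pn that in \<open>simp add: joint_hol_def\<close>)
    thus ?thesis by (rule holomorphic_transform) (simp add: f that)
  qed
  have cont: "\<exists>D W. D holomorphic_on {\<nu>. Re \<nu> > b} \<and> (\<exists>\<nu>. Re \<nu> > b \<and> D \<nu> \<noteq> 0) \<and> joint_hol (cbox 0 1) {\<nu>. Re \<nu> > b} W \<and>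
     (\<forall>S\<in>cbox 0 1. \<forall>\<nu>. Re \<nu> > 2 \<longrightarrow> D \<nu> * f S \<nu> = W S \<nu>)" if b: "b \<le> 2" for b
  proof -
    obtain D W where DW: "D holomorphic_on {w. Re w > b + 2}" "\<exists>w. Re w > b + 2 \<and> D w \<noteq> 0" "joint_hol (cbox 0 1) {w. Re w > b + 2} W" 
       "\<And>S w. S \<in> cbox 0 1 \<Longrightarrow> Re w > 4 \<Longrightarrow> D w * prim_sum (N S) w = W S w"
      using prim_sum_continuation[of "b + 2"] b unfolding N_def by auto
    have D': "\<exists>s. Re s > b \<and> D (s + 2) \<noteq> 0"
      using nonzero_affine[of 1 b 2 D] DW(2) by simp
    have "joint_hol (cbox 0 1) {\<nu>. Re \<nu> > b} (\<lambda>S \<nu>. 1/2 * W S (\<nu> + 2))"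
    proof (intro joint_hol_mult joint_hol_const_param)
      show "joint_hol (cbox 0 1) {\<nu>. Re \<nu> > b} (\<lambda>S \<nu>. W S (\<nu> + 2))" unfolding joint_hol_def
      proof safe
        have c: "continuous_on (cbox 0 1 \<times> {w. Re w > b + 2}) (\<lambda>x. W (fst x) (snd x))" using DW(3) by (simp add: joint_hol_def case_prod_unfold)
        show "continuous_on (cbox 0 1 \<times> {\<nu>. Re \<nu> > b}) (\<lambda>(S,\<nu>). W S (\<nu> + 2))" unfolding case_prod_unfold
          by (rule continuous_on_compose2[OF c, of _ "\<lambda>x. (fst x, snd x + 2)", simplified]) (auto intro!: continuous_intros)
        fix S :: "real^3" assume "S \<in> cbox 0 1"
        thus "(\<lambda>\<nu>. W S (\<nu> + 2)) holomorphic_on {\<nu>. Re \<nu> > b}" using DW(3) by (intro shift) (simp add: joint_hol_def)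
      qed
    qed auto
    moreover have "D (\<nu> + 2) * f S \<nu> = 1/2 * W S (\<nu> + 2)" if "S \<in> cbox 0 1" "Re \<nu> > 2" for S \<nu>
      using DW(4)[OF that(1), of "\<nu> + 2"] that(2) unfolding f[OF that] by (simp add: mult_ac)
    ultimately show ?thesis using shift[OF DW(1)] D'
      by (intro exI[of _ "\<lambda>\<nu>. D (\<nu> + 2)"] exI[of _ "\<lambda>S \<nu>. 1/2 * W S (\<nu> + 2)"]) auto
  qed
  have semi: "left_continuable 2 (f S)" if S: "S \<in> cbox 0 1" for S
    unfolding left_continuable_def
  proof (intro allI impI)
    fix b :: real assume "b \<le> 2"
    from cont[OF this] obtain D W where "D holomorphic_on {\<nu>. Re \<nu> > b}" "\<exists>\<nu>. Re \<nu> > b \<and> D \<nu> \<noteq> 0" "joint_hol (cbox (0::real^3) 1) {\<nu>. Re \<nu> > b} W"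
     "\<And>S \<nu>. S \<in> cbox 0 1 \<Longrightarrow> Re \<nu> > 2 \<Longrightarrow> D \<nu> * f S \<nu> = W S \<nu>" by blast
    thus "\<exists>D W. D holomorphic_on {s. b < Re s} \<and> W holomorphic_on {s. b < Re s} \<and> (\<exists>s. b < Re s \<and> D s \<noteq> 0) \<and> (\<forall>s. 2 < Re s \<longrightarrow> D s * f S s = W s)"
      using S by (intro exI[of _ D] exI[of _ "W S"]) (auto simp: joint_hol_def)
  qed
  have E: "E_beta (n_alpha S ** g) = mero_cont 2 (f S)" for S by (simp add: E_beta_def f_def)
  have En: "E_beta (n_alpha S ** g) nicely_meromorphic_on UNIV" and Ef: "\<And>\<nu>. Re \<nu> > 2 \<Longrightarrow> E_beta (n_alpha S ** g) \<nu> = f S \<nu>" if "S \<in> cbox 0 1" for S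
    unfolding E using mero_cont_nicely[OF hol semi] mero_cont_eq[OF hol semi] that by auto
  from cont[OF b] obtain D W where DW: "D holomorphic_on {\<nu>. Re \<nu> > b}" "\<exists>\<nu>. Re \<nu> > b \<and> D \<nu> \<noteq> 0" "joint_hol (cbox (0::real^3) 1) {\<nu>. Re \<nu> > b} W"
     "\<And>S \<nu>. S \<in> cbox 0 1 \<Longrightarrow> Re \<nu> > 2 \<Longrightarrow> D \<nu> * f S \<nu> = W S \<nu>" by blast
  show thesis
  proof (rule that[OF DW(1-3)])
    fix S :: "real^3" and \<nu> assume S: "S \<in> cbox 0 1"
    show "E_beta (n_alpha S ** g) \<nu> = W S \<nu> / D \<nu>" if n: "Re \<nu> > b" "D \<nu> \<noteq> 0"
      by (rule nicely_meromorphic_quotient[OF En[OF S] DW(1) _ _ b n]) (use DW(3,4) Ef[OF S] S in \<open>auto simp: joint_hol_def\<close>)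
    show "E_beta (n_alpha S ** g) \<nu> = 1/2 * prim_sum (\<lambda>v. norm (v v* (n_alpha S ** g))) (\<nu> + 2)" if n: "Re \<nu> > 2"
      using Ef[OF S n] f[OF S n] by (simp add: N_def)
  qed
qed


text \<open>The half-open and the closed cube differ by three faces, which are null sets.\<close>
lemma AE_unit_cube: "AE S in lborel. (S \<in> unit_cube \<longleftrightarrow> S \<in> cbox (0::real^3) 1)"
proof -
  have n: "AE S in lborel. S$i \<noteq> (1::real)" for i :: 3
  proof (rule AE_I')
    have "negligible {x::real^3. x \<bullet> axis i 1 = 1}" by (rule negligible_standard_hyperplane) (simp add: axis_in_Basis_iff)
    hence "negligible {x::real^3. x$i = 1}" by (simp add: cart_eq_inner_axis)
    moreover have "{x::real^3. x$i = 1} \<in> sets lborel" by measurable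
    ultimately show "{x::real^3. x$i = 1} \<in> null_sets lborel"
      by (simp add: null_sets_completion_iff negligible_iff_null_sets)
  qed auto
  have "AE S in lborel. \<forall>i::3. S$i \<noteq> (1::real)" by (rule AE_all_countable[THEN iffD2]) (use n in auto)
  thus ?thesis
    by eventually_elim (auto simp: unit_cube_def mem_box_cart less_le)
qed

lemma
  fixes f :: "real^3 \<Rightarrow> 'b::euclidean_space"
  assumes f: "continuous_on (cbox 0 1) f"
  shows LINT_unit_cube: "(LINT S:unit_cube|lborel. f S) = integral (cbox 0 1) f"
    and set_integrable_unit_cube: "set_integrable lborel unit_cube f"
proof -
  have i: "set_integrable lborel (cbox 0 1) f" unfolding set_integrable_def
    by (rule borel_integrable_compact[OF compact_cbox f])
  have "unit_cube \<subseteq> cbox 0 1" by (auto simp: unit_cube_def mem_box_cart less_imp_le)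
  thus s: "set_integrable lborel unit_cube f" using i by (rule set_integrable_subset[rotated 2]) simp
  have "(LINT S:unit_cube|lborel. f S) = (LINT S:cbox 0 1|lborel. f S)"
    unfolding set_lebesgue_integral_def
  proof (rule integral_cong_AE)
    show "AE S in lborel. indicator unit_cube S *\<^sub>R f S = indicator (cbox 0 1) S *\<^sub>R f S"
      using AE_unit_cube by eventually_elim (simp add: indicator_def)
  qed (use i s in \<open>auto simp: set_integrable_def\<close>)
  also have "\<dots> = integral (cbox 0 1) f" by (rule set_borel_integral_eq_integral(2)[OF i])
  finally show "(LINT S:unit_cube|lborel. f S) = integral (cbox 0 1) f" .
qed

text \<open>Near a given point the integrand is \<open>W S \<nu> / D \<nu>\<close>, so the constant term is the quotient of the holomorphic
function \<open>\<integral> W S \<nu>\<close> by \<open>D\<close>, except at the isolated zeros of \<open>D\<close>.\<close>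
lemma constant_term_meromorphic:
  assumes g: "g \<in> Sp4R"
  shows "constant_term g meromorphic_on UNIV"
proof (subst meromorphic_on_meromorphic_at, safe)
  fix \<nu>0 :: complex
  \<comment> \<open>The half plane has to contain \<open>\<nu>0\<close> and to overlap the domain of convergence.\<close>
  define b where "b = min 2 (Re \<nu>0) - 1"
  have b: "b \<le> 2" "Re \<nu>0 > b" by (auto simp: b_def)
  let ?H = "{\<nu>. Re \<nu> > b}"
  have oH: "open ?H" "connected ?H" by (auto simp: open_halfspace_Re_gt connected_halfspace_Re)
  obtain D W where DW: "D holomorphic_on ?H" "\<exists>\<nu>. Re \<nu> > b \<and> D \<nu> \<noteq> 0" "joint_hol (cbox (0::real^3) 1) ?H W"
    "\<And>S \<nu>. S \<in> cbox 0 1 \<Longrightarrow> Re \<nu> > b \<Longrightarrow> D \<nu> \<noteq> 0 \<Longrightarrow> E_beta (n_alpha S ** g) \<nu> = W S \<nu> / D \<nu>"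
    "\<And>S \<nu>. S \<in> cbox 0 1 \<Longrightarrow> Re \<nu> > 2 \<Longrightarrow> E_beta (n_alpha S ** g) \<nu> = 1/2 * prim_sum (\<lambda>v. norm (v v* (n_alpha S ** g))) (\<nu> + 2)"
    by (rule E_beta_family[OF g b(1)], rule that; assumption)
  define I where "I = (\<lambda>\<nu>. integral (cbox 0 1) (\<lambda>S. W S \<nu>))"
  have Ih: "I holomorphic_on ?H" unfolding I_def
    by (rule holomorphic_on_integral_param[OF oH(1)]) (use DW(3) in \<open>auto simp: joint_hol_def\<close>)
  have eq: "constant_term g \<nu> = I \<nu> / D \<nu>" if n: "Re \<nu> > b" "D \<nu> \<noteq> 0" for \<nu>
  proof -
    have c: "continuous_on (cbox 0 1) (\<lambda>S. W S \<nu>)"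
    proof -
      have "continuous_on (cbox 0 1 \<times> ?H) (\<lambda>x. W (fst x) (snd x))" using DW(3) by (simp add: joint_hol_def case_prod_unfold)
      hence "continuous_on (cbox 0 1) (\<lambda>S. W (fst (S, \<nu>)) (snd (S, \<nu>)))"
        by (rule continuous_on_compose2[where f = "\<lambda>S. (S, \<nu>)"]) (use n in \<open>auto intro!: continuous_intros\<close>)
      thus ?thesis by simp
    qed
    have "constant_term g \<nu> = (LINT S:unit_cube|lborel. E_beta (n_alpha S ** g) \<nu>)"
      by (simp add: constant_term_def unit_cube_def)
    also have "\<dots> = (LINT S:unit_cube|lborel. W S \<nu> / D \<nu>)"
    proof (rule set_lebesgue_integral_cong)
      show "\<forall>S. S \<in> unit_cube \<longrightarrow> E_beta (n_alpha S ** g) \<nu> = W S \<nu> / D \<nu>"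
        using DW(4) n by (auto simp: unit_cube_def mem_box_cart less_imp_le)
    qed simp
    also have "\<dots> = integral (cbox 0 1) (\<lambda>S. W S \<nu> / D \<nu>)"
      by (rule LINT_unit_cube) (use c n in \<open>auto intro!: continuous_intros\<close>)
    also have "\<dots> = I \<nu> / D \<nu>" by (simp add: I_def)
    finally show ?thesis .
  qed
  have "(\<lambda>\<nu>. I \<nu> / D \<nu>) meromorphic_on ?H" by (rule entire_quotient_meromorphic[OF DW(1) Ih oH(1)])
  hence m: "(\<lambda>\<nu>. I \<nu> / D \<nu>) meromorphic_on {\<nu>0}" by (rule meromorphic_on_subset) (use b in auto)
  have "\<forall>\<^sub>\<approx>\<nu>\<in>?H. D \<nu> \<noteq> 0" using holomorphic_nonzero_cosparse[OF DW(1) oH] DW(2) by blast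
  hence "\<forall>\<^sub>F \<nu> in at \<nu>0. D \<nu> \<noteq> 0" using b oH by (auto simp: eventually_cosparse_open_eq)
  moreover have "\<forall>\<^sub>F \<nu> in at \<nu>0. \<nu> \<in> ?H" by (rule eventually_at_in_open') (use oH b in auto)
  ultimately have "\<forall>\<^sub>F \<nu> in at \<nu>0. constant_term g \<nu> = I \<nu> / D \<nu>" by eventually_elim (use eq in auto)
  thus "constant_term g meromorphic_on {\<nu>0}"
    using m by (subst meromorphic_on_cong[where g = "\<lambda>\<nu>. I \<nu> / D \<nu>" and B = "{\<nu>0}"]) auto
qed

section \<open>The constant term formula\<close>

lemma nn_integral_count_space_infsum:
  fixes f :: "'a \<Rightarrow> real"
  assumes "f summable_on A" "\<And>x. x \<in> A \<Longrightarrow> f x \<ge> 0"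
  shows "(\<integral>\<^sup>+x. ennreal (f x) \<partial>count_space A) = ennreal (infsum f A)"
proof -
  have "(\<lambda>x. norm (f x)) summable_on A"
    by (rule summable_on_cong[THEN iffD1, OF _ assms(1)]) (use assms(2) in auto)
  hence a: "Infinite_Set_Sum.abs_summable_on f A" using abs_summable_equivalent by metis
  thus ?thesis using nn_integral_conv_infsetsum[OF a] assms(2) infsetsum_infsum[OF a] by simp
qed

text \<open>The bridge between sums of extended nonnegative reals and the complex functions.\<close>
lemma (in linear_family) lattice_nn_sum:
  assumes p: "p \<in> P" and s: "s > real CARD('n)"
  obtains r where "r \<ge> 0" "(\<integral>\<^sup>+v. ennreal (norm (L p v) powr (- s)) \<partial>count_space lattice) = ennreal r"
    "complex_of_real r = zeta_series (of_real s) * prim_sum (\<lambda>v. norm (L p v)) (of_real s)"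
proof -
  define f where "f = (\<lambda>v. norm (L p v) powr (- s))"
  have e: "complex_of_real (f v) = of_real (norm (L p v)) powr (- of_real s)" for v
    unfolding f_def using powr_of_real[of "norm (L p v)" "- s"] by simp
  have "(\<lambda>v. complex_of_real (f v)) summable_on (lattice - {0})"
    unfolding e by (rule norm_powr_summable[OF order_refl p]) (use s in simp)
  from summable_on_bounded_linear[OF bounded_linear_Re this]
  have sm: "f summable_on (lattice - {0})" by (simp add: o_def)
  have "(\<integral>\<^sup>+v. ennreal (f v) \<partial>count_space lattice) = (\<integral>\<^sup>+v. ennreal (f v) \<partial>count_space (lattice - {0}))"
    by (rule nn_integral_count_space_eq) (use linL[OF p] in \<open>auto simp: f_def linear_0\<close>)
  also have "\<dots> = ennreal (infsum f (lattice - {0}))"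
    by (rule nn_integral_count_space_infsum[OF sm]) (simp add: f_def)
  finally have 1: "(\<integral>\<^sup>+v. ennreal (f v) \<partial>count_space lattice) = ennreal (infsum f (lattice - {0}))" .
  have "complex_of_real (infsum f (lattice - {0})) = infsum (\<lambda>v. complex_of_real (f v)) (lattice - {0})"
    by (rule infsumI[symmetric], rule has_sum_of_real, rule has_sum_infsum[OF sm])
  also have "\<dots> = zeta_series (of_real s) * prim_sum (\<lambda>v. norm (L p v)) (of_real s)"
    unfolding e by (rule prim_sum_zeta_series[OF p]) (use s in simp)
  finally show thesis using 1 by (intro that[of "infsum f (lattice - {0})"]) (auto simp: f_def intro!: infsum_nonneg)
qed

text \<open>Multiplying by \<open>2 * zeta_series (x + 2)\<close> turns the sum over primitive vectors into the full lattice sum, to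
which \<open>cube_lattice_sum\<close> applies.\<close>
lemma constant_term_real:
  assumes g: "is_iwasawa g n1 n2 n3 n4 n5 y1 y2" and gS: "g \<in> Sp4R" and x: "x > 2"
  defines "z \<equiv> Complex (- n1) (y1 / y2)"
  shows "2 * zeta_series (of_real (x + 2)) * constant_term g (of_real x) = 
     of_real (y1 powr (x + 2)) * (zeta_series (of_real (x + 2)) * prim_sum (tau_norm z) (of_real (x + 2))) + 
     of_real (y1 * y2 * (2 * pi / x) * y2 powr (- x)) * (zeta_series (of_real x) * prim_sum (tau_norm z) (of_real x))"
proof -
  have y: "y1 > 0" "y2 > 0" using g by (auto simp: is_iwasawa_def)
  have z: "Im z > 0" using y by (simp add: z_def)
  define s where "s = x + 2"
  have s: "s > 4" using x by (simp add: s_def)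
  interpret F: linear_family "cbox (0::real^3) 1" "\<lambda>S v. v v* (n_alpha S ** g)" using linear_family_n[OF gS] .
  interpret G: linear_family "{0::real}" "\<lambda>_. \<lambda>v::real^2. of_real (v$1) * z + of_real (v$2)" using linear_family_z[OF z] .
  define N where "N = (\<lambda>S v. norm (v v* (n_alpha S ** g)))"
  define t where "t = (\<lambda>S. Re (zeta_series (of_real s) * prim_sum (N S) (of_real s)))"
  have tt: "t S \<ge> 0" "(\<integral>\<^sup>+v. ennreal (norm (v v* (n_alpha S ** g)) powr (- s)) \<partial>count_space lattice) = ennreal (t S)"
     "complex_of_real (t S) = zeta_series (of_real s) * prim_sum (N S) (of_real s)" if S: "S \<in> cbox 0 1" for S
  proof -
    obtain r where r: "r \<ge> 0" "(\<integral>\<^sup>+v. ennreal (norm (v v* (n_alpha S ** g)) powr (- s)) \<partial>count_space lattice) = ennreal r"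
      "complex_of_real r = zeta_series (of_real s) * prim_sum (\<lambda>v. norm (v v* (n_alpha S ** g))) (of_real s)"
      by (rule F.lattice_nn_sum[OF S, of s]) (use s in auto)
    have "t S = r" unfolding t_def N_def using r(3)[symmetric] by simp
    thus "t S \<ge> 0" "(\<integral>\<^sup>+v. ennreal (norm (v v* (n_alpha S ** g)) powr (- s)) \<partial>count_space lattice) = ennreal (t S)"
     "complex_of_real (t S) = zeta_series (of_real s) * prim_sum (N S) (of_real s)" using r by (simp_all add: N_def)
  qed
  have e: "\<exists>r\<ge>0. planar_sum z u = ennreal r \<and> complex_of_real r = zeta_series (of_real u) * prim_sum (tau_norm z) (of_real u)" if u: "u > 2" for u
  proof -
    obtain r where r: "r \<ge> 0" "(\<integral>\<^sup>+v. ennreal (norm (of_real (v$1) * z + of_real (v$2)) powr (- u)) \<partial>count_space (lattice :: (real^2) set)) = ennreal r"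
      "complex_of_real r = zeta_series (of_real u) * prim_sum (\<lambda>v::real^2. norm (of_real (v$1) * z + of_real (v$2))) (of_real u)"
      by (rule G.lattice_nn_sum[of 0 u]) (use u in auto)
    have "prim_sum (\<lambda>v::real^2. norm (of_real (v$1) * z + of_real (v$2))) = prim_sum (tau_norm z)" by (simp add: tau_norm_def[abs_def])
    thus ?thesis using r by (intro exI[of _ r]) (simp add: planar_sum_def)
  qed
  obtain e1 where e1: "e1 \<ge> 0" "planar_sum z s = ennreal e1" "complex_of_real e1 = zeta_series (of_real s) * prim_sum (tau_norm z) (of_real s)"
    using e[of s] s by auto
  obtain e2 where e2: "e2 \<ge> 0" "planar_sum z (s - 2) = ennreal e2" "complex_of_real e2 = zeta_series (of_real x) * prim_sum (tau_norm z) (of_real x)"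
    using e[of x] x by (auto simp: s_def)
  have sub: "unit_cube \<subseteq> cbox (0::real^3) 1" by (auto simp: unit_cube_def mem_box_cart less_imp_le)
  have ct: "continuous_on (cbox 0 1) t"
  proof -
    have "continuous_on (cbox 0 1 \<times> {w. Re w > 4}) (\<lambda>x. prim_sum (N (fst x)) (snd x))" using F.prim_sum_joint_hol by (simp add: joint_hol_def case_prod_unfold N_def)
    hence "continuous_on (cbox 0 1) (\<lambda>S. prim_sum (N (fst (S, complex_of_real s))) (snd (S, complex_of_real s)))"
      by (rule continuous_on_compose2[where f = "\<lambda>S. (S, complex_of_real s)"]) (use s in \<open>auto intro!: continuous_intros\<close>)
    thus ?thesis unfolding t_def by (auto intro!: continuous_intros)
  qed
  define c where "c = y1 * y2 * (2 * pi / x) * y2 powr (- x)"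
  have c0: "c \<ge> 0" using y x by (simp add: c_def)
  have A: "(LINT S:unit_cube|lborel. t S) = y1 powr s * e1 + c * e2"
  proof -
    have int: "integrable lborel (\<lambda>S. indicator unit_cube S *\<^sub>R t S)" using set_integrable_unit_cube[OF ct] by (simp add: set_integrable_def)
    have nn: "0 \<le> indicator unit_cube S *\<^sub>R t S" for S using tt(1) sub by (auto simp: indicator_def)
    have "ennreal (LINT S:unit_cube|lborel. t S) = (\<integral>\<^sup>+S. ennreal (indicator unit_cube S *\<^sub>R t S) \<partial>lborel)"
      unfolding set_lebesgue_integral_def by (rule nn_integral_eq_integral[OF int, symmetric]) (use nn in simp)
    also have "\<dots> = (\<integral>\<^sup>+S. indicator unit_cube S * (\<integral>\<^sup>+v. ennreal (norm (v v* (n_alpha S ** g)) powr (- s)) \<partial>count_space lattice) \<partial>lborel)"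
    proof (rule nn_integral_cong)
      fix S :: "real^3"
      show "ennreal (indicator unit_cube S *\<^sub>R t S) = indicator unit_cube S * (\<integral>\<^sup>+v. ennreal (norm (v v* (n_alpha S ** g)) powr (- s)) \<partial>count_space lattice)"
      proof (cases "S \<in> unit_cube")
        case True
        thus ?thesis using tt(2)[of S] sub by auto
      qed simp
    qed
    also have "\<dots> = ennreal (y1 powr s) * planar_sum z s + ennreal (y1 * y2 * (pi / (s / 2 - 1)) * y2 powr (2 - s)) * planar_sum z (s - 2)"
      unfolding z_def by (rule cube_lattice_sum[OF g]) (use s in simp)
    also have "y1 * y2 * (pi / (s / 2 - 1)) * y2 powr (2 - s) = c"
      using x by (simp add: c_def s_def field_simps)
    also have "ennreal (y1 powr s) * planar_sum z s + ennreal c * planar_sum z (s - 2) = ennreal (y1 powr s * e1 + c * e2)"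
      unfolding e1 e2 using e1(1) e2(1) c0 by (simp add: ennreal_mult)
    finally have "ennreal (LINT S:unit_cube|lborel. t S) = ennreal (y1 powr s * e1 + c * e2)" .
    moreover have "(LINT S:unit_cube|lborel. t S) \<ge> 0" unfolding set_lebesgue_integral_def
      by (rule integral_nonneg_AE) (use nn in simp)
    ultimately show ?thesis using e1(1) e2(1) c0 by (subst (asm) ennreal_inj) auto
  qed
  have E: "E_beta (n_alpha S ** g) (of_real x) = 1/2 * prim_sum (N S) (of_real s)" if "S \<in> cbox 0 1" for S
  proof -
    obtain D W where "\<And>S \<nu>. S \<in> cbox 0 1 \<Longrightarrow> Re \<nu> > 2 \<Longrightarrow> E_beta (n_alpha S ** g) \<nu> = 1/2 * prim_sum (\<lambda>v. norm (v v* (n_alpha S ** g))) (\<nu> + 2)"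
      by (rule E_beta_family[OF gS order_refl], rule that; assumption)
    from this[of S "of_real x"] that x show ?thesis by (simp add: N_def s_def)
  qed
  have "2 * zeta_series (of_real s) * constant_term g (of_real x) = 2 * zeta_series (of_real s) * (LINT S:unit_cube|lborel. E_beta (n_alpha S ** g) (of_real x))"
    by (simp add: constant_term_def unit_cube_def)
  also have "\<dots> = (LINT S:unit_cube|lborel. 2 * zeta_series (of_real s) * E_beta (n_alpha S ** g) (of_real x))"
    by simp
  also have "\<dots> = (LINT S:unit_cube|lborel. complex_of_real (t S))"
  proof (rule set_lebesgue_integral_cong)
    show "\<forall>S. S \<in> unit_cube \<longrightarrow> 2 * zeta_series (of_real s) * E_beta (n_alpha S ** g) (of_real x) = complex_of_real (t S)"
    proof safe
      fix S assume "S \<in> unit_cube"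
      hence S: "S \<in> cbox 0 1" using sub by blast
      show "2 * zeta_series (of_real s) * E_beta (n_alpha S ** g) (of_real x) = complex_of_real (t S)"
        unfolding E[OF S] tt(3)[OF S] by simp
    qed
  qed simp
  also have "\<dots> = of_real (LINT S:unit_cube|lborel. t S)"
    by (simp add: set_lebesgue_integral_def flip: integral_complex_of_real) (simp add: scaleR_conv_of_real)
  also have "\<dots> = of_real (y1 powr s) * of_real e1 + of_real c * of_real e2" unfolding A by simp
  finally show ?thesis unfolding e1 e2 c_def s_def .
qed

text \<open>The intermediate factor \<open>Lambda (x + 1)\<close> cancels because it does not vanish, and
\<open>Gamma (x / 2 + 1) = (x / 2) * Gamma (x / 2)\<close> leaves \<open>2 * pi / x\<close>.\<close>
lemma Lambda_ratio:
  assumes x: "x > 1"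
  shows "(Lambda (of_real x) / Lambda (of_real x + 1)) * (Lambda (of_real x + 1) / Lambda (of_real x + 2)) = 
     of_real (2 * pi / x) * zeta_series (of_real x) / zeta_series (of_real (x + 2))"
proof -
  have L: "Lambda (of_real u) = of_real pi powr (- of_real u / 2) * Gamma (of_real u / 2) * zeta_series (of_real u)" if "u > 1" for u
    using that by (simp add: Lambda_def zeta_eq)
  have G: "Gamma (complex_of_real u / 2) \<noteq> 0" if "u > 1" for u
  proof -
    have "Gamma (u / 2) > 0" using that by (intro Gamma_real_pos) auto
    moreover have "Gamma (complex_of_real (u / 2)) = of_real (Gamma (u / 2))" by (rule Gamma_complex_of_real)
    ultimately show ?thesis by auto
  qed
  have nz: "Lambda (of_real u) \<noteq> 0" if "u > 1" for u
    using that G[OF that] zeta_series_real[OF that] by (simp add: L)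
  have "Lambda (of_real x + 1) \<noteq> 0" using nz[of "x + 1"] x by simp
  hence "(Lambda (of_real x) / Lambda (of_real x + 1)) * (Lambda (of_real x + 1) / Lambda (of_real x + 2)) = Lambda (of_real x) / Lambda (of_real (x + 2))"
    by simp
  also have "\<dots> = (of_real pi powr (- of_real x / 2) * Gamma (of_real x / 2) * zeta_series (of_real x)) / 
     (of_real pi powr (- of_real (x + 2) / 2) * Gamma (of_real (x + 2) / 2) * zeta_series (of_real (x + 2)))"
    using x by (simp only: L)
  also have "complex_of_real pi powr (- of_real (x + 2) / 2) = of_real pi powr (- of_real x / 2) / of_real pi"
  proof -
    have "- complex_of_real (x + 2) / 2 = - of_real x / 2 - 1" by (simp add: field_simps)
    hence "complex_of_real pi powr (- of_real (x + 2) / 2) = of_real pi powr (- of_real x / 2 - 1)" by (simp only:)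
    thus ?thesis by (simp add: powr_diff)
  qed
  also have "Gamma (complex_of_real (x + 2) / 2) = (of_real x / 2) * Gamma (of_real x / 2)"
  proof -
    have "complex_of_real x / 2 \<noteq> 0" using x by simp
    moreover have "complex_of_real x / 2 \<notin> \<int>\<^sub>\<le>\<^sub>0" using x by (auto elim!: nonpos_Ints_cases simp: complex_eq_iff)
    ultimately have "Gamma (complex_of_real x / 2 + 1) = (of_real x / 2) * Gamma (of_real x / 2)"
      by (intro Gamma_plus1)
    thus ?thesis by (simp add: add_divide_distrib)
  qed
  finally show ?thesis using G[OF x] x by (simp add: field_simps)
qed

lemma Gamma_meromorphic: "Gamma meromorphic_on (UNIV :: complex set)"
proof -
  have eq: "(Gamma :: complex \<Rightarrow> complex) = (\<lambda>z. inverse (rGamma z))" by (auto simp: rGamma_inverse_Gamma)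
  show ?thesis unfolding eq by (intro meromorphic_on_inverse analytic_on_imp_meromorphic_on analytic_rGamma)
qed

lemma Lambda_meromorphic: "Lambda meromorphic_on UNIV"
proof -
  have "(\<lambda>s. Gamma (s / 2)) meromorphic_on UNIV"
    by (rule meromorphic_on_compose[OF Gamma_meromorphic]) (auto intro!: analytic_intros)
  moreover have "(\<lambda>s. complex_of_real pi powr (- s / 2)) meromorphic_on UNIV"
    by (intro analytic_on_imp_meromorphic_on) (auto intro!: holomorphic_intros simp: analytic_on_open)
  ultimately show ?thesis unfolding Lambda_def[abs_def]
    using nicely_imp_meromorphic[OF zeta_nicely] by (intro meromorphic_on_mult)
qed

lemma meromorphic_affine:
  assumes "f meromorphic_on UNIV"
  shows "(\<lambda>s. f (a * s + b)) meromorphic_on UNIV"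
  by (rule meromorphic_on_compose[OF assms]) (auto intro!: analytic_intros)

theorem corollary7p7:
  fixes g :: "real^4^4"
  assumes "g \<in> Sp4R"
  shows "mero_eq (constant_term g) (\<lambda>\<nu>. C_s_beta g \<nu> + C_s_beta_alpha_beta g \<nu>)"
proof -
  obtain n1 n2 n3 n4 n5 y1 y2 where i: "is_iwasawa g n1 n2 n3 n4 n5 y1 y2" using iwasawa_exists[OF assms] by blast
  have y: "y1 > 0" "y2 > 0" using i by (auto simp: is_iwasawa_def)
  define z where "z = Complex (- n1) (y1 / y2)"
  have z: "Im z > 0" "Im z = y1 / y2" using y by (auto simp: z_def)
  have zz: "- of_real n1 + of_real (y1 / y2) * \<i> = z" by (simp add: z_def complex_eq_iff)
  have C1: "C_s_beta g = (\<lambda>\<nu>. E_SL2 z ((\<nu> + 1) / 2) * of_real y1 powr (\<nu> / 2 + 1) * of_real y2 powr (\<nu> / 2 + 1))"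
    unfolding C_s_beta_def[abs_def] iwasawa_coords[OF i] zz ..
  have C2: "C_s_beta_alpha_beta g = (\<lambda>\<nu>. (Lambda \<nu> / Lambda (\<nu> + 1)) * (Lambda (\<nu> + 1) / Lambda (\<nu> + 2)) *
     E_SL2 z ((\<nu> - 1) / 2) * of_real y1 powr (- \<nu> / 2 + 1) * of_real y2 powr (- \<nu> / 2 + 1))"
    unfolding C_s_beta_alpha_beta_def[abs_def] iwasawa_coords[OF i] zz ..
  have powm: "(\<lambda>\<nu>. complex_of_real u powr (h \<nu>)) meromorphic_on UNIV" if "u > 0" "h holomorphic_on UNIV" for u h
    using that by (intro analytic_on_imp_meromorphic_on) (auto intro!: holomorphic_intros simp: analytic_on_open)
  have Em: "(\<lambda>\<nu>. E_SL2 z ((\<nu> + c) / 2)) meromorphic_on UNIV" for c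
    using meromorphic_affine[OF nicely_imp_meromorphic[OF E_SL2_nicely[OF z(1)]], of "1/2" "c/2"] by (simp add: add_divide_distrib)
  have Lm: "(\<lambda>\<nu>. Lambda (\<nu> + c)) meromorphic_on UNIV" for c
    using meromorphic_affine[OF Lambda_meromorphic, of 1 c] by simp
  have m1: "C_s_beta g meromorphic_on UNIV" unfolding C1
    using y by (intro meromorphic_on_mult Em powm) (auto intro!: holomorphic_intros)
  have m2: "C_s_beta_alpha_beta g meromorphic_on UNIV" unfolding C2
    using y Em[of "-1"] by (intro meromorphic_on_mult meromorphic_on_divide Lm Lambda_meromorphic powm) (auto intro!: holomorphic_intros)
  have m: "(\<lambda>\<nu>. C_s_beta g \<nu> + C_s_beta_alpha_beta g \<nu>) meromorphic_on UNIV" by (intro meromorphic_on_add m1 m2)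
  have eq: "constant_term g (of_real x) = C_s_beta g (of_real x) + C_s_beta_alpha_beta g (of_real x)" if x: "x > 2" for x
  proof -
    define P1 where "P1 = prim_sum (tau_norm z) (of_real (x + 2))"
    define P2 where "P2 = prim_sum (tau_norm z) (of_real x)"
    define l1 where "l1 = complex_of_real (ln y1)"
    define l2 where "l2 = complex_of_real (ln y2)"
    define X where "X = complex_of_real x"
    \<comment> \<open>Everything is rewritten by \<open>exp\<close> of linear forms in \<open>ln y1\<close> and \<open>ln y2\<close>.\<close>
    define h where "h = X / 2"
    have X2: "X = 2 * h" by (simp add: h_def)
    have po: "complex_of_real y1 powr a = exp (a * l1)" "complex_of_real y2 powr a = exp (a * l2)" "complex_of_real (y1 / y2) powr a = exp (a * (l1 - l2))" for a
      using y by (simp_all add: of_real_powr_exp ln_div l1_def l2_def del: of_real_divide)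
    have nz: "zeta_series (of_real (x + 2)) \<noteq> 0" using x by (intro zeta_series_real) auto
    have a1: "(X + 1) / 2 + 1/2 = X / 2 + 1" "2 * ((X + 1) / 2) + 1 = of_real (x + 2)" by (simp_all add: X_def field_simps)
    have "E_SL2 z ((X + 1) / 2) = 1/2 * (exp ((X / 2 + 1) * (l1 - l2)) * P1)"
      using E_SL2_eq[OF z(1), of "(X + 1) / 2"] x unfolding a1 z(2) po by (simp add: X_def P1_def)
    hence "C_s_beta g X = 1/2 * P1 * (exp ((X / 2 + 1) * (l1 - l2)) * exp ((X / 2 + 1) * l1) * exp ((X / 2 + 1) * l2))"
      unfolding C1 po by simp
    also have "exp ((X / 2 + 1) * (l1 - l2)) * exp ((X / 2 + 1) * l1) * exp ((X / 2 + 1) * l2) = exp ((X + 2) * l1)"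
      unfolding exp_add[symmetric] X2 by (simp add: algebra_simps)
    also have "\<dots> = of_real (y1 powr (x + 2))" using y powr_of_real[of y1 "x + 2"] by (simp add: po[symmetric] X_def)
    finally have c1: "C_s_beta g X = 1/2 * P1 * of_real (y1 powr (x + 2))" .
    have a2: "(X - 1) / 2 + 1/2 = X / 2" "2 * ((X - 1) / 2) + 1 = of_real x" by (simp_all add: X_def field_simps)
    have E2: "E_SL2 z ((X - 1) / 2) = 1/2 * (exp ((X / 2) * (l1 - l2)) * P2)"
      using E_SL2_eq[OF z(1), of "(X - 1) / 2"] x unfolding a2 z(2) po by (simp add: X_def P2_def)
    have "C_s_beta_alpha_beta g X = (Lambda X / Lambda (X + 1)) * (Lambda (X + 1) / Lambda (X + 2)) * 
       (1/2 * P2 * (exp ((X / 2) * (l1 - l2)) * exp ((- X / 2 + 1) * l1) * exp ((- X / 2 + 1) * l2)))"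
      unfolding C2 po E2 by (simp only: mult_ac)
    also have "exp ((X / 2) * (l1 - l2)) * exp ((- X / 2 + 1) * l1) * exp ((- X / 2 + 1) * l2) = exp (1 * l1) * exp (1 * l2) * exp ((- X) * l2)"
      unfolding exp_add[symmetric] X2 by (simp add: algebra_simps)
    also have "\<dots> = of_real (y1 * y2 * y2 powr (- x))"
      using y powr_of_real[of y2 "- x"] unfolding po[symmetric] by (simp add: X_def)
    also have "(Lambda X / Lambda (X + 1)) * (Lambda (X + 1) / Lambda (X + 2)) = of_real (2 * pi / x) * zeta_series X / zeta_series (of_real (x + 2))"
      unfolding X_def by (rule Lambda_ratio) (use x in simp)
    finally have c2: "C_s_beta_alpha_beta g X = of_real (2 * pi / x) * zeta_series X / zeta_series (of_real (x + 2)) * (1/2 * P2 * of_real (y1 * y2 * y2 powr (- x)))" .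
    have "2 * zeta_series (of_real (x + 2)) * constant_term g X = 2 * zeta_series (of_real (x + 2)) * (C_s_beta g X + C_s_beta_alpha_beta g X)"
      unfolding X_def constant_term_real[OF i assms x] 
      unfolding z_def[symmetric] P1_def[symmetric] P2_def[symmetric] unfolding X_def[symmetric] c1 c2 distrib_left
      using nz by simp
    thus ?thesis using nz by (simp add: X_def)
  qed
  have "\<forall>\<^sub>\<approx>\<nu>\<in>UNIV. constant_term g \<nu> = C_s_beta g \<nu> + C_s_beta_alpha_beta g \<nu>"
  proof (rule meromorphic_identity[OF constant_term_meromorphic[OF assms] m open_UNIV connected_UNIV UNIV_I])
    show "\<exists>\<^sub>F \<nu> in at (of_real 3). constant_term g \<nu> = C_s_beta g \<nu> + C_s_beta_alpha_beta g \<nu>"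
    proof (rule frequently_at[THEN iffD2], safe)
      fix d :: real assume "d > 0"
      thus "\<exists>\<nu>\<in>UNIV. \<nu> \<noteq> complex_of_real 3 \<and> dist \<nu> (complex_of_real 3) < d \<and> constant_term g \<nu> = C_s_beta g \<nu> + C_s_beta_alpha_beta g \<nu>"
        using eq[of "3 + d / 2"] by (intro bexI[of _ "of_real (3 + d / 2)"]) (auto simp: dist_norm complex_eq_iff)
    qed
  qed
  thus ?thesis unfolding mero_eq_def using constant_term_meromorphic[OF assms] m by blast
qed

end
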